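(* Let $G=(V,E)$ be a finite decomposable connected graph with at least two vertices. 1) Let $X$ be an $M_G$-valued random vector. If for every moral DAG $\mathcal G$ with skeleton $G$ the random variables $u_i^{\mathcal G}(X)$, $i\in V$, are independent, then $X$ has a $G$-Dirichlet distribution, i.e. $X\sim\operatorname{Dir}_G(\alpha,\beta)$ for some $\alpha\in(0,\infty)^V$ and $\beta>0$. 2) Let $Y$ be a $(0,\infty)^V$-valued random vector. If for every moral DAG $\mathcal G$ with skeleton $G$ the random variables $w_i^{\mathcal G}(Y)$, $i\in V$, are independent, then $Y$ has a $G$-inverted Dirichlet distribution, i.e. $Y\sim\operatorname{IDir}_G(\alpha,\beta)$ for some $\alpha\in(0,\infty)^V$ and $\beta>\max_{C\in\mathcal C_G^+}\sum_{i\in C}\alpha_i$.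
   Context: $G=(V,E)$ is a finite undirected simple graph; $G^*$ its complement graph; $G_A$ the subgraph induced by $A\subset V$. A clique is a set of pairwise adjacent vertices ($\emptyset$ and singletons are cliques); $\mathcal C_G$ is the set of cliques and $\mathcal C_G^+$ the set of maximal cliques. $G$ is decomposable iff it is chordal (no induced cycle of length greater than 3). A moral DAG $\mathcal G$ with skeleton $G$ is an orientation of all edges of $G$ without directed cycles such that any two distinct parents of a common vertex are adjacent. $\mathfrak{de}(i)$ is the set of descendants of $i$ in $\mathcal G$ (vertices reachable from $i$ by a directed path of length at least 1), $\overline{\mathfrak{de}}(i)=\mathfrak{de}(i)\cup\{i\}$. $\Delta_G(x)=\sum_{C\in\mathcal C_{G^*}}(-1)^{|C|}\prod_{i\in C}x_i$, $\delta_G(y)=\sum_{C\in\mathcal C_{G^*}}\prod_{i\in C}y_i$; for $A\subset V$, $\Delta_A(x):=\Delta_{G_A}(x_A)$, $\delta_A(y):=\delta_{G_A}(y_A)$, $\Delta_\emptyset=\delta_\emptyset=1$, $x_A=(x_i)_{i\in A}$. $M_G=\{x\in(0,\infty)^V:\Delta_A(x)>0\ \forall A\subset V\}$. For $x\in M_G$ and $y\in(0,\infty)^V$: $$u_i^{\mathcal G}(x)=1-\frac{\Delta_{\overline{\mathfrak{de}}(i)}(x)}{\Delta_{\mathfrak{de}(i)}(x)},\qquad w_i^{\mathcal G}(y)=\frac{\delta_{\overline{\mathfrak{de}}(i)}(y)}{\delta_{\mathfrak{de}(i)}(y)}-1,\qquad i\in V.$$ For $\alpha\in(0,\infty)^V$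 and $\beta>0$, $\operatorname{Dir}_G(\alpha,\beta)$ is the probability distribution on $\mathbb R^V$ with Lebesgue density proportional to $\Delta_G(x)^{\beta-1}\prod_{i\in V}x_i^{\alpha_i-1}\mathbf 1_{M_G}(x)$. For $\alpha\in(0,\infty)^V$ and $\beta>\max_{C\in\mathcal C_G^+}\sum_{i\in C}\alpha_i$, $\operatorname{IDir}_G(\alpha,\beta)$ is the probability distribution on $\mathbb R^V$ with Lebesgue density proportional to $\delta_G(y)^{-\beta}\prod_{i\in V}y_i^{\alpha_i-1}\mathbf 1_{(0,\infty)^V}(y)$.
   Formalization: X (in part 1) and Y (in part 2) are additionally assumed not to be almost surely constant; a constant vector has independent u_i (resp. w_i) for every moral DAG but has no Lebesgue density, so the claim fails for it. *)

theory Defs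
  imports "HOL-Probability.Probability"
begin

text \<open>
  Graphs are given by a vertex set and an adjacency relation. The ambient vertex set of the graph
  under study is the whole finite type \<open>'v\<close>, so that $\mathbb R^V$ is \<^typ>\<open>real^'v\<close>; explicit vertex
  sets \<open>A\<close> are only needed for induced subgraphs.
\<close>

definition simple_graph :: "'v rel \<Rightarrow> bool" where
  "simple_graph E \<longleftrightarrow> sym E \<and> irrefl E"

definition connected_graph :: "'v rel \<Rightarrow> bool" where
  "connected_graph E \<longleftrightarrow> (\<forall>i j. (i, j) \<in> E\<^sup>*)"

definition induced_subgraph :: "'v set \<Rightarrow> 'v rel \<Rightarrow> 'v rel" where
  "induced_subgraph A E = E \<inter> A \<times> A"

definition complement_graph :: "'v set \<Rightarrow> 'v rel \<Rightarrow> 'v rel" where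
  "complement_graph A E = {(i, j) \<in> A \<times> A. i \<noteq> j \<and> (i, j) \<notin> E}"

definition cliques :: "'v set \<Rightarrow> 'v rel \<Rightarrow> 'v set set" where
  "cliques A E = {C. C \<subseteq> A \<and> (\<forall>i\<in>C. \<forall>j\<in>C. i \<noteq> j \<longrightarrow> (i, j) \<in> E)}"

definition maximal_cliques :: "'v set \<Rightarrow> 'v rel \<Rightarrow> 'v set set" where
  "maximal_cliques A E = {C \<in> cliques A E. \<forall>C'\<in>cliques A E. C \<subseteq> C' \<longrightarrow> C' = C}"

definition induced_cycle :: "'v rel \<Rightarrow> 'v list \<Rightarrow> bool" where
  "induced_cycle E vs \<longleftrightarrow> length vs \<ge> 3 \<and> distinct vs \<and>
     (\<forall>a<length vs. \<forall>b<length vs.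
        (vs ! a, vs ! b) \<in> E \<longleftrightarrow> b = Suc a mod length vs \<or> a = Suc b mod length vs)"

definition chordal :: "'v rel \<Rightarrow> bool" where
  "chordal E \<longleftrightarrow> (\<nexists>vs. induced_cycle E vs \<and> length vs > 3)"

text \<open>
  \<open>(i, j) \<in> D\<close> stands for the arrow $i \to j$. Acyclicity excludes that both orientations of an edge
  are present, so \<open>D \<union> D\<inverse> = E\<close> says that each edge of \<open>E\<close> is oriented in exactly one way.
\<close>

definition moral_dag :: "'v rel \<Rightarrow> 'v rel \<Rightarrow> bool" where
  "moral_dag E D \<longleftrightarrow> D \<union> D\<inverse> = E \<and> acyclic D \<and>
     (\<forall>i j k. (i, k) \<in> D \<and> (j, k) \<in> D \<and> i \<noteq> j \<longrightarrow> (i, j) \<in> E)"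

definition desc :: "'v rel \<Rightarrow> 'v \<Rightarrow> 'v set" where
  "desc D i = {j. (i, j) \<in> D\<^sup>+}"

definition desc_refl :: "'v rel \<Rightarrow> 'v \<Rightarrow> 'v set" where
  "desc_refl D i = desc D i \<union> {i}"

text \<open>
  \<open>Delta E A x\<close> is $\Delta_{G_A}(x_A)$ and \<open>delta E A y\<close> is $\delta_{G_A}(y_A)$: the sums range over the
  cliques of the complement of the induced subgraph, with \<open>A = UNIV\<close> giving $\Delta_G$ and $\delta_G$.
\<close>

definition Delta :: "'v rel \<Rightarrow> 'v set \<Rightarrow> real^'v \<Rightarrow> real" where
  "Delta E A x =
     (\<Sum>C\<in>cliques A (complement_graph A (induced_subgraph A E)). (- 1) ^ card C * (\<Prod>i\<in>C. x $ i))"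

definition delta :: "'v rel \<Rightarrow> 'v set \<Rightarrow> real^'v \<Rightarrow> real" where
  "delta E A y =
     (\<Sum>C\<in>cliques A (complement_graph A (induced_subgraph A E)). \<Prod>i\<in>C. y $ i)"

definition pos_orthant :: "(real^'v) set" where
  "pos_orthant = {x. \<forall>i. 0 < x $ i}"

definition M_set :: "'v rel \<Rightarrow> (real^'v) set" where
  "M_set E = {x \<in> pos_orthant. \<forall>A. Delta E A x > 0}"

definition u :: "'v rel \<Rightarrow> 'v rel \<Rightarrow> 'v \<Rightarrow> real^'v \<Rightarrow> real" where
  "u E D i x = 1 - Delta E (desc_refl D i) x / Delta E (desc D i) x"

definition w :: "'v rel \<Rightarrow> 'v rel \<Rightarrow> 'v \<Rightarrow> real^'v \<Rightarrow> real" where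
  "w E D i y = delta E (desc_refl D i) y / delta E (desc D i) y - 1"

definition dirichlet_kernel :: "('v::finite) rel \<Rightarrow> real^'v \<Rightarrow> real \<Rightarrow> real^'v \<Rightarrow> real" where
  "dirichlet_kernel E \<alpha> \<beta> x =
     Delta E UNIV x powr (\<beta> - 1) * (\<Prod>i\<in>UNIV. x $ i powr (\<alpha> $ i - 1)) * indicator (M_set E) x"

definition inv_dirichlet_kernel :: "('v::finite) rel \<Rightarrow> real^'v \<Rightarrow> real \<Rightarrow> real^'v \<Rightarrow> real" where
  "inv_dirichlet_kernel E \<alpha> \<beta> y =
     delta E UNIV y powr (- \<beta>) * (\<Prod>i\<in>UNIV. y $ i powr (\<alpha> $ i - 1)) * indicator pos_orthant y"

text \<open>
  The constant \<open>c\<close> is the normalisation; it is determined by \<open>M\<close> being a probability space.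
  The parameter ranges are imposed where the distributions are used.
\<close>

definition has_Dir ::
  "'a measure \<Rightarrow> ('a \<Rightarrow> real^'v) \<Rightarrow> ('v::finite) rel \<Rightarrow> real^'v \<Rightarrow> real \<Rightarrow> bool" where
  "has_Dir M X E \<alpha> \<beta> \<longleftrightarrow>
     (\<exists>c>0. distributed M lborel X (\<lambda>x. ennreal (c * dirichlet_kernel E \<alpha> \<beta> x)))"

definition has_IDir ::
  "'a measure \<Rightarrow> ('a \<Rightarrow> real^'v) \<Rightarrow> ('v::finite) rel \<Rightarrow> real^'v \<Rightarrow> real \<Rightarrow> bool" where
  "has_IDir M Y E \<alpha> \<beta> \<longleftrightarrow>
     (\<exists>c>0. distributed M lborel Y (\<lambda>y. ennreal (c * inv_dirichlet_kernel E \<alpha> \<beta> y)))"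

text \<open>
  An almost surely constant vector satisfies every independence condition trivially, but has no
  density. Characterizations by independence therefore presuppose the following; single coordinates
  are not required to be non-constant.
\<close>

definition nondegenerate :: "'a measure \<Rightarrow> ('a \<Rightarrow> 'b) \<Rightarrow> bool" where
  "nondegenerate M X \<longleftrightarrow> (\<nexists>c. AE \<omega> in M. X \<omega> = c)"

end

theory Submission
  imports Defs
begin

text \<open>
  Why the theorem is true. Along a moral orientation \<open>D\<close> the coordinates \<open>v i = u E D i x\<close> determine
  \<open>x\<close> by the triangular formula \<open>x i = v i * (\<Prod>c. 1 - v c)\<close>, the product ranging over the children of
  \<open>i\<close> (\<open>phi_u\<close>), and \<open>Delta E UNIV x\<close> is the product of all \<open>1 - v i\<close> (\<open>Delta_phi\<close>). The second
  statement concerns the same formulas, since \<open>delta E A y = Delta E A (- y)\<close> and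
  \<open>w E D i y = - u E D i (- y)\<close>.

  Call an edge from \<open>i\<close> to \<open>j\<close> covered if the parents of \<open>j\<close> are \<open>i\<close> and the parents of \<open>i\<close>. Reversing
  a covered edge gives another moral orientation, and changes only the coordinates of \<open>i\<close> and \<open>j\<close>,
  according to \<open>v' i = v i * (1 - v j)\<close> and \<open>v j = v' j * (1 - v' i)\<close> (\<open>u_flip\<close>). If both pairs are
  independent, this is the case of a single edge, that is, of Dirichlet vectors with three components.
  There the mixed moments factor in two ways, and comparing those of low order shows that each of the
  four variables is beta, with linked parameters, or that all four are constant
  (\<open>beta_characterization_on_edge\<close>). No density has to be assumed.

  It remains to reach every coordinate of every orientation. The law of \<open>v j\<close> depends only on the
  descendants of \<open>j\<close>. In a chordal graph the other vertices can be reordered so that they begin with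
  the parents of \<open>j\<close>, with any chosen parent last, which makes the edge from this parent to \<open>j\<close> covered
  (\<open>moral_dag_reorient_above\<close>); this rests on the existence of a simplicial vertex outside any given
  clique. An induction on the number of parents expresses all parameters by one \<open>\<alpha> i\<close> per vertex and
  one \<open>\<beta>\<close>, which is common to all sources because the graph is connected
  (\<open>beta_parameters_propagate\<close>). The constant alternative spreads in the same way to all
  coordinates, and is excluded as the vector is nondegenerate.

  Finally, for any single orientation the coordinates are independent with known densities, and the
  triangular change of variables, whose Jacobian is the product of the factors \<open>1 - v c\<close>, turns their
  product into the Dirichlet kernel (\<open>distributed_scale_on\<close>, \<open>kernel_along_orientation\<close>).
\<close>

section \<open>Perfect orderings of chordal graphs\<close>

text \<open>
  If \<open>s\<close> and \<open>t\<close> were not adjacent, a shortest path from \<open>s\<close> to \<open>t\<close> through \<open>B\<close> would be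
  chordless, and closing it through \<open>k\<close> would give an induced cycle of length at least four.
\<close>

lemma neighbours_of_connected_part_adjacent:
  assumes G: "simple_graph E" and ch: "chordal E"
    and ks: "(k, s) \<in> E" and kt: "(k, t) \<in> E" and st: "s \<noteq> t"
    and sB: "s \<notin> B" and tB: "t \<notin> B" and kB: "k \<notin> B" and kB': "\<And>b. b \<in> B \<Longrightarrow> (k, b) \<notin> E"
    and b1: "b1 \<in> B" "(s, b1) \<in> E" and b2: "b2 \<in> B" "(b2, t) \<in> E"
    and conn: "(b1, b2) \<in> (E \<inter> B \<times> B)\<^sup>*"
  shows "(s, t) \<in> E"
proof (rule ccontr)
  assume nst: "(s, t) \<notin> E"
  have symE: "\<And>a b. (a, b) \<in> E \<Longrightarrow> (b, a) \<in> E" and irr: "\<And>a. (a, a) \<notin> E"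
    using G by (auto simp: simple_graph_def sym_def irrefl_def)
  define W where "W = (\<lambda>n (p::nat \<Rightarrow> 'a). p 0 = s \<and> p n = t \<and>
    (\<forall>m<n. (p m, p (Suc m)) \<in> E) \<and> (\<forall>m. 0 < m \<and> m < n \<longrightarrow> p m \<in> B))"
  have "\<exists>n p. W n p"
  proof -
    obtain l f where f: "f 0 = b1" "f l = b2" "\<And>m. m < l \<Longrightarrow> (f m, f (Suc m)) \<in> E \<inter> B \<times> B"
      using rtrancl_imp_relpow[OF conn] by (auto simp: relpow_fun_conv)
    have fB: "f m \<in> B" if "m \<le> l" for m
    proof (cases "m = l")
      case False
      then show ?thesis using f(3)[of m] that by simp
    qed (use f(2) b2 in simp)
    define p where "p m = (if m = 0 then s else if m \<le> Suc l then f (m - 1) else t)" for m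
    have "(p m, p (Suc m)) \<in> E" if "m < Suc (Suc l)" for m
    proof (cases m)
      case 0
      then show ?thesis using b1 f(1) by (simp add: p_def)
    next
      case (Suc m')
      then show ?thesis using that f(2) f(3)[of m'] b2
        by (cases "m' = l") (auto simp: p_def)
    qed
    then have "W (Suc (Suc l)) p"
      using fB by (auto simp: W_def p_def)
    then show ?thesis by blast
  qed
  then have ex: "\<exists>n. \<exists>p. W n p" .
  define n where "n = (LEAST n. \<exists>p. W n p)"
  obtain p where Wp: "W n p" using LeastI_ex[OF ex] n_def by blast
  have least: "n \<le> n'" if "W n' p'" for n' p'
    using Least_le[of "\<lambda>n. \<exists>p. W n p" n'] that n_def by blast
  have p0: "p 0 = s" and pn: "p n = t" and pE: "\<And>m. m < n \<Longrightarrow> (p m, p (Suc m)) \<in> E"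
    and pB: "\<And>m. 0 < m \<Longrightarrow> m < n \<Longrightarrow> p m \<in> B"
    using Wp by (auto simp: W_def)
  \<comment> \<open>a chord from \<open>p a\<close> to \<open>p b\<close> would allow a shorter walk, skipping what lies between\<close>
  have chord: "b = Suc a" if ab: "a < b" "b \<le> n" and e: "(p a, p b) \<in> E" for a b
  proof (rule ccontr)
    assume "b \<noteq> Suc a"
    then have gap: "Suc a < b" using ab by simp
    define q where "q m = (if m \<le> a then p m else p (m + (b - Suc a)))" for m
    have "W (n - (b - Suc a)) q"
      unfolding W_def
    proof (intro conjI allI impI)
      show "q 0 = s" by (simp add: q_def p0)
      have "\<not> n - (b - Suc a) \<le> a" "n - (b - Suc a) + (b - Suc a) = n" using gap ab by linarith+
      then show "q (n - (b - Suc a)) = t" by (simp add: q_def pn)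
      fix m assume m: "m < n - (b - Suc a)"
      show "(q m, q (Suc m)) \<in> E"
      proof (cases "m = a")
        case True
        then show ?thesis using e gap by (simp add: q_def)
      next
        case False
        then show ?thesis using pE[of m] pE[of "m + (b - Suc a)"] m gap ab
          by (auto simp: q_def)
      qed
    next
      fix m assume m: "0 < m \<and> m < n - (b - Suc a)"
      then show "q m \<in> B" using pB[of m] pB[of "m + (b - Suc a)"] gap ab by (auto simp: q_def)
    qed
    from least[OF this] show False using gap ab by simp
  qed
  have n1: "n \<noteq> 0" using p0 pn st by (cases "n = 0") simp_all
  have n2: "n \<ge> 2"
  proof -
    have "n \<noteq> 1" using pE[of 0] p0 pn nst by auto
    then show ?thesis using n1 by simp
  qed
  have neq: "p a \<noteq> p b" if ab: "a < b" "b \<le> n" for a b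
  proof
    assume eq: "p a = p b"
    show False
    proof (cases "b = n")
      case True
      then show False using eq pn p0 st pB[of a] tB ab by (cases "a = 0") auto
    next
      case False
      then show False using chord[of a "Suc b"] pE[of b] eq ab by simp
    qed
  qed
  have adj: "(p a, p b) \<in> E \<longleftrightarrow> b = Suc a \<or> a = Suc b" if "a \<le> n" "b \<le> n" for a b
  proof (cases a b rule: linorder_cases)
    case less
    then show ?thesis using chord[of a b] pE[of a] that by auto
  next
    case equal
    then show ?thesis using irr by simp
  next
    case greater
    then show ?thesis using chord[of b a] pE[of b] that symE by auto
  qed
  have adjk: "(k, p m) \<in> E \<longleftrightarrow> m = 0 \<or> m = n" if "m \<le> n" for m
    using that pB[of m] kB' p0 pn ks kt by (cases "m = 0"; cases "m = n") auto
  have pk: "p m \<noteq> k" if "m \<le> n" for m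
    using that pB[of m] kB p0 pn ks kt irr by (cases "m = 0"; cases "m = n") auto
  define vs where "vs = k # map p [0..<Suc n]"
  have len: "length vs = n + 2" by (simp add: vs_def)
  have vs0: "vs ! 0 = k" by (simp add: vs_def)
  have vsS: "vs ! Suc m = p m" if "m \<le> n" for m
  proof -
    have "vs ! Suc m = map p [0..<Suc n] ! m" by (simp only: vs_def nth_Cons_Suc)
    also have "\<dots> = p m" using that by (subst nth_map) (auto simp del: upt_Suc)
    finally show ?thesis .
  qed
  have "distinct vs"
  proof -
    have "inj_on p (set [0..<Suc n])"
    proof (rule inj_onI)
      fix a b assume "a \<in> set [0..<Suc n]" "b \<in> set [0..<Suc n]" "p a = p b"
      then show "a = b" using neq[of a b] neq[of b a] by (cases a b rule: linorder_cases) auto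
    qed
    moreover have "k \<notin> p ` set [0..<Suc n]"
      using pk by (metis (no_types, lifting) atLeastLessThan_iff atLeastLessThan_upt imageE less_Suc_eq_le)
    ultimately show ?thesis unfolding vs_def by (simp only: distinct.simps distinct_map set_map) simp
  qed
  moreover have "(vs ! a, vs ! b) \<in> E \<longleftrightarrow> b = Suc a mod length vs \<or> a = Suc b mod length vs"
    if "a < length vs" "b < length vs" for a b
  proof -
    consider "a = 0" "b = 0" | b' where "a = 0" "b = Suc b'" | a' where "a = Suc a'" "b = 0"
      | a' b' where "a = Suc a'" "b = Suc b'"
      by (cases a; cases b) auto
    then show ?thesis
    proof cases
      case 1
      then show ?thesis using irr vs0 len n2 by simp
    next
      case 2
      then show ?thesis using that adjk[of b'] vs0 vsS[of b'] len
        by (cases "b' = n") auto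
    next
      case 3
      have "(p a', k) \<in> E \<longleftrightarrow> (k, p a') \<in> E" using symE by blast
      then show ?thesis using 3 that adjk[of a'] vs0 vsS[of a'] len
        by (cases "a' = n") auto
    next
      case 4
      then show ?thesis using that adj[of a' b'] vsS[of a'] vsS[of b'] len
        by (cases "a' = n"; cases "b' = n") auto
    qed
  qed
  ultimately have "induced_cycle E vs" using n2 len by (auto simp: induced_cycle_def)
  then show False using ch len n2 unfolding chordal_def by force
qed

text \<open>
  A form of Dirac's theorem. The case that matters is that some \<open>k \<in> K\<close> misses some vertex of \<open>A\<close>:
  a component \<open>B\<close> of the non-neighbours of \<open>k\<close> has a clique \<open>S\<close> as its boundary, and a simplicial
  vertex of \<open>B \<union> S\<close> outside \<open>S\<close> has all its neighbours in \<open>B \<union> S\<close>.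
\<close>

lemma simplicial_outside_clique:
  assumes G: "simple_graph E" and ch: "chordal E"
  shows "finite A \<Longrightarrow> K \<subset> A \<Longrightarrow> K \<in> cliques A E \<Longrightarrow>
    \<exists>v\<in>A - K. \<forall>a\<in>A. \<forall>b\<in>A. (a, v) \<in> E \<longrightarrow> (b, v) \<in> E \<longrightarrow> a \<noteq> b \<longrightarrow> (a, b) \<in> E"
proof (induction "card A" arbitrary: A K rule: less_induct)
  case less
  have symE: "\<And>a b. (a, b) \<in> E \<Longrightarrow> (b, a) \<in> E" and irr: "\<And>a. (a, a) \<notin> E"
    using G by (auto simp: simple_graph_def sym_def irrefl_def)
  have main: "\<exists>v\<in>A - K. \<forall>a\<in>A. \<forall>b\<in>A. (a, v) \<in> E \<longrightarrow> (b, v) \<in> E \<longrightarrow> a \<noteq> b \<longrightarrow> (a, b) \<in> E"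
    if KA: "K \<subset> A" and Kc: "K \<in> cliques A E" and ne: "K \<noteq> {}" for K
  proof -
    have K: "\<And>i j. i \<in> K \<Longrightarrow> j \<in> K \<Longrightarrow> i \<noteq> j \<Longrightarrow> (i, j) \<in> E" and KA': "K \<subseteq> A"
      using Kc by (auto simp: cliques_def)
    show ?thesis
    proof (cases "\<exists>k\<in>K. \<exists>c\<in>A. c \<noteq> k \<and> (k, c) \<notin> E")
      case True
      then obtain k c where k: "k \<in> K" and c: "c \<in> A" "c \<noteq> k" "(k, c) \<notin> E" by blast
      \<comment> \<open>\<open>B\<close> is the component of \<open>c\<close> among the non-neighbours \<open>W\<close> of \<open>k\<close>, and \<open>S\<close> its boundary\<close>
      define W where "W = {v \<in> A. v \<noteq> k \<and> (k, v) \<notin> E}"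
      define B where "B = {b. (c, b) \<in> (E \<inter> W \<times> W)\<^sup>*}"
      define S where "S = {s \<in> A - B. \<exists>b\<in>B. (b, s) \<in> E}"
      have cW: "c \<in> W" using c by (simp add: W_def)
      have BW: "B \<subseteq> W"
      proof
        fix b assume "b \<in> B"
        then have "(c, b) \<in> (E \<inter> W \<times> W)\<^sup>*" by (simp add: B_def)
        then show "b \<in> W" by (cases rule: rtranclE) (use cW in auto)
      qed
      have step: "b' \<in> B" if "b \<in> B" "b' \<in> W" "(b, b') \<in> E" for b b'
        using that BW rtrancl_into_rtrancl[of c b "E \<inter> W \<times> W" b'] by (auto simp: B_def)
      have fromc: "(c, b) \<in> (E \<inter> B \<times> B)\<^sup>*" if "b \<in> B" for b
      proof -
        have "(c, b) \<in> (E \<inter> W \<times> W)\<^sup>*" using that by (simp add: B_def)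
        then show ?thesis
        proof (induction rule: rtrancl_induct)
          case (step y z)
          then have "y \<in> B" "z \<in> B" by (auto simp: B_def intro: rtrancl_into_rtrancl)
          then show ?case using step by (auto intro: rtrancl_into_rtrancl)
        qed simp
      qed
      have symB: "sym ((E \<inter> B \<times> B)\<^sup>*)"
        by (rule sym_rtrancl) (use symE in \<open>auto simp: sym_def\<close>)
      have Sk: "(k, s) \<in> E" if "s \<in> S" for s
        using that step BW symE unfolding S_def W_def by blast
      have Sc: "S \<in> cliques (B \<union> S) E"
        unfolding cliques_def
      proof (intro CollectI conjI ballI impI)
        fix s t assume s: "s \<in> S" and t: "t \<in> S" and st: "s \<noteq> t"
        obtain b1 b2 where b: "b1 \<in> B" "(b1, s) \<in> E" "b2 \<in> B" "(b2, t) \<in> E"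
          using s t by (auto simp: S_def)
        show "(s, t) \<in> E"
        proof (rule neighbours_of_connected_part_adjacent[OF G ch Sk[OF s] Sk[OF t] st])
          show "(b1, b2) \<in> (E \<inter> B \<times> B)\<^sup>*"
            using fromc[OF b(1)] fromc[OF b(3)] symB by (meson rtrancl_trans symD)
        qed (use b s t symE BW in \<open>auto simp: S_def W_def\<close>)
      qed auto
      have "k \<notin> B \<union> S" using BW Sk irr by (auto simp: W_def)
      moreover have sub: "B \<union> S \<subseteq> A" using BW by (auto simp: W_def S_def)
      ultimately have "B \<union> S \<subset> A" using k KA' by blast
      then have "card (B \<union> S) < card A" using less.prems(1) by (simp add: psubset_card_mono)
      moreover have "finite (B \<union> S)" using sub less.prems(1) finite_subset by blast
      moreover have "S \<subset> B \<union> S" using fromc by (auto simp: S_def B_def)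
      ultimately have "\<exists>v\<in>(B \<union> S) - S. \<forall>a\<in>B \<union> S. \<forall>b\<in>B \<union> S.
          (a, v) \<in> E \<longrightarrow> (b, v) \<in> E \<longrightarrow> a \<noteq> b \<longrightarrow> (a, b) \<in> E"
        by (rule less.hyps[OF _ _ _ Sc])
      then obtain v where v: "v \<in> (B \<union> S) - S"
        and vs: "\<forall>a\<in>B \<union> S. \<forall>b\<in>B \<union> S. (a, v) \<in> E \<longrightarrow> (b, v) \<in> E \<longrightarrow> a \<noteq> b \<longrightarrow> (a, b) \<in> E"
        by (elim bexE)
      have "v \<in> B" using v by blast
      then have nb: "a \<in> B \<union> S" if "a \<in> A" "(a, v) \<in> E" for a
        using that symE by (auto simp: S_def)
      have "v \<notin> K" using K[OF k, of v] \<open>v \<in> B\<close> BW by (auto simp: W_def)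
      moreover have "v \<in> A" using \<open>v \<in> B\<close> sub by blast
      ultimately show ?thesis using vs nb by (intro bexI[of _ v]) auto
    next
      case False
      \<comment> \<open>\<open>k\<close> is adjacent to all of \<open>A\<close>, so it cannot spoil simpliciality and may be removed\<close>
      obtain k where k: "k \<in> K" using ne by blast
      have univ: "(k, c) \<in> E" if "c \<in> A" "c \<noteq> k" for c using False k that by blast
      have "card (A - {k}) < card A" using k KA' less.prems(1) by (intro psubset_card_mono) auto
      moreover have "K - {k} \<subset> A - {k}" using KA k by blast
      moreover have "K - {k} \<in> cliques (A - {k}) E" using Kc by (auto simp: cliques_def)
      ultimately obtain v where v: "v \<in> (A - {k}) - (K - {k})"
        and vs: "\<And>a b. a \<in> A - {k} \<Longrightarrow> b \<in> A - {k} \<Longrightarrow> (a, v) \<in> E \<Longrightarrow> (b, v) \<in> E \<Longrightarrow> a \<noteq> b \<Longrightarrow> (a, b) \<in> E"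
        using less.hyps[of "A - {k}" "K - {k}"] less.prems(1) by blast
      have "(a, b) \<in> E" if "a \<in> A" "b \<in> A" "(a, v) \<in> E" "(b, v) \<in> E" "a \<noteq> b" for a b
        using that vs[of a b] univ symE by (cases "a = k"; cases "b = k") auto
      then show ?thesis using v k by (intro bexI[of _ v]) auto
    qed
  qed
  show ?case
  proof (cases "K = {}")
    case False
    then show ?thesis using main less.prems by blast
  next
    case True
    then obtain x where x: "x \<in> A" using less.prems(2) by blast
    show ?thesis
    proof (cases "A = {x}")
      case True
      then show ?thesis using irr \<open>K = {}\<close> by blast
    next
      case False
      then show ?thesis using main[of "{x}"] x \<open>K = {}\<close> by (auto simp: cliques_def)
    qed
  qed
qed

text \<open>
  If \<open>r\<close> is injective, it is a perfect ordering of \<open>A\<close>. Only the comparison of adjacent vertices is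
  constrained, because a rank serves to orient edges.
\<close>

definition perfect_rank :: "'v rel \<Rightarrow> 'v set \<Rightarrow> ('v \<Rightarrow> nat) \<Rightarrow> bool" where
  "perfect_rank E A r \<longleftrightarrow>
     (\<forall>a\<in>A. \<forall>b\<in>A. (a, b) \<in> E \<longrightarrow> r a \<noteq> r b) \<and>
     (\<forall>k\<in>A. \<forall>a\<in>A. \<forall>b\<in>A. (a, k) \<in> E \<longrightarrow> (b, k) \<in> E \<longrightarrow> r a < r k \<longrightarrow> r b < r k \<longrightarrow> a \<noteq> b \<longrightarrow> (a, b) \<in> E)"

lemma perfect_rank_neq:
  "perfect_rank E A r \<Longrightarrow> a \<in> A \<Longrightarrow> b \<in> A \<Longrightarrow> (a, b) \<in> E \<Longrightarrow> r a \<noteq> r b"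
  unfolding perfect_rank_def by blast

lemma perfect_rank_adjacent:
  "perfect_rank E A r \<Longrightarrow> k \<in> A \<Longrightarrow> a \<in> A \<Longrightarrow> b \<in> A \<Longrightarrow> (a, k) \<in> E \<Longrightarrow> (b, k) \<in> E \<Longrightarrow>
    r a < r k \<Longrightarrow> r b < r k \<Longrightarrow> a \<noteq> b \<Longrightarrow> (a, b) \<in> E"
  unfolding perfect_rank_def by blast

text \<open>
  Deleting simplicial vertices outside the clique one after the other leaves the clique; the deleted
  vertices are ranked in the reverse order of their deletion.
\<close>

lemma perfect_rank_starting_with_clique:
  assumes G: "simple_graph E" and ch: "chordal E" and i: "i \<in> K"
  shows "finite A \<Longrightarrow> K \<subseteq> A \<Longrightarrow> K \<in> cliques A E \<Longrightarrow>
    \<exists>r. perfect_rank E A r \<and> (\<forall>a\<in>A. r a < r i \<longleftrightarrow> a \<in> K - {i})"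
proof (induction "card A" arbitrary: A rule: less_induct)
  case less
  have irr: "\<And>a. (a, a) \<notin> E" using G by (auto simp: simple_graph_def irrefl_def)
  show ?case
  proof (cases "A = K")
    case True
    obtain f :: "'a \<Rightarrow> nat" where f: "inj_on f A"
      using less.prems(1) finite_imp_inj_to_nat_seg by blast
    obtain N where N: "\<And>a. a \<in> A \<Longrightarrow> f a < N"
      using less.prems(1) by (metis finite_imageI finite_nat_set_iff_bounded imageI)
    have "perfect_rank E A (f(i := N))"
      using less.prems(3) True f N irr
      by (auto simp: perfect_rank_def cliques_def inj_on_def) (metis less_irrefl)+
    moreover have "\<forall>a\<in>A. (f(i := N)) a < (f(i := N)) i \<longleftrightarrow> a \<in> K - {i}" using N True by auto
    ultimately show ?thesis by blast
  next
    case False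
    then have "K \<subset> A" using less.prems by blast
    from simplicial_outside_clique[OF G ch less.prems(1) this less.prems(3)]
    obtain v where v: "v \<in> A - K"
      and vs: "\<And>a b. a \<in> A \<Longrightarrow> b \<in> A \<Longrightarrow> (a, v) \<in> E \<Longrightarrow> (b, v) \<in> E \<Longrightarrow> a \<noteq> b \<Longrightarrow> (a, b) \<in> E"
      by blast
    have "card (A - {v}) < card A" using v less.prems(1) by (intro psubset_card_mono) auto
    moreover have "K \<in> cliques (A - {v}) E" "K \<subseteq> A - {v}" using less.prems(2,3) v by (auto simp: cliques_def)
    ultimately obtain r where r: "perfect_rank E (A - {v}) r"
      and ri: "\<And>a. a \<in> A - {v} \<Longrightarrow> r a < r i \<longleftrightarrow> a \<in> K - {i}"
      using less.hyps[of "A - {v}"] less.prems(1) by auto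
    obtain N where N: "\<And>a. a \<in> A \<Longrightarrow> r a < N"
      using less.prems(1) by (metis finite_imageI finite_nat_set_iff_bounded imageI)
    have iA: "i \<in> A" "i \<noteq> v" using i v less.prems by auto
    have rv: "a \<in> A \<Longrightarrow> \<not> N < r a" "a \<in> A \<Longrightarrow> r a \<noteq> N" "a \<in> A \<Longrightarrow> N \<noteq> r a" for a using N[of a] by auto
    have "perfect_rank E A (r(v := N))"
      unfolding perfect_rank_def
    proof (intro conjI ballI impI)
      fix a b assume "a \<in> A" "b \<in> A" "(a, b) \<in> E"
      then show "(r(v := N)) a \<noteq> (r(v := N)) b"
        using perfect_rank_neq[OF r, of a b] rv irr by auto
    next
      fix k a b assume *: "k \<in> A" "a \<in> A" "b \<in> A" "(a, k) \<in> E" "(b, k) \<in> E"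
        "(r(v := N)) a < (r(v := N)) k" "(r(v := N)) b < (r(v := N)) k" "a \<noteq> b"
      show "(a, b) \<in> E"
      proof (cases "k = v")
        case True
        then show ?thesis using * vs by blast
      next
        case False
        then have "a \<noteq> v" "b \<noteq> v" using * rv by (auto split: if_splits)
        then show ?thesis using * False perfect_rank_adjacent[OF r, of k a b] by simp
      qed
    qed
    moreover have "\<forall>a\<in>A. (r(v := N)) a < (r(v := N)) i \<longleftrightarrow> a \<in> K - {i}"
      using ri iA rv v by auto
    ultimately show ?thesis by blast
  qed
qed

section \<open>Reorienting moral graphs\<close>

definition parents :: "'v rel \<Rightarrow> 'v \<Rightarrow> 'v set" where
  "parents D k = {i. (i, k) \<in> D}"

definition oriented_by :: "'v rel \<Rightarrow> ('v \<Rightarrow> nat) \<Rightarrow> 'v rel" where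
  "oriented_by E r = {(a, b) \<in> E. r a < r b}"

lemma moral_dag_oriented_by:
  assumes G: "simple_graph E" and r: "perfect_rank E UNIV r"
  shows "moral_dag E (oriented_by E r)"
  unfolding moral_dag_def
proof (intro conjI allI impI)
  show "oriented_by E r \<union> (oriented_by E r)\<inverse> = E"
    using G perfect_rank_neq[OF r] by (auto simp: oriented_by_def simple_graph_def sym_def nat_neq_iff)
  show "acyclic (oriented_by E r)"
    by (rule acyclic_subset[OF wf_acyclic[OF wf_measure[of r]]]) (auto simp: oriented_by_def)
  show "(i, j) \<in> E" if "(i, k) \<in> oriented_by E r \<and> (j, k) \<in> oriented_by E r \<and> i \<noteq> j" for i j k
    using that perfect_rank_adjacent[OF r, of k i j] by (auto simp: oriented_by_def)
qed

lemma moral_dag_subset: "moral_dag E D \<Longrightarrow> D \<subseteq> E"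
  by (auto simp: moral_dag_def)

lemma moral_dag_asym: "moral_dag E D \<Longrightarrow> (a, b) \<in> D \<Longrightarrow> (b, a) \<notin> D"
  by (meson acyclic_def moral_dag_def r_into_trancl' trancl_trans)

lemma moral_dag_total: "moral_dag E D \<Longrightarrow> (a, b) \<in> E \<Longrightarrow> (a, b) \<in> D \<or> (b, a) \<in> D"
  by (auto simp: moral_dag_def)

lemma moral_dag_parents_adjacent:
  "moral_dag E D \<Longrightarrow> (i, k) \<in> D \<Longrightarrow> (j, k) \<in> D \<Longrightarrow> i \<noteq> j \<Longrightarrow> (i, j) \<in> E"
  unfolding moral_dag_def by blast

text \<open>
  The number of ancestors is a possible rank. All moral orientations thus come from perfect ranks,
  and they can be glued by gluing ranks.
\<close>

lemma moral_dag_rank: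
  fixes D :: "'v::finite rel"
  assumes D: "moral_dag E D"
  obtains r where "perfect_rank E UNIV r" "D = oriented_by E r"
proof -
  define r where "r v = card {a. (a, v) \<in> D\<^sup>+}" for v
  have less: "r a < r b" if "(a, b) \<in> D" for a b
    unfolding r_def
  proof (rule psubset_card_mono)
    have "(a, a) \<notin> D\<^sup>+" using D by (auto simp: moral_dag_def acyclic_def)
    then show "{c. (c, a) \<in> D\<^sup>+} \<subset> {c. (c, b) \<in> D\<^sup>+}"
      using that by (auto intro: trancl_into_trancl)
  qed simp
  show ?thesis
  proof
    show DE: "D = oriented_by E r"
      using moral_dag_subset[OF D] less moral_dag_total[OF D]
      by (auto simp: oriented_by_def) (meson less_asym)
    show "perfect_rank E UNIV r"
      unfolding perfect_rank_def
    proof (intro conjI ballI impI)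
      fix a b assume "(a, b) \<in> E"
      then show "r a \<noteq> r b" using moral_dag_total[OF D] less by (metis less_irrefl)
    next
      fix k a b assume "(a, k) \<in> E" "(b, k) \<in> E" "r a < r k" "r b < r k" "a \<noteq> b"
      then have "(a, k) \<in> D" "(b, k) \<in> D" using DE by (auto simp: oriented_by_def)
      then show "(a, b) \<in> E" using \<open>a \<noteq> b\<close> moral_dag_parents_adjacent[OF D] by blast
    qed
  qed
qed

lemma desc_cong:
  assumes "\<And>a b. a \<in> desc_refl D j \<Longrightarrow> (a, b) \<in> D2 \<longleftrightarrow> (a, b) \<in> D"
  shows "desc D2 j = desc D j"
proof -
  have "(j, b) \<in> D\<^sup>+ \<Longrightarrow> (j, b) \<in> D2\<^sup>+" for b
  proof (induction rule: trancl_induct)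
    case (base y)
    then show ?case using assms[of j y] by (auto simp: desc_refl_def)
  next
    case (step y z)
    then show ?case using assms[of y z] by (auto simp: desc_refl_def desc_def intro: trancl_into_trancl)
  qed
  moreover have "(j, b) \<in> D2\<^sup>+ \<Longrightarrow> (j, b) \<in> D\<^sup>+" for b
  proof (induction rule: trancl_induct)
    case (base y)
    then show ?case using assms[of j y] by (auto simp: desc_refl_def)
  next
    case (step y z)
    then show ?case using assms[of y z] by (auto simp: desc_refl_def desc_def intro: trancl_into_trancl)
  qed
  ultimately show ?thesis by (auto simp: desc_def)
qed

text \<open>
  The vertices outside \<open>desc_refl D j\<close> can be reordered at will: they receive no arrow from the
  rest. Starting them with the clique of the parents of \<open>j\<close>, with \<open>i\<close> last, makes the edge from
  \<open>i\<close> to \<open>j\<close> covered.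
\<close>

lemma moral_dag_reorient_above:
  fixes D :: "'v::finite rel"
  assumes G: "simple_graph E" and ch: "chordal E" and D: "moral_dag E D" and ij: "i \<in> parents D j"
  obtains D2 where "moral_dag E D2" "desc D2 j = desc D j" "parents D2 j = parents D j"
    "parents D2 i = parents D j - {i}"
proof -
  define A where "A = - desc_refl D j"
  define K where "K = parents D j"
  have closed: "b \<notin> A" if "(a, b) \<in> D" "a \<notin> A" for a b
    using that by (auto simp: A_def desc_refl_def desc_def intro: trancl_into_trancl)
  have KA: "K \<subseteq> A"
  proof
    fix k assume k: "k \<in> K"
    then have kj: "(k, j) \<in> D" by (simp add: K_def parents_def)
    have nc: "(j, j) \<notin> D\<^sup>+" using D by (auto simp: moral_dag_def acyclic_def)
    then have "k \<noteq> j" using kj by blast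
    moreover have "(j, k) \<notin> D\<^sup>+" using nc kj by (meson trancl_into_trancl)
    ultimately show "k \<in> A" by (auto simp: A_def desc_refl_def desc_def)
  qed
  have cl: "K \<in> cliques A E"
    using KA moral_dag_parents_adjacent[OF D] by (auto simp: cliques_def K_def parents_def)
  have iK: "i \<in> K" using ij by (simp add: K_def)
  obtain r where r: "perfect_rank E A r" and ri: "\<forall>a\<in>A. r a < r i \<longleftrightarrow> a \<in> K - {i}"
    using perfect_rank_starting_with_clique[OF G ch iK finite KA cl] by blast
  obtain s where s: "perfect_rank E UNIV s" and Ds: "D = oriented_by E s"
    using moral_dag_rank[OF D] .
  obtain N where N: "\<And>a. r a < N"
    by (metis finite finite_imageI finite_nat_set_iff_bounded rangeI)
  \<comment> \<open>all of \<open>A\<close> first, in the new order; the rest afterwards, in the old order\<close>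
  define r2 where "r2 v = (if v \<in> A then r v else N + s v)" for v
  have rN: "N + s a < r b \<longleftrightarrow> False" "r b < N + s a \<longleftrightarrow> True" "r b \<noteq> N + s a" "N + s a \<noteq> r b" for a b
    using N[of b] by auto
  have noEdge: "s a < s b" if "(a, b) \<in> E" "a \<in> A" "b \<notin> A" for a b
    using that closed[of b a] moral_dag_total[OF D, of a b] by (auto simp: Ds oriented_by_def)
  have r2: "perfect_rank E UNIV r2"
    unfolding perfect_rank_def
  proof (intro conjI ballI impI)
    fix a b assume "(a, b) \<in> E"
    then show "r2 a \<noteq> r2 b"
      using perfect_rank_neq[OF r, of a b] perfect_rank_neq[OF s, of a b] rN by (auto simp: r2_def)
  next
    fix k a b assume *: "(a, k) \<in> E" "(b, k) \<in> E" "r2 a < r2 k" "r2 b < r2 k" "a \<noteq> b"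
    show "(a, b) \<in> E"
    proof (cases "k \<in> A")
      case True
      then have "a \<in> A" "b \<in> A" using * rN by (auto simp: r2_def split: if_splits)
      then show ?thesis
        using * True perfect_rank_adjacent[OF r, of k a b] by (simp add: r2_def)
    next
      case False
      then have "s a < s k" "s b < s k" using * noEdge by (auto simp: r2_def split: if_splits)
      then show ?thesis using * perfect_rank_adjacent[OF s, of k a b] by simp
    qed
  qed
  define D2 where "D2 = oriented_by E r2"
  have D2_eq: "(a, b) \<in> D2 \<longleftrightarrow> (if a \<in> A \<and> b \<in> A then (a, b) \<in> E \<and> r a < r b else (a, b) \<in> D)" for a b
    using noEdge closed[of a b] rN by (auto simp: D2_def oriented_by_def r2_def Ds)
  have jA: "j \<notin> A" by (simp add: A_def desc_refl_def)
  show ?thesis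
  proof
    show "moral_dag E D2" unfolding D2_def by (rule moral_dag_oriented_by[OF G r2])
    show "desc D2 j = desc D j" by (rule desc_cong) (auto simp: D2_eq A_def)
    show "parents D2 j = parents D j" using jA by (auto simp: D2_eq parents_def)
    have adj: "(a, i) \<in> E" if "a \<in> K - {i}" for a
      using that iK moral_dag_parents_adjacent[OF D, of a j i] by (simp add: K_def parents_def)
    have iA: "i \<in> A" using iK KA by blast
    have "a \<in> parents D2 i \<longleftrightarrow> a \<in> K - {i}" for a
    proof (cases "a \<in> A")
      case True
      then have "(a, i) \<in> D2 \<longleftrightarrow> (a, i) \<in> E \<and> a \<in> K - {i}" using iA ri by (simp add: D2_eq)
      then show ?thesis using adj by (auto simp: parents_def)
    next
      case False
      then have "(a, i) \<notin> D" "a \<notin> K" using closed[of a i] iA KA by blast+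
      then show ?thesis using False by (simp add: parents_def D2_eq)
    qed
    then show "parents D2 i = parents D j - {i}" unfolding K_def by blast
  qed
qed

lemma moral_dag_starting_with_clique:
  fixes E :: "'v::finite rel"
  assumes G: "simple_graph E" and ch: "chordal E" and K: "K \<in> cliques UNIV E" and i: "i \<in> K"
  obtains D where "moral_dag E D" "parents D i = K - {i}"
proof -
  obtain r where r: "perfect_rank E UNIV r" and ri: "\<forall>a\<in>UNIV. r a < r i \<longleftrightarrow> a \<in> K - {i}"
    using perfect_rank_starting_with_clique[OF G ch i finite subset_UNIV K] by blast
  have "parents (oriented_by E r) i = K - {i}"
    using ri K i by (auto simp: parents_def oriented_by_def cliques_def)
  then show ?thesis using that moral_dag_oriented_by[OF G r] by blast
qed

definition flip :: "'v \<Rightarrow> 'v \<Rightarrow> 'v rel \<Rightarrow> 'v rel" where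
  "flip i j D = insert (j, i) (D - {(i, j)})"

text \<open>
  An edge from \<open>i\<close> to \<open>j\<close> is covered if \<open>i\<close> and \<open>j\<close> have the same parents apart from \<open>i\<close> itself.
  Another directed path from \<open>i\<close> to \<open>j\<close> would enter \<open>j\<close> through a parent of \<open>i\<close> and so close a
  cycle; hence reversing the edge creates no cycle either.
\<close>

lemma moral_dag_flip_covered:
  assumes G: "simple_graph E" and D: "moral_dag E D" and ij: "(i, j) \<in> D"
    and cov: "parents D j = insert i (parents D i)"
  shows "moral_dag E (flip i j D)"
  unfolding moral_dag_def
proof (intro conjI allI impI)
  have symE: "sym E" using G by (simp add: simple_graph_def)
  have neq: "i \<noteq> j" using ij D by (metis moral_dag_asym)
  show "flip i j D \<union> (flip i j D)\<inverse> = E"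
    using D ij by (auto simp: flip_def moral_dag_def)
  have acyc: "acyclic D" using D by (simp add: moral_dag_def)
  have "(i, j) \<notin> (D - {(i, j)})\<^sup>*"
  proof
    assume "(i, j) \<in> (D - {(i, j)})\<^sup>*"
    then obtain p where p: "(i, p) \<in> (D - {(i, j)})\<^sup>*" "(p, j) \<in> D - {(i, j)}"
      using neq by (meson rtranclE)
    then have "(p, i) \<in> D" using cov by (auto simp: parents_def)
    moreover have "(i, p) \<in> D\<^sup>*" using p(1) rtrancl_mono[of "D - {(i, j)}" D] by blast
    ultimately have "(i, i) \<in> D\<^sup>+" by (meson rtrancl_into_trancl1)
    then show False using acyc by (auto simp: acyclic_def)
  qed
  then show "acyclic (flip i j D)"
    unfolding flip_def acyclic_insert using acyc acyclic_subset by (metis Diff_subset)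
  fix a b k assume *: "(a, k) \<in> flip i j D \<and> (b, k) \<in> flip i j D \<and> a \<noteq> b"
  have par: "(c, i) \<in> D \<Longrightarrow> (c, j) \<in> D" "(c, j) \<in> D \<Longrightarrow> c = i \<or> (c, i) \<in> D" for c
    using cov by (auto simp: parents_def)
  have "(c, j) \<in> E \<and> (j, c) \<in> E" if "(c, i) \<in> D" for c
    using moral_dag_subset[OF D] par(1)[OF that] symE by (auto simp: sym_def)
  then show "(a, b) \<in> E"
    using * moral_dag_parents_adjacent[OF D, of a k b] by (auto simp: flip_def)
qed

lemma parents_flip:
  assumes D: "moral_dag E D" and cov: "parents D j = insert i (parents D i)"
  shows "parents (flip i j D) j = parents D i"
proof -
  have ij: "(i, j) \<in> D" using cov by (auto simp: parents_def)
  have "(i, i) \<notin> D" "i \<noteq> j" using moral_dag_asym[OF D, of i i] ij moral_dag_asym[OF D, of i j] by auto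
  then show "parents (flip i j D) j = parents D i"
    using cov by (auto simp: flip_def parents_def)
qed

text \<open>
  No arrow enters the descendants of a source from outside: by morality such an arrow could be
  lifted along a directed path up to the source.
\<close>

lemma desc_source:
  fixes D :: "'v rel"
  assumes cn: "connected_graph E" and D: "moral_dag E D" and j: "parents D j = {}"
  shows "desc D j = - {j}"
proof -
  have noin: "b \<in> desc_refl D j" if "a \<in> desc_refl D j" "(b, a) \<in> D" for a b
  proof -
    have "(j, a) \<in> D\<^sup>*" using that by (auto simp: desc_refl_def desc_def)
    then show ?thesis using that(2)
    proof (induction arbitrary: b rule: rtrancl_induct)
      case base
      then show ?case using j by (auto simp: parents_def)
    next
      case (step p a)
      have p: "p \<in> desc_refl D j" using step.hyps(1) by (auto simp: desc_refl_def desc_def rtrancl_eq_or_trancl)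
      show ?case
      proof (cases "b = p")
        case False
        then have "(b, p) \<in> D \<or> (p, b) \<in> D"
          using moral_dag_parents_adjacent[OF D step.prems step.hyps(2)] moral_dag_total[OF D] by blast
        then show ?thesis using step.IH[of b] p
          by (auto simp: desc_refl_def desc_def intro: trancl_into_trancl)
      qed (use p in simp)
    qed
  qed
  have "v \<in> desc_refl D j" for v
  proof -
    have "(j, v) \<in> E\<^sup>*" using cn by (simp add: connected_graph_def)
    then show ?thesis
    proof (induction rule: rtrancl_induct)
      case base
      then show ?case by (simp add: desc_refl_def)
    next
      case (step y z)
      then show ?case using moral_dag_total[OF D step.hyps(2)] noin[of y z]
        by (auto simp: desc_refl_def desc_def intro: trancl_into_trancl)
    qed
  qed
  moreover have "j \<notin> desc D j" using D by (auto simp: desc_def moral_dag_def acyclic_def)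
  ultimately show ?thesis by (auto simp: desc_refl_def)
qed

section \<open>Independence polynomials along a moral orientation\<close>

definition independent_sets :: "'v rel \<Rightarrow> 'v set \<Rightarrow> 'v set set" where
  "independent_sets E A = {C. C \<subseteq> A \<and> (\<forall>i\<in>C. \<forall>j\<in>C. i \<noteq> j \<longrightarrow> (i, j) \<notin> E)}"

lemma cliques_complement_induced:
  "cliques A (complement_graph A (induced_subgraph A E)) = independent_sets E A"
  unfolding cliques_def complement_graph_def induced_subgraph_def independent_sets_def by blast

lemma Delta_alt: "Delta E A x = (\<Sum>C\<in>independent_sets E A. (- 1) ^ card C * (\<Prod>i\<in>C. x $ i))"
  by (simp add: Delta_def cliques_complement_induced)

text \<open>
  Both characterizations concern the same functions: the second is about \<open>u\<close> at the negative of a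
  positive vector. The lemmas on \<open>u\<close> below therefore assume that all \<open>Delta E A x\<close> are positive,
  but not that \<open>x\<close> is.
\<close>

lemma delta_eq_Delta: "delta E A y = Delta E A (- y)" for y :: "real^'v::finite"
  by (simp add: Delta_alt delta_def cliques_complement_induced prod_uminus flip: power_mult_distrib)

lemma w_eq_u: "w E D i y = - u E D i (- y)" for y :: "real^'v::finite"
  by (simp add: w_def u_def delta_eq_Delta)

lemma Delta_empty: "Delta E {} x = 1"
proof -
  have "independent_sets E {} = {{}}" by (auto simp: independent_sets_def)
  then show ?thesis by (simp add: Delta_alt)
qed

lemma Delta_cong: "(\<And>i. i \<in> A \<Longrightarrow> x $ i = y $ i) \<Longrightarrow> Delta E A x = Delta E A y"
  unfolding Delta_alt
  by (intro sum.cong refl arg_cong2[where f="(*)"] prod.cong) (auto simp: independent_sets_def)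

lemma Delta_induced: "Delta (E \<inter> A \<times> A) A x = Delta E A x"
proof -
  have "independent_sets (E \<inter> A \<times> A) A = independent_sets E A"
    by (auto simp: independent_sets_def)
  then show ?thesis by (simp add: Delta_alt)
qed

text \<open>
  Split the independent sets according to whether they contain \<open>i\<close>.
\<close>

lemma Delta_remove:
  fixes x :: "real^'v::finite"
  assumes G: "simple_graph E" and i: "i \<in> A"
  shows "Delta E A x = Delta E (A - {i}) x - x $ i * Delta E (A - {i} - {c. (i, c) \<in> E}) x"
proof -
  let ?N = "independent_sets E (A - {i} - {c. (i, c) \<in> E})"
  have sym: "\<And>a b. (a, b) \<in> E \<Longrightarrow> (b, a) \<in> E" using G by (auto simp: simple_graph_def sym_def)
  have split: "independent_sets E A = independent_sets E (A - {i}) \<union> insert i ` ?N"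
  proof (intro set_eqI iffI)
    fix C assume C: "C \<in> independent_sets E A"
    show "C \<in> independent_sets E (A - {i}) \<union> insert i ` ?N"
    proof (cases "i \<in> C")
      case True
      then have "C = insert i (C - {i})" "C - {i} \<in> ?N"
        using C by (auto simp: independent_sets_def)
      then show ?thesis by blast
    next
      case False
      then show ?thesis using C by (auto simp: independent_sets_def)
    qed
  next
    fix C assume "C \<in> independent_sets E (A - {i}) \<union> insert i ` ?N"
    then show "C \<in> independent_sets E A"
      using i sym by (auto simp: independent_sets_def)
  qed
  have disj: "independent_sets E (A - {i}) \<inter> insert i ` ?N = {}"
    by (auto simp: independent_sets_def)
  have inj: "inj_on (insert i) ?N"
    by (rule inj_onI) (auto simp: independent_sets_def dest!: insert_ident[THEN iffD1, rotated 2])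
  have "(\<Sum>C\<in>insert i ` ?N. (- 1) ^ card C * (\<Prod>j\<in>C. x $ j)) =
      (\<Sum>C\<in>?N. - x $ i * ((- 1) ^ card C * (\<Prod>j\<in>C. x $ j)))"
    unfolding sum.reindex[OF inj] o_def
  proof (rule sum.cong[OF refl])
    fix C assume "C \<in> ?N"
    then have "i \<notin> C" by (auto simp: independent_sets_def)
    then show "(- 1) ^ card (insert i C) * (\<Prod>j\<in>insert i C. x $ j) =
        - x $ i * ((- 1) ^ card C * (\<Prod>j\<in>C. x $ j))" by simp
  qed
  then show ?thesis
    unfolding Delta_alt split by (subst sum.union_disjoint) (auto simp: disj sum_distrib_left sum_negf)
qed

text \<open>
  The inverse of the map from \<open>x\<close> to the vector of all \<open>u E D i x\<close>. It is polynomial, and triangular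
  for any order compatible with \<open>D\<close>.
\<close>

definition phi :: "('v::finite) rel \<Rightarrow> real^'v \<Rightarrow> real^'v" where
  "phi D v = (\<chi> i. v $ i * (\<Prod>c\<in>{c. (i, c) \<in> D}. 1 - v $ c))"

lemma phi_nth: "phi D v $ i = v $ i * (\<Prod>c\<in>{c. (i, c) \<in> D}. 1 - v $ c)"
  by (simp add: phi_def)

definition desc_closed :: "'v rel \<Rightarrow> 'v set \<Rightarrow> bool" where
  "desc_closed D A \<longleftrightarrow> (\<forall>a b. a \<in> A \<longrightarrow> (a, b) \<in> D \<longrightarrow> b \<in> A)"

lemma desc_closed_desc: "desc_closed D (desc D i)"
  by (auto simp: desc_closed_def desc_def intro: trancl_into_trancl)

lemma desc_closed_desc_refl: "desc_closed D (desc_refl D i)"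
  by (auto simp: desc_closed_def desc_refl_def desc_def intro: trancl_into_trancl)

lemma not_in_desc: "moral_dag E D \<Longrightarrow> i \<notin> desc D i"
  by (auto simp: desc_def moral_dag_def acyclic_def)

text \<open>
  Remove a source \<open>i\<close> of \<open>A\<close>. By morality, removing the children of \<open>i\<close> as well leaves a
  descendant-closed set, and the factors \<open>1 - v\<close> of these children are those in \<open>phi D v $ i\<close>.
  Agreement of \<open>x\<close> with \<open>phi D v\<close> on \<open>A\<close> is all that may be assumed when \<open>v\<close> is recovered from \<open>x\<close>
  recursively, from the sinks upwards.
\<close>

lemma Delta_phi:
  fixes v :: "real^'v::finite"
  assumes G: "simple_graph E" and D: "moral_dag E D"
  shows "desc_closed D A \<Longrightarrow> (\<And>i. i \<in> A \<Longrightarrow> x $ i = phi D v $ i) \<Longrightarrow> Delta E A x = (\<Prod>j\<in>A. 1 - v $ j)"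
proof (induction "card A" arbitrary: A rule: less_induct)
  case less
  show ?case
  proof (cases "A = {}")
    case True
    then show ?thesis by (simp add: Delta_empty)
  next
    case False
    obtain r where Dr: "D = oriented_by E r" using moral_dag_rank[OF D] by blast
    obtain i where i: "i \<in> A" and imin: "\<And>a. a \<in> A \<Longrightarrow> r i \<le> r a"
      using ex_is_arg_min_if_finite[of A r] False by (auto simp: is_arg_min_linorder)
    let ?ch = "{c. (i, c) \<in> D}"
    have source: "(a, i) \<notin> D" if "a \<in> A" for a using imin[OF that] by (auto simp: Dr oriented_by_def)
    have ch: "?ch \<subseteq> A - {i}" using less.prems(1) i moral_dag_asym[OF D] by (auto simp: desc_closed_def)
    have N: "A - {i} - {c. (i, c) \<in> E} = A - {i} - ?ch"
      using source moral_dag_total[OF D] moral_dag_subset[OF D] by blast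
    have c1: "desc_closed D (A - {i})" using less.prems(1) source by (auto simp: desc_closed_def)
    have c2: "desc_closed D (A - {i} - ?ch)"
      unfolding desc_closed_def
    proof (intro allI impI)
      fix a b assume a: "a \<in> A - {i} - ?ch" and ab: "(a, b) \<in> D"
      have "b \<notin> ?ch"
        using moral_dag_parents_adjacent[OF D ab, of i] moral_dag_total[OF D, of a i] a source by blast
      moreover have "b \<in> A - {i}" using c1 a ab unfolding desc_closed_def by blast
      ultimately show "b \<in> A - {i} - ?ch" by blast
    qed
    have "card (A - {i}) < card A" by (rule psubset_card_mono) (use i in auto)
    moreover have "card (A - {i} - ?ch) < card A" by (rule psubset_card_mono) (use i in auto)
    ultimately have "Delta E (A - {i}) x = (\<Prod>j\<in>A - {i}. 1 - v $ j)"
      "Delta E (A - {i} - ?ch) x = (\<Prod>j\<in>A - {i} - ?ch. 1 - v $ j)"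
      using less.hyps[OF _ c1] less.hyps[OF _ c2] less.prems(2) by auto
    moreover have "(\<Prod>c\<in>?ch. 1 - v $ c) * (\<Prod>j\<in>A - {i} - ?ch. 1 - v $ j) = (\<Prod>j\<in>A - {i}. 1 - v $ j)"
      using prod.subset_diff[OF ch, of "\<lambda>j. 1 - v $ j"] by (simp add: mult.commute)
    moreover have "x $ i = v $ i * (\<Prod>c\<in>?ch. 1 - v $ c)" using less.prems(2)[OF i] by (simp add: phi_nth)
    ultimately have "Delta E A x = (1 - v $ i) * (\<Prod>j\<in>A - {i}. 1 - v $ j)"
      using Delta_remove[OF G i, of x] by (simp add: N left_diff_distrib)
    then show ?thesis using i by (simp add: prod.remove)
  qed
qed

lemma u_phi:
  assumes G: "simple_graph E" and D: "moral_dag E D" and v: "\<And>k. v $ k \<noteq> 1"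
  shows "u E D i (phi D v) = v $ i"
proof -
  have "(\<Prod>j\<in>desc_refl D i. 1 - v $ j) = (1 - v $ i) * (\<Prod>j\<in>desc D i. 1 - v $ j)"
    using not_in_desc[OF D] by (simp add: desc_refl_def)
  moreover have "(\<Prod>j\<in>desc D i. 1 - v $ j) \<noteq> 0" using v by simp
  ultimately show ?thesis
    by (simp add: u_def Delta_phi[OF G D] desc_closed_desc desc_closed_desc_refl)
qed

lemma triangular_solution:
  fixes x :: "real^'v::finite"
  assumes "acyclic D"
  obtains v :: "real^'v" where "\<And>i. v $ i = x $ i / (\<Prod>c\<in>{c. (i, c) \<in> D}. 1 - v $ c)"
proof -
  have wf: "wf (D\<inverse>)" using assms by (simp add: finite_acyclic_wf_converse)
  define F where "F = (\<lambda>f i. x $ i / (\<Prod>c\<in>{c. (i, c) \<in> D}. 1 - f c))"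
  define f where "f = wfrec (D\<inverse>) F"
  have f: "f i = x $ i / (\<Prod>c\<in>{c. (i, c) \<in> D}. 1 - f c)" for i
    unfolding f_def by (subst wfrec[OF wf]) (simp add: F_def cut_apply)
  show ?thesis by (rule that[of "\<chi> i. f i"]) (unfold vec_lambda_beta, rule f)
qed

lemma desc_induct [consumes 1, case_names less]:
  fixes D :: "'v::finite rel"
  assumes D: "moral_dag E D" and step: "\<And>i. (\<And>j. j \<in> desc D i \<Longrightarrow> P j) \<Longrightarrow> P i"
  shows "P i"
proof -
  have "wf ((D\<inverse>)\<^sup>+)"
    using D by (intro wf_trancl finite_acyclic_wf_converse) (auto simp: moral_dag_def)
  then show ?thesis
  proof (induction i rule: wf_induct_rule)
    case (less i)
    show ?case by (rule step, rule less) (simp add: desc_def trancl_converse)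
  qed
qed

text \<open>
  Solve \<open>phi D v = x\<close> recursively. The recursion divides by factors \<open>1 - v\<close>, and the factor at \<open>i\<close> is
  the quotient of \<open>Delta\<close> over the descendants of \<open>i\<close> with and without \<open>i\<close>, hence positive.
\<close>

lemma phi_u:
  assumes G: "simple_graph E" and D: "moral_dag E D" and x: "\<And>A. Delta E A x > 0"
  shows "u E D i x < 1" and "phi D (\<chi> i. u E D i x) = x"
proof -
  obtain v where v: "\<And>i. v $ i = x $ i / (\<Prod>c\<in>{c. (i, c) \<in> D}. 1 - v $ c)"
    using triangular_solution[of D x] D by (auto simp: moral_dag_def)
  have solves: "x $ i = phi D v $ i" if "\<And>c. (i, c) \<in> D \<Longrightarrow> v $ c < 1" for i
  proof -
    have "(\<Prod>c\<in>{c. (i, c) \<in> D}. 1 - v $ c) > 0" using that by (intro prod_pos) auto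
    then show ?thesis using v[of i] unfolding phi_nth by (metis less_irrefl nonzero_eq_divide_eq)
  qed
  have v1: "v $ i < 1" for i
    using D
  proof (induction rule: desc_induct)
    case (less i)
    have "x $ j = phi D v $ j" if "j \<in> desc_refl D i" for j
      using that by (intro solves less) (auto simp: desc_refl_def desc_def intro: trancl_into_trancl)
    then have "Delta E (desc_refl D i) x = (\<Prod>j\<in>desc_refl D i. 1 - v $ j)"
      by (intro Delta_phi[OF G D] desc_closed_desc_refl)
    also have "\<dots> = (1 - v $ i) * (\<Prod>j\<in>desc D i. 1 - v $ j)"
      using not_in_desc[OF D] by (simp add: desc_refl_def)
    finally have "(1 - v $ i) * (\<Prod>j\<in>desc D i. 1 - v $ j) > 0" using x by metis
    moreover have "(\<Prod>j\<in>desc D i. 1 - v $ j) > 0" using less by (intro prod_pos) auto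
    ultimately show ?case by (simp add: zero_less_mult_iff)
  qed
  have xv: "x = phi D v" using solves v1 by (simp add: vec_eq_iff)
  have uv: "u E D i x = v $ i" for i unfolding xv using v1 by (intro u_phi[OF G D]) (metis less_irrefl)
  show "u E D i x < 1" using v1 uv by simp
  show "phi D (\<chi> i. u E D i x) = x" using xv uv by simp
qed

lemma phi_children_pos:
  fixes v :: "real^'v::finite"
  shows "(\<And>k. v $ k < 1) \<Longrightarrow> (\<Prod>c\<in>{c. (i, c) \<in> D}. 1 - v $ c) > 0"
  by (simp add: prod_pos)

lemma u_sign:
  assumes G: "simple_graph E" and D: "moral_dag E D" and x: "\<And>A. Delta E A x > 0"
  shows "x $ i > 0 \<Longrightarrow> u E D i x > 0" and "x $ i < 0 \<Longrightarrow> u E D i x < 0"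
proof -
  have "(\<Prod>c\<in>{c. (i, c) \<in> D}. 1 - (\<chi> i. u E D i x) $ c) > 0"
    using phi_u(1)[OF G D x] by (intro phi_children_pos) auto
  moreover have "x $ i = u E D i x * (\<Prod>c\<in>{c. (i, c) \<in> D}. 1 - (\<chi> i. u E D i x) $ c)"
    using phi_nth[of D "\<chi> i. u E D i x" i] phi_u(2)[OF G D x] by simp
  ultimately show "x $ i > 0 \<Longrightarrow> u E D i x > 0" "x $ i < 0 \<Longrightarrow> u E D i x < 0"
    by (simp_all add: zero_less_mult_iff mult_less_0_iff)
qed

text \<open>
  For a subset \<open>A\<close> the same orientation restricted to \<open>A\<close> is moral, and the coordinates of
  \<open>phi D v\<close> with respect to it are at most those of \<open>v\<close>: fewer children occur, each with a
  larger factor.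
\<close>

lemma phi_in_M_set:
  fixes v :: "real^'v::finite"
  assumes G: "simple_graph E" and D: "moral_dag E D" and v: "\<And>i. 0 < v $ i" "\<And>i. v $ i < 1"
  shows "phi D v \<in> M_set E"
proof -
  have pos: "phi D v $ i > 0" for i using v(1) phi_children_pos[OF v(2)] unfolding phi_nth by (rule mult_pos_pos)
  moreover have "Delta E A (phi D v) > 0" for A
  proof -
    let ?E = "E \<inter> A \<times> A" and ?D = "D \<inter> A \<times> A"
    have G': "simple_graph ?E" using G by (auto simp: simple_graph_def sym_def irrefl_def)
    have "?D \<union> ?D\<inverse> = ?E" using D unfolding moral_dag_def by blast
    moreover have "acyclic ?D" using D acyclic_subset[of D ?D] by (auto simp: moral_dag_def)
    ultimately have D': "moral_dag ?E ?D" using D unfolding moral_dag_def by blast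
    obtain v' where v': "\<And>i. v' $ i = phi D v $ i / (\<Prod>c\<in>{c. (i, c) \<in> ?D}. 1 - v' $ c)"
      using triangular_solution[of ?D "phi D v"] D' by (auto simp: moral_dag_def)
    have le: "v' $ i \<le> v $ i" for i
      using D'
    proof (induction rule: desc_induct)
      case (less i)
      let ?ch = "{c. (i, c) \<in> ?D}"
      have IH: "v' $ c \<le> v $ c" if "c \<in> ?ch" for c using that by (intro less) (auto simp: desc_def)
      have "(\<Prod>c\<in>{c. (i, c) \<in> D}. 1 - v $ c) \<le> (\<Prod>c\<in>?ch. 1 - v $ c)"
      proof -
        have "?ch \<subseteq> {c. (i, c) \<in> D}" by auto
        moreover have "(\<Prod>c\<in>{c. (i, c) \<in> D} - ?ch. 1 - v $ c) \<le> 1"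
          using v by (intro prod_le_1) (auto intro: less_imp_le)
        moreover have "0 \<le> (\<Prod>c\<in>?ch. 1 - v $ c)" using v by (intro prod_nonneg) (auto intro: less_imp_le)
        ultimately show ?thesis
          using mult_right_mono[of "\<Prod>c\<in>{c. (i, c) \<in> D} - ?ch. 1 - v $ c" 1 "\<Prod>c\<in>?ch. 1 - v $ c"]
          by (subst prod.subset_diff[of ?ch]) simp_all
      qed
      also have "\<dots> \<le> (\<Prod>c\<in>?ch. 1 - v' $ c)" using IH v by (intro prod_mono) (auto simp: less_imp_le)
      finally have "phi D v $ i \<le> v $ i * (\<Prod>c\<in>?ch. 1 - v' $ c)"
        using v(1)[of i] by (simp add: phi_nth)
      moreover have "(\<Prod>c\<in>?ch. 1 - v' $ c) > 0"
        using IH v(2) by (intro prod_pos) (auto intro: le_less_trans)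
      ultimately show ?case using v'[of i] by (simp add: field_simps)
    qed
    have v'1: "v' $ i < 1" for i using le[of i] v(2)[of i] by simp
    have "phi D v $ i = phi ?D v' $ i" for i
      using v'[of i] phi_children_pos[of v' i ?D, OF v'1] unfolding phi_nth[of ?D]
      by (metis less_irrefl nonzero_eq_divide_eq)
    then have "Delta ?E A (phi D v) = (\<Prod>j\<in>A. 1 - v' $ j)"
      by (intro Delta_phi[OF G' D']) (auto simp: desc_closed_def)
    also have "\<dots> > 0" using v'1 by (intro prod_pos) auto
    finally show ?thesis by (simp add: Delta_induced)
  qed
  ultimately show ?thesis by (simp add: M_set_def pos_orthant_def)
qed

text \<open>
  A third vertex is a parent of both ends of a covered edge or of neither. In its coordinate the two
  ends enter only through \<open>(1 - v $ i) * (1 - v $ j)\<close>, which is the same for \<open>v'\<close>.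
\<close>

lemma phi_flip:
  fixes v :: "real^'v::finite"
  assumes D: "moral_dag E D" and cov: "parents D j = insert i (parents D i)"
    and v'i: "v' $ i = v $ i * (1 - v $ j)" and v'j: "v' $ j * (1 - v' $ i) = v $ j"
    and other: "\<And>k. k \<noteq> i \<Longrightarrow> k \<noteq> j \<Longrightarrow> v' $ k = v $ k"
  shows "phi (flip i j D) v' = phi D v"
proof -
  have ij: "(i, j) \<in> D" using cov by (auto simp: parents_def)
  have neq: "i \<noteq> j" and ii: "(i, i) \<notin> D" "(j, j) \<notin> D" and ji: "(j, i) \<notin> D"
    using moral_dag_asym[OF D] ij by blast+
  have par: "(k, j) \<in> D \<longleftrightarrow> k = i \<or> (k, i) \<in> D" for k using cov by (auto simp: parents_def)
  let ?rest = "\<lambda>k. {c. (k, c) \<in> D} - {i, j}"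
  have rest: "(\<Prod>c\<in>?rest k. 1 - v' $ c) = (\<Prod>c\<in>?rest k. 1 - v $ c)" for k
    by (intro prod.cong) (auto simp: other)
  have both: "(1 - v' $ i) * (1 - v' $ j) = (1 - v $ i) * (1 - v $ j)"
    using v'i v'j by algebra
  have "phi (flip i j D) v' $ k = phi D v $ k" for k
  proof -
    consider "k = i" | "k = j" | "k \<noteq> i" "k \<noteq> j" "(k, i) \<in> D" | "k \<noteq> i" "k \<noteq> j" "(k, i) \<notin> D" by blast
    then show ?thesis
    proof cases
      case 1
      have "{c. (i, c) \<in> flip i j D} = ?rest i" "{c. (i, c) \<in> D} = insert j (?rest i)"
        using ij neq ii by (auto simp: flip_def)
      have fi: "phi (flip i j D) v' $ i = v' $ i * (\<Prod>c\<in>?rest i. 1 - v' $ c)"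
        unfolding phi_nth \<open>{c. (i, c) \<in> flip i j D} = ?rest i\<close> ..
      have "(\<Prod>c\<in>{c. (i, c) \<in> D}. 1 - v $ c) = (1 - v $ j) * (\<Prod>c\<in>?rest i. 1 - v $ c)"
        by (subst \<open>{c. (i, c) \<in> D} = insert j (?rest i)\<close>) simp
      then have fd: "phi D v $ i = v $ i * ((1 - v $ j) * (\<Prod>c\<in>?rest i. 1 - v $ c))"
        by (simp add: phi_nth)
      show ?thesis unfolding 1 fi fd v'i rest by simp
    next
      case 2
      have "{c. (j, c) \<in> flip i j D} = insert i (?rest j)" "{c. (j, c) \<in> D} = ?rest j"
        using neq ii ji by (auto simp: flip_def)
      have fi: "phi (flip i j D) v' $ j = v' $ j * ((1 - v' $ i) * (\<Prod>c\<in>?rest j. 1 - v' $ c))"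
        unfolding phi_nth \<open>{c. (j, c) \<in> flip i j D} = insert i (?rest j)\<close> by simp
      have fd: "phi D v $ j = v $ j * (\<Prod>c\<in>?rest j. 1 - v $ c)"
        unfolding phi_nth using \<open>{c. (j, c) \<in> D} = ?rest j\<close> by metis
      show ?thesis unfolding 2 fi fd rest by (simp add: v'j[symmetric])
    next
      case 3
      then have "{c. (k, c) \<in> flip i j D} = insert i (insert j (?rest k))"
        "{c. (k, c) \<in> D} = insert i (insert j (?rest k))"
        using par by (auto simp: flip_def)
      then have ch: "{c. (k, c) \<in> flip i j D} = {c. (k, c) \<in> D}" by simp
      have "(\<Prod>c\<in>{c. (k, c) \<in> D}. 1 - z $ c) = (1 - z $ i) * (1 - z $ j) * (\<Prod>c\<in>?rest k. 1 - z $ c)"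
        for z :: "real^'v"
        by (subst \<open>{c. (k, c) \<in> D} = insert i (insert j (?rest k))\<close>) (simp add: neq)
      then show ?thesis unfolding phi_nth ch using both other[of k] rest[of k] 3 by simp
    next
      case 4
      then have "{c. (k, c) \<in> flip i j D} = ?rest k" "{c. (k, c) \<in> D} = ?rest k"
        using par by (auto simp: flip_def)
      then show ?thesis using 4 other[of k] rest[of k] by (simp add: phi_nth)
    qed
  qed
  then show ?thesis by (simp add: vec_eq_iff)
qed

text \<open>
  With \<open>v\<close> the coordinates along \<open>D\<close>, the vector \<open>v'\<close> of the previous lemma solves
  \<open>phi (flip i j D) v' = x\<close>. The common sign of the coordinates of \<open>x\<close> keeps \<open>v' $ i\<close> below one.
\<close>

lemma u_flip:
  fixes x :: "real^'v::finite"
  assumes G: "simple_graph E" and D: "moral_dag E D" and cov: "parents D j = insert i (parents D i)"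
    and x: "\<And>A. Delta E A x > 0" and sgn: "(\<forall>k. x $ k > 0) \<or> (\<forall>k. x $ k < 0)"
  shows "u E (flip i j D) i x = u E D i x * (1 - u E D j x)"
    and "u E (flip i j D) j x * (1 - u E (flip i j D) i x) = u E D j x"
proof -
  have ij: "(i, j) \<in> D" using cov by (auto simp: parents_def)
  have neq: "i \<noteq> j" using moral_dag_asym[OF D] ij by blast
  have D': "moral_dag E (flip i j D)" by (rule moral_dag_flip_covered[OF G D ij cov])
  define v where "v = (\<chi> k. u E D k x)"
  have v1: "v $ k < 1" for k using phi_u(1)[OF G D x] by (simp add: v_def)
  define s where "s = v $ i * (1 - v $ j)"
  have s1: "s < 1"
  proof (cases "x $ i > 0")
    case True
    then have "0 < v $ i" "0 < v $ j" using u_sign(1)[OF G D x] sgn by (auto simp: v_def dest: less_asym)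
    then have "v $ i * (1 - v $ j) \<le> v $ i" by (simp add: mult_left_le)
    then show ?thesis using v1[of i] by (simp add: s_def)
  next
    case False
    then have "v $ i < 0" using u_sign(2)[OF G D x] sgn by (auto simp: v_def)
    then show ?thesis using v1[of j] mult_neg_pos[of "v $ i" "1 - v $ j"] by (simp add: s_def)
  qed
  define v' where "v' = (\<chi> k. if k = i then s else if k = j then v $ j / (1 - s) else v $ k)"
  have both: "(1 - v' $ i) * (1 - v' $ j) = (1 - v $ i) * (1 - v $ j)"
    using neq s1 by (simp add: v'_def field_simps) (simp add: s_def algebra_simps)
  have "v' $ j \<noteq> 1" using both v1[of i] v1[of j] by auto
  then have v'1: "v' $ k \<noteq> 1" for k using s1 v1[of k] by (cases "k = j") (auto simp: v'_def)
  have "phi (flip i j D) v' = phi D v"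
    by (rule phi_flip[OF D cov]) (use neq s1 in \<open>auto simp: v'_def s_def\<close>)
  also have "\<dots> = x" using phi_u(2)[OF G D x] by (simp add: v_def)
  finally have "u E (flip i j D) k x = v' $ k" for k using u_phi[OF G D' v'1, of k] by simp
  then show "u E (flip i j D) i x = u E D i x * (1 - u E D j x)"
    "u E (flip i j D) j x * (1 - u E (flip i j D) i x) = u E D j x"
    using neq s1 by (auto simp: v'_def s_def) (auto simp: v_def)
qed

section \<open>Beta distributions and their moments\<close>

definition beta_density :: "real \<Rightarrow> real \<Rightarrow> real \<Rightarrow> real" where
  "beta_density a b x = indicator {0<..<1} x * (x powr (a - 1) * (1 - x) powr (b - 1)) / Beta a b"

definition beta_measure :: "real \<Rightarrow> real \<Rightarrow> real measure" where
  "beta_measure a b = density lborel (\<lambda>x. ennreal (beta_density a b x))"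

lemma beta_density_measurable [measurable]: "beta_density a b \<in> borel_measurable borel"
  unfolding beta_density_def[abs_def] by measurable

lemma sets_beta_measure [simp, measurable_cong]: "sets (beta_measure a b) = sets borel"
  by (simp add: beta_measure_def)

lemma Beta_real_pos:
  fixes a b :: real
  assumes "a > 0" "b > 0"
  shows "Beta a b > 0"
  using assms by (simp add: Beta_def Gamma_real_pos)

lemma beta_density_nonneg: "a > 0 \<Longrightarrow> b > 0 \<Longrightarrow> beta_density a b x \<ge> 0"
  using Beta_real_pos[of a b] by (simp add: beta_density_def)

lemma beta_measure_moment_aux:
  assumes "a > 0" "b > 0"
  shows "has_bochner_integral lborel (\<lambda>x. beta_density a b x * (1 - x) ^ n) (Beta a (b + n) / Beta a b)"
proof (rule has_bochner_integral_nn_integral)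
  have Bp: "Beta a b > 0" "Beta a (b + real n) > 0" using assms by (auto intro!: Beta_real_pos)
  have nn: "0 \<le> beta_density a b x * (1 - x) ^ n" for x
  proof (cases "x < 1")
    case True
    then show ?thesis using beta_density_nonneg[OF assms, of x] by (intro mult_nonneg_nonneg) auto
  qed (simp add: beta_density_def)
  then show "AE x in lborel. 0 \<le> beta_density a b x * (1 - x) ^ n" by simp
  show "0 \<le> Beta a (b + real n) / Beta a b" using Bp by simp
  have "((\<lambda>t. t powr (a - 1) * (1 - t) powr (b + real n - 1)) has_integral Beta a (b + real n)) {0<..<1}"
    using has_integral_Beta_real[of a "b + real n"] assms by (simp add: has_integral_Icc_iff_Ioo)
  then have "((\<lambda>t. (t powr (a - 1) * (1 - t) powr (b + real n - 1)) / Beta a b) has_integral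
      Beta a (b + real n) / Beta a b) {0<..<1}"
    by (rule has_integral_divide)
  then have "((\<lambda>x. if x \<in> {0<..<1} then x powr (a - 1) * (1 - x) powr (b + real n - 1) / Beta a b else 0)
      has_integral Beta a (b + real n) / Beta a b) UNIV"
    by (simp only: has_integral_restrict_UNIV)
  moreover have "(\<lambda>x. if x \<in> {0<..<1} then x powr (a - 1) * (1 - x) powr (b + real n - 1) / Beta a b else 0) =
      (\<lambda>x. beta_density a b x * (1 - x) ^ n)"
  proof
    fix x :: real
    have "(1 - x) powr (b + real n - 1) = (1 - x) powr (b - 1) * (1 - x) ^ n" if "x < 1"
      using that by (simp add: powr_realpow[symmetric] powr_add[symmetric] algebra_simps)
    then show "(if x \<in> {0<..<1} then x powr (a - 1) * (1 - x) powr (b + real n - 1) / Beta a b else 0) =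
      beta_density a b x * (1 - x) ^ n"
      by (simp add: beta_density_def)
  qed
  ultimately show "(\<integral>\<^sup>+ x. ennreal (beta_density a b x * (1 - x) ^ n) \<partial>lborel) =
      ennreal (Beta a (b + real n) / Beta a b)"
    using nn by (intro nn_integral_has_integral_lborel) auto
qed measurable

lemma prob_space_beta_measure:
  assumes "a > 0" "b > 0"
  shows "prob_space (beta_measure a b)"
proof
  have "has_bochner_integral lborel (beta_density a b) 1"
    using beta_measure_moment_aux[OF assms, of 0] Beta_real_pos[OF assms] by simp
  then have "(\<integral>\<^sup>+ x. ennreal (beta_density a b x) \<partial>lborel) = ennreal 1"
    using beta_density_nonneg[OF assms]
    by (subst nn_integral_eq_integral) (auto simp: has_bochner_integral_iff)
  then show "emeasure (beta_measure a b) (space (beta_measure a b)) = 1"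
    by (simp add: beta_measure_def emeasure_density)
qed

lemma beta_measure_moment:
  assumes "a > 0" "b > 0"
  shows "(\<integral>x. (1 - x) ^ n \<partial>beta_measure a b) = Beta a (b + n) / Beta a b"
proof -
  have "(\<integral>x. (1 - x) ^ n \<partial>beta_measure a b) = (\<integral>x. beta_density a b x * (1 - x) ^ n \<partial>lborel)"
    unfolding beta_measure_def by (subst integral_density) (auto simp: beta_density_nonneg assms)
  also have "\<dots> = Beta a (b + n) / Beta a b"
    using beta_measure_moment_aux[OF assms, of n] by (simp add: has_bochner_integral_iff)
  finally show ?thesis .
qed

lemma beta_measure_moment_Suc:
  assumes "a > 0" "b > 0"
  shows "(\<integral>x. (1 - x) ^ Suc n \<partial>beta_measure a b) * (a + b + n) =
    (b + n) * (\<integral>x. (1 - x) ^ n \<partial>beta_measure a b)"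
proof -
  have "(a + (b + real n)) * Beta a (b + real n + 1) = (b + real n) * Beta a (b + real n)"
    by (rule Beta_plus1_right) (use assms in \<open>auto dest: nonpos_Ints_nonpos\<close>)
  then show ?thesis
    unfolding beta_measure_moment[OF assms] using Beta_real_pos[OF assms]
    by (simp add: field_simps)
qed

lemma beta_measure_unit: "AE x in beta_measure a b. x \<in> {0..1}"
  unfolding beta_measure_def
  by (subst AE_density) (auto simp: beta_density_def indicator_def)

text \<open>
  The first two moments already determine the parameters.
\<close>

lemma beta_measure_params_unique:
  assumes eq: "beta_measure a b = beta_measure a' b'" and "a > 0" "b > 0" "a' > 0" "b' > 0"
  shows "a = a'" "b = b'"
proof -
  let ?m = "\<lambda>n. (\<integral>x. (1 - x) ^ n \<partial>beta_measure a b)"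
  interpret prob_space "beta_measure a b" using assms by (intro prob_space_beta_measure)
  have m0: "?m 0 = 1" by (simp add: prob_space)
  have m: "?m (Suc n) * (a + b + n) = (b + n) * ?m n" "?m (Suc n) * (a' + b' + n) = (b' + n) * ?m n" for n
    using beta_measure_moment_Suc[of a b n] beta_measure_moment_Suc[of a' b' n] assms by auto
  have m1: "?m 1 * (a + b) = b" "?m 1 * (a' + b') = b'" using m[of 0] m0 by simp_all
  then have m1pos: "?m 1 > 0" using assms by (metis add_pos_pos zero_less_mult_pos2)
  have m2: "?m 2 * (a + b + 1) = (b + 1) * ?m 1" "?m 2 * (a' + b' + 1) = (b' + 1) * ?m 1"
    using m[of 1] by (simp_all add: numeral_2_eq_2)
  have cross: "y * s' = y' * s" if "m * s = y" "m * s' = y'" for m s s' y y' :: real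
    using that by (auto simp: mult_ac)
  have e1: "b * (a' + b') = b' * (a + b)" by (rule cross[OF m1])
  have "(b + 1) * ?m 1 * (a' + b' + 1) = (b' + 1) * ?m 1 * (a + b + 1)" by (rule cross[OF m2])
  then have e2: "(b + 1) * (a' + b' + 1) = (b' + 1) * (a + b + 1)" using m1pos by simp
  show "a = a'" using e1 e2 by (simp add: algebra_simps)
  then show "b = b'" using e1 assms by (simp add: algebra_simps)
qed

text \<open>
  Polynomials are dense in the continuous functions on the unit interval, so the moments determine
  the characteristic function.
\<close>

lemma unit_interval_moments_unique:
  fixes M N :: "real measure"
  assumes M: "prob_space M" "sets M = sets borel" "AE x in M. x \<in> {0..1}"
    and N: "prob_space N" "sets N = sets borel" "AE x in N. x \<in> {0..1}"
    and eq: "\<And>n. (\<integral>x. (1 - x) ^ n \<partial>M) = (\<integral>x. (1 - x) ^ n \<partial>N)"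
  shows "M = N"
proof -
  have int: "integrable P f" and bound: "\<bar>\<integral>x. f x \<partial>P\<bar> \<le> e"
    if P: "prob_space P" "sets P = sets borel" "AE x in P. x \<in> {0..1}"
      and f: "f \<in> borel_measurable borel" and e: "\<And>x. x \<in> {0..1} \<Longrightarrow> \<bar>f x\<bar> \<le> e"
    for P :: "real measure" and f :: "real \<Rightarrow> real" and e
  proof -
    interpret prob_space P by fact
    have f': "f \<in> borel_measurable P" using f P(2) by (simp cong: measurable_cong_sets)
    have ae: "AE x in P. norm (f x) \<le> e" using P(3) by eventually_elim (use e in auto)
    show i: "integrable P f" by (rule integrable_const_bound[OF ae f'])
    have "\<bar>\<integral>x. f x \<partial>P\<bar> \<le> (\<integral>x. \<bar>f x\<bar> \<partial>P)" by simp
    also have "\<dots> \<le> (\<integral>x. e \<partial>P)" using i ae by (intro integral_mono_AE) auto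
    also have "\<dots> = e" by (simp add: prob_space)
    finally show "\<bar>\<integral>x. f x \<partial>P\<bar> \<le> e" .
  qed
  have cont: "(\<integral>x. f x \<partial>M) = (\<integral>x. f x \<partial>N)" if f: "continuous_on UNIV f" for f :: "real \<Rightarrow> real"
  proof -
    have fb: "f \<in> borel_measurable borel" using f by (rule borel_measurable_continuous_onI)
    have "compact (f ` {0..1})" using f by (intro compact_continuous_image) (auto intro: continuous_on_subset)
    then obtain K where K: "\<And>x. x \<in> {0..1} \<Longrightarrow> \<bar>f x\<bar> \<le> K"
      using compact_imp_bounded[of "f ` {0..1}"] unfolding bounded_iff by (metis imageI real_norm_def)
    have "\<bar>(\<integral>x. f x \<partial>M) - (\<integral>x. f x \<partial>N)\<bar> \<le> e" if e: "e > 0" for e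
    proof -
      have "continuous_on {0..1} (\<lambda>y. f (1 - y))"
        by (intro continuous_on_compose2[OF f]) (auto intro!: continuous_intros)
      then obtain g where g: "real_polynomial_function g"
        and fg: "\<And>y. y \<in> {0..1} \<Longrightarrow> \<bar>f (1 - y) - g y\<bar> < e / 2"
        using Stone_Weierstrass_real_polynomial_function[of "{0..1::real}" "\<lambda>y. f (1 - y)" "e / 2"] e by auto
      obtain p n where p: "g = (\<lambda>x. \<Sum>i\<le>n. p i * x ^ i)"
        using g by (auto simp: real_polynomial_function_iff_sum)
      have pow: "integrable P (\<lambda>x. (1 - x) ^ i)"
        if "prob_space P" "sets P = sets borel" "AE x in P. x \<in> {0..1}" for i and P :: "real measure"
        by (rule int[OF that, where e = 1]) (auto simp: power_le_one abs_le_iff intro: order_trans[of _ 0])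
      have gi: "integrable P (\<lambda>x. g (1 - x))"
        if "prob_space P" "sets P = sets borel" "AE x in P. x \<in> {0..1}" for P :: "real measure"
        unfolding p using pow[OF that] by (intro Bochner_Integration.integrable_sum integrable_mult_right) auto
      have gint: "(\<integral>x. g (1 - x) \<partial>P) = (\<Sum>i\<le>n. p i * (\<integral>x. (1 - x) ^ i \<partial>P))"
        if "prob_space P" "sets P = sets borel" "AE x in P. x \<in> {0..1}" for P :: "real measure"
        unfolding p using pow[OF that] by (subst Bochner_Integration.integral_sum) auto
      have near: "\<bar>(\<integral>x. f x \<partial>P) - (\<integral>x. g (1 - x) \<partial>P)\<bar> \<le> e / 2"
        if P: "prob_space P" "sets P = sets borel" "AE x in P. x \<in> {0..1}" for P :: "real measure"
      proof -
        have "\<bar>\<integral>x. f x - g (1 - x) \<partial>P\<bar> \<le> e / 2"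
        proof (rule bound[OF P])
          show "(\<lambda>x. f x - g (1 - x)) \<in> borel_measurable borel" using fb unfolding p by measurable
          show "\<bar>f x - g (1 - x)\<bar> \<le> e / 2" if "x \<in> {0..1}" for x using fg[of "1 - x"] that by simp
        qed
        then show ?thesis using int[OF P fb K] gi[OF P] by simp
      qed
      have "(\<integral>x. g (1 - x) \<partial>M) = (\<integral>x. g (1 - x) \<partial>N)" by (simp only: gint[OF M] gint[OF N] eq)
      then show ?thesis using near[OF M] near[OF N] by linarith
    qed
    from this[of "\<bar>(\<integral>x. f x \<partial>M) - (\<integral>x. f x \<partial>N)\<bar> / 2"] show ?thesis
      by (cases "(\<integral>x. f x \<partial>M) = (\<integral>x. f x \<partial>N)") simp_all
  qed
  have rM: "real_distribution M" and rN: "real_distribution N"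
    using M N by (auto intro!: real_distribution.intro real_distribution_axioms.intro)
  have "char M = char N"
  proof
    fix t
    have iM: "integrable P (\<lambda>x. iexp (t * x))" if "real_distribution P" for P
    proof -
      interpret real_distribution P by fact
      show ?thesis by (rule integrable_const_bound[of _ 1]) auto
    qed
    show "char M t = char N t"
    proof (rule complex_eqI)
      show "Re (char M t) = Re (char N t)"
        unfolding char_def integral_Re[OF iM[OF rM], symmetric] integral_Re[OF iM[OF rN], symmetric]
        by (simp add: Re_exp) (intro cont continuous_intros)
      show "Im (char M t) = Im (char N t)"
        unfolding char_def integral_Im[OF iM[OF rM], symmetric] integral_Im[OF iM[OF rN], symmetric]
        by (simp add: Im_exp) (intro cont continuous_intros)
    qed
  qed
  then show ?thesis using Levy_uniqueness rM rN by blast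
qed

section \<open>The characterization on a single edge\<close>

context prob_space
begin

definition beta_moment :: "('a \<Rightarrow> real) \<Rightarrow> nat \<Rightarrow> nat \<Rightarrow> real" where
  "beta_moment X a c = expectation (\<lambda>\<omega>. X \<omega> ^ a * (1 - X \<omega>) ^ c)"

text \<open>
  This is \<open>a / (a + b + c)\<close> for the beta law with parameters \<open>a\<close> and \<open>b\<close>: its reciprocal is affine
  in \<open>c\<close>, which is how beta laws are recognized below.
\<close>

definition moment_ratio :: "('a \<Rightarrow> real) \<Rightarrow> nat \<Rightarrow> real" where
  "moment_ratio X c = beta_moment X 1 c / beta_moment X 0 c"

definition unit_valued :: "('a \<Rightarrow> real) \<Rightarrow> bool" where
  "unit_valued X \<longleftrightarrow> random_variable borel X \<and> (\<forall>\<omega>\<in>space M. 0 < X \<omega> \<and> X \<omega> < 1)"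

lemma unit_valued_measurable [measurable_dest]: "unit_valued X \<Longrightarrow> random_variable borel X"
  by (simp add: unit_valued_def)

lemma beta_moment_integrable:
  assumes "unit_valued X"
  shows "integrable M (\<lambda>\<omega>. X \<omega> ^ a * (1 - X \<omega>) ^ c)"
proof (rule integrable_const_bound[of _ 1])
  show "AE \<omega> in M. norm (X \<omega> ^ a * (1 - X \<omega>) ^ c) \<le> 1"
    using assms by (intro AE_I2) (auto simp: unit_valued_def abs_mult power_abs intro!: mult_le_one power_le_one intro: less_imp_le)
qed (use assms in measurable)

lemma beta_moment_pos:
  assumes "unit_valued X"
  shows "beta_moment X a c > 0"
proof -
  have pos: "\<omega> \<in> space M \<Longrightarrow> X \<omega> ^ a * (1 - X \<omega>) ^ c > 0" for \<omega>
    using assms by (simp add: unit_valued_def)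
  have "beta_moment X a c \<ge> 0"
    unfolding beta_moment_def by (rule Bochner_Integration.integral_nonneg) (use pos in \<open>auto intro: less_imp_le\<close>)
  moreover have "beta_moment X a c \<noteq> 0"
  proof
    assume "beta_moment X a c = 0"
    then have "AE \<omega> in M. X \<omega> ^ a * (1 - X \<omega>) ^ c = 0"
      unfolding beta_moment_def using beta_moment_integrable[OF assms] pos
      by (subst (asm) integral_nonneg_eq_0_iff_AE) (simp_all add: less_imp_le)
    moreover have "AE \<omega> in M. X \<omega> ^ a * (1 - X \<omega>) ^ c \<noteq> 0"
      by (rule AE_I2) (metis pos less_irrefl)
    ultimately have "AE \<omega> in M. False" by eventually_elim simp
    then show False by simp
  qed
  ultimately show ?thesis by simp
qed

lemma beta_moment_split:
  assumes "unit_valued X"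
  shows "beta_moment X a c = beta_moment X (Suc a) c + beta_moment X a (Suc c)"
  unfolding beta_moment_def
    Bochner_Integration.integral_add[OF beta_moment_integrable[OF assms] beta_moment_integrable[OF assms], symmetric]
  by (rule Bochner_Integration.integral_cong) (auto simp: algebra_simps)

lemma moment_ratio_facts:
  assumes X: "unit_valued X"
  shows "beta_moment X 1 c = moment_ratio X c * beta_moment X 0 c"
    and "beta_moment X 0 (Suc c) = (1 - moment_ratio X c) * beta_moment X 0 c"
    and "beta_moment X 2 c =
      (moment_ratio X c - (1 - moment_ratio X c) * moment_ratio X (Suc c)) * beta_moment X 0 c"
    and "0 < moment_ratio X c" "moment_ratio X c < 1"
proof -
  have pos: "beta_moment X a c > 0" for a c by (rule beta_moment_pos[OF X])
  show 1: "beta_moment X 1 c = moment_ratio X c * beta_moment X 0 c" for c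
    using pos[of 0 c] by (simp add: moment_ratio_def)
  show 2: "beta_moment X 0 (Suc c) = (1 - moment_ratio X c) * beta_moment X 0 c" for c
    using beta_moment_split[OF X, of 0 c] 1[of c] by (simp add: algebra_simps)
  show "beta_moment X 2 c =
      (moment_ratio X c - (1 - moment_ratio X c) * moment_ratio X (Suc c)) * beta_moment X 0 c"
    using beta_moment_split[OF X, of 1 c] 1[of c] 1[of "Suc c"] 2[of c]
    by (simp add: numeral_2_eq_2 algebra_simps)
  show "0 < moment_ratio X c" using pos[of 1 c] pos[of 0 c] by (simp add: moment_ratio_def)
  show "moment_ratio X c < 1"
    using pos[of 0 "Suc c"] pos[of 0 c] 2[of c] by (simp add: zero_less_mult_iff)
qed

lemma distr_eq_beta_measure:
  assumes X: "unit_valued X" and ab: "a > 0" "b > 0"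
    and ratio: "\<And>c. moment_ratio X c * (a + b + real c) = a"
  shows "distr M borel X = beta_measure a b"
proof (rule unit_interval_moments_unique)
  have [measurable]: "random_variable borel X" using X by measurable
  show "prob_space (distr M borel X)" by (rule prob_space_distr) measurable
  show "AE x in distr M borel X. x \<in> {0..1}"
    using X by (subst AE_distr_iff) (auto simp: unit_valued_def intro!: AE_I2 intro: less_imp_le)
  show "prob_space (beta_measure a b)" by (rule prob_space_beta_measure[OF ab])
  then interpret B: prob_space "beta_measure a b" .
  fix n
  have "beta_moment X 0 n = (\<integral>x. (1 - x) ^ n \<partial>beta_measure a b)"
  proof (induction n)
    case 0
    show ?case by (simp add: beta_moment_def prob_space B.prob_space)
  next
    case (Suc n)
    have "beta_moment X 0 (Suc n) * (a + b + n) = (b + n) * beta_moment X 0 n"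
    proof -
      have "(1 - moment_ratio X n) * beta_moment X 0 n * (a + b + n) =
        (a + b + n - moment_ratio X n * (a + b + n)) * beta_moment X 0 n" by (simp add: algebra_simps)
      then show ?thesis by (simp add: ratio moment_ratio_facts(2)[OF X, of n])
    qed
    then have "beta_moment X 0 (Suc n) * (a + b + n) =
        (\<integral>x. (1 - x) ^ Suc n \<partial>beta_measure a b) * (a + b + n)"
      unfolding beta_measure_moment_Suc[OF ab] Suc .
    then show ?case using ab by simp
  qed
  then show "(\<integral>x. (1 - x) ^ n \<partial>distr M borel X) = (\<integral>x. (1 - x) ^ n \<partial>beta_measure a b)"
    by (subst integral_distr) (auto simp: beta_moment_def)
  show "AE x in beta_measure a b. x \<in> {0..1}" by (rule beta_measure_unit)
qed auto

lemma AE_const_if_ratio_const: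
  assumes X: "unit_valued X" and eq: "moment_ratio X 0 = moment_ratio X 1"
  shows "AE \<omega> in M. X \<omega> = moment_ratio X 0"
proof -
  let ?r = "moment_ratio X 0"
  have m: "beta_moment X 0 0 = 1" by (simp add: beta_moment_def prob_space)
  have m1: "beta_moment X 1 0 = ?r" using moment_ratio_facts(1)[OF X, of 0] m by simp
  have m2: "beta_moment X 2 0 = ?r\<^sup>2"
    using moment_ratio_facts(3)[OF X, of 0] m eq by (simp add: algebra_simps power2_eq_square)
  have i: "integrable M (\<lambda>\<omega>. X \<omega> ^ 2)" "integrable M X"
    using beta_moment_integrable[OF X, of 2 0] beta_moment_integrable[OF X, of 1 0] by simp_all
  have "expectation (\<lambda>\<omega>. (X \<omega> - ?r)\<^sup>2) = expectation (\<lambda>\<omega>. X \<omega> ^ 2 - 2 * ?r * X \<omega> + ?r\<^sup>2)"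
    by (rule Bochner_Integration.integral_cong) (auto simp: power2_eq_square algebra_simps)
  also have "\<dots> = ?r\<^sup>2 - 2 * ?r * ?r + ?r\<^sup>2"
    using i m1 m2 by (simp add: beta_moment_def prob_space)
  finally have "expectation (\<lambda>\<omega>. (X \<omega> - ?r)\<^sup>2) = 0" by (simp add: power2_eq_square)
  moreover have "integrable M (\<lambda>\<omega>. (X \<omega> - ?r)\<^sup>2)"
  proof -
    have "integrable M (\<lambda>\<omega>. X \<omega> ^ 2 - 2 * ?r * X \<omega> + ?r\<^sup>2)" using i by simp
    then show ?thesis by (rule Bochner_Integration.integrable_cong[THEN iffD1, rotated 2]) (auto simp: power2_eq_square algebra_simps)
  qed
  ultimately have "AE \<omega> in M. (X \<omega> - ?r)\<^sup>2 = 0"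
    by (subst (asm) integral_nonneg_eq_0_iff_AE) auto
  then show ?thesis by eventually_elim simp
qed


text \<open>
  In the next lemma \<open>p, q, t, s\<close> are the moment ratios of the four variables on an edge. The
  third relation makes \<open>q\<close> proportional to \<open>t\<close>. Eliminating \<open>p\<close>, \<open>q\<close> and \<open>s\<close> from the fourth one then
  shows that \<open>t (Suc c)\<close> is the harmonic mean of \<open>t c\<close> and \<open>t (Suc (Suc c))\<close>.
\<close>

lemma ratio_recursion_solution:
  fixes p q t s :: "nat \<Rightarrow> real"
  assumes t: "\<And>c. 0 < t c" and q: "\<And>c. 0 < q c" "\<And>c. q c < 1"
    and r1: "\<And>c. t c = p c * (1 - q c)" and r2: "\<And>c. q c = s c * (1 - t c)"
    and r3: "\<And>c. t c * q (Suc c) = q c * t (Suc c)"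
    and r4: "\<And>c. (p c - (1 - p c) * p (Suc c)) * q (Suc (Suc c)) * (1 - q (Suc c)) * (1 - q c) =
      s c * (1 - t c) * (t (Suc c) - (1 - t (Suc c)) * t (Suc (Suc c)))"
  obtains A B k where "k > 0" "\<And>c. t c * (A + B * real c) = 1" "\<And>c. q c = k * t c"
proof -
  define k where "k = q 0 / t 0"
  have k: "k > 0" using t[of 0] q[of 0] by (simp add: k_def)
  have qk: "q c = k * t c" for c
  proof (induction c)
    case 0
    then show ?case using t[of 0] by (simp add: k_def)
  next
    case (Suc c)
    have "t c * q (Suc c) = t c * (k * t (Suc c))" using r3[of c] Suc by simp
    then show ?case using t[of c] by simp
  qed
  have step: "2 * t c * t (Suc (Suc c)) = t (Suc c) * (t c + t (Suc (Suc c)))" for c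
  proof -
    let ?a = "t c" and ?b = "t (Suc c)" and ?d = "t (Suc (Suc c))"
    have "(p c - (1 - p c) * p (Suc c)) * (1 - q (Suc c)) * (1 - q c) =
        (p c * (1 - q c)) * (1 - q (Suc c)) - (1 - q c - p c * (1 - q c)) * (p (Suc c) * (1 - q (Suc c)))"
      by (simp add: algebra_simps)
    also have "\<dots> = ?a * (1 - k * ?b) - (1 - k * ?a - ?a) * ?b"
      by (simp only: r1[of c, symmetric] r1[of "Suc c", symmetric]) (simp only: qk)
    also have "\<dots> = ?a - ?b + ?a * ?b" by (simp add: algebra_simps)
    finally have L: "(p c - (1 - p c) * p (Suc c)) * (1 - q (Suc c)) * (1 - q c) = ?a - ?b + ?a * ?b" .
    have "(?a - ?b + ?a * ?b) * (k * ?d) =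
        (p c - (1 - p c) * p (Suc c)) * q (Suc (Suc c)) * (1 - q (Suc c)) * (1 - q c)"
      unfolding L[symmetric] by (simp add: qk[of "Suc (Suc c)"])
    also have "\<dots> = s c * (1 - ?a) * (?b - (1 - ?b) * ?d)" by (rule r4)
    also have "\<dots> = k * ?a * (?b - (1 - ?b) * ?d)" by (simp only: r2[of c, symmetric] qk[of c])
    finally have "k * ((?a - ?b + ?a * ?b) * ?d) = k * (?a * (?b - (1 - ?b) * ?d))"
      by (simp add: mult_ac)
    then have "(?a - ?b + ?a * ?b) * ?d = ?a * (?b - (1 - ?b) * ?d)" using k by simp
    then show ?thesis by (simp add: algebra_simps)
  qed
  define A where "A = 1 / t 0"
  define B where "B = 1 / t 1 - 1 / t 0"
  have inv: "1 / t c = A + B * real c \<and> 1 / t (Suc c) = A + B * real (Suc c)" for c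
  proof (induction c)
    case 0
    then show ?case by (simp add: A_def B_def)
  next
    case (Suc c)
    have "2 / t (Suc c) = 1 / t c + 1 / t (Suc (Suc c))"
      using step[of c] t[of c] t[of "Suc c"] t[of "Suc (Suc c)"] by (simp add: field_simps)
    then have "1 / t (Suc (Suc c)) = 2 * (1 / t (Suc c)) - 1 / t c" by simp
    then show ?case using Suc by (simp add: algebra_simps)
  qed
  have "t c * (A + B * real c) = 1" for c
    using inv[of c] t[of c] by (metis less_irrefl nonzero_mult_div_cancel_left times_divide_eq_right mult.right_neutral)
  then show ?thesis using that[of k A B] k qk by blast
qed

text \<open>
  The relations imply \<open>(1 - X i) * (1 - X j) = (1 - X' i) * (1 - X' j)\<close>. Thus the expectation of
  \<open>X' i ^ a * X j ^ b\<close> times the \<open>c\<close>-th power of this product factors in two ways, once by each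
  independence. The cases of \<open>(a, b)\<close> equal to \<open>(0, 0)\<close>, \<open>(1, 0)\<close>, \<open>(0, 1)\<close>, \<open>(1, 1)\<close>, \<open>(2, 1)\<close> and all
  \<open>c\<close> put the moment ratios under the previous lemma. If the common difference \<open>B\<close> is zero, the
  ratios are constant, the variances vanish, and the variables are constant; otherwise the ratios are
  those of beta laws.
\<close>

lemma beta_characterization_on_edge:
  fixes X X' :: "'i \<Rightarrow> 'a \<Rightarrow> real"
  assumes ij: "i \<noteq> j"
    and unit: "unit_valued (X i)" "unit_valued (X j)" "unit_valued (X' i)" "unit_valued (X' j)"
    and ind: "indep_vars (\<lambda>_. borel) X {i, j}" "indep_vars (\<lambda>_. borel) X' {i, j}"
    and rel1: "\<And>\<omega>. \<omega> \<in> space M \<Longrightarrow> X' i \<omega> = X i \<omega> * (1 - X j \<omega>)"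
    and rel2: "\<And>\<omega>. \<omega> \<in> space M \<Longrightarrow> X' j \<omega> * (1 - X' i \<omega>) = X j \<omega>"
  shows "(\<forall>Z\<in>{X i, X j, X' i, X' j}. \<exists>c. AE \<omega> in M. Z \<omega> = c) \<or>
    (\<exists>a b g. a > 0 \<and> b > 0 \<and> g > 0 \<and>
      distr M borel (X i) = beta_measure a g \<and> distr M borel (X j) = beta_measure b (g + a) \<and>
      distr M borel (X' i) = beta_measure a (g + b) \<and> distr M borel (X' j) = beta_measure b g)"
proof -
  have prod: "expectation (\<lambda>\<omega>. (Z i \<omega> ^ k * (1 - Z i \<omega>) ^ l) * (Z j \<omega> ^ m * (1 - Z j \<omega>) ^ n)) =
      beta_moment (Z i) k l * beta_moment (Z j) m n"
    if Z: "indep_vars (\<lambda>_. borel) Z {i, j}" "unit_valued (Z i)" "unit_valued (Z j)" for Z k l m n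
  proof -
    define f where "f = (\<lambda>a x. if a = i then x ^ k * (1 - x) ^ l else x ^ m * (1 - x) ^ n :: real)"
    have "indep_vars (\<lambda>_. borel) (\<lambda>a \<omega>. f a (Z a \<omega>)) {i, j}"
      by (rule indep_vars_compose2[OF Z(1)]) (simp add: f_def)
    moreover have "integrable M (\<lambda>\<omega>. f a (Z a \<omega>))" if "a \<in> {i, j}" for a
      using that ij Z beta_moment_integrable by (auto simp: f_def)
    ultimately have "expectation (\<lambda>\<omega>. \<Prod>a\<in>{i, j}. f a (Z a \<omega>)) = (\<Prod>a\<in>{i, j}. expectation (\<lambda>\<omega>. f a (Z a \<omega>)))"
      by (intro indep_vars_lebesgue_integral) auto
    then show ?thesis using ij by (simp add: f_def beta_moment_def)
  qed
  have FE: "beta_moment (X i) a c * beta_moment (X j) b (a + c) =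
      beta_moment (X' j) b c * beta_moment (X' i) a (b + c)" for a b c
  proof -
    have "(X i \<omega> ^ a * (1 - X i \<omega>) ^ c) * (X j \<omega> ^ b * (1 - X j \<omega>) ^ (a + c)) =
        (X' i \<omega> ^ a * (1 - X' i \<omega>) ^ (b + c)) * (X' j \<omega> ^ b * (1 - X' j \<omega>) ^ c)" if \<omega>: "\<omega> \<in> space M" for \<omega>
    proof -
      have both: "(1 - X i \<omega>) * (1 - X j \<omega>) = (1 - X' i \<omega>) * (1 - X' j \<omega>)"
        using rel1[OF \<omega>] rel2[OF \<omega>] by (simp add: algebra_simps)
      have "(X i \<omega> ^ a * (1 - X i \<omega>) ^ c) * (X j \<omega> ^ b * (1 - X j \<omega>) ^ (a + c)) =
          (X i \<omega> * (1 - X j \<omega>)) ^ a * X j \<omega> ^ b * ((1 - X i \<omega>) * (1 - X j \<omega>)) ^ c"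
        by (simp add: power_add power_mult_distrib mult_ac)
      also have "\<dots> = X' i \<omega> ^ a * (X' j \<omega> * (1 - X' i \<omega>)) ^ b * ((1 - X' i \<omega>) * (1 - X' j \<omega>)) ^ c"
        by (simp only: both rel1[OF \<omega>, symmetric] rel2[OF \<omega>])
      also have "\<dots> = (X' i \<omega> ^ a * (1 - X' i \<omega>) ^ (b + c)) * (X' j \<omega> ^ b * (1 - X' j \<omega>) ^ c)"
        by (simp add: power_add power_mult_distrib mult_ac)
      finally show ?thesis .
    qed
    then have "expectation (\<lambda>\<omega>. (X i \<omega> ^ a * (1 - X i \<omega>) ^ c) * (X j \<omega> ^ b * (1 - X j \<omega>) ^ (a + c))) =
        expectation (\<lambda>\<omega>. (X' i \<omega> ^ a * (1 - X' i \<omega>) ^ (b + c)) * (X' j \<omega> ^ b * (1 - X' j \<omega>) ^ c))"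
      by (intro Bochner_Integration.integral_cong) auto
    then show ?thesis
      unfolding prod[OF ind(1) unit(1,2)] prod[OF ind(2) unit(3,4)] by (simp add: mult.commute)
  qed
  define p where "p = moment_ratio (X i)"
  define q where "q = moment_ratio (X j)"
  define t where "t = moment_ratio (X' i)"
  define s where "s = moment_ratio (X' j)"
  note P = moment_ratio_facts[OF unit(1), folded p_def] and Q = moment_ratio_facts[OF unit(2), folded q_def]
    and T = moment_ratio_facts[OF unit(3), folded t_def] and S = moment_ratio_facts[OF unit(4), folded s_def]
  have base: "beta_moment (X i) 0 c * beta_moment (X j) 0 c = beta_moment (X' j) 0 c * beta_moment (X' i) 0 c" for c
    using FE[of 0 c 0] by simp
  have ne: "beta_moment (X' j) 0 c * beta_moment (X' i) 0 c \<noteq> 0" for c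
    using beta_moment_pos[OF unit(3), of 0 c] beta_moment_pos[OF unit(4), of 0 c] by simp
  have cancel: "x = y" if "x * (beta_moment (X i) 0 c * beta_moment (X j) 0 c) =
      y * (beta_moment (X' j) 0 c * beta_moment (X' i) 0 c)" for x y c
    using that ne[of c] by (simp add: base)
  have r1: "t c = p c * (1 - q c)" for c
    by (rule cancel[of _ c, symmetric]) (use FE[of 1 c 0] P(1)[of c] Q(2)[of c] T(1)[of c] in \<open>simp add: mult_ac\<close>)
  have r2: "q c = s c * (1 - t c)" for c
    by (rule cancel[of _ c]) (use FE[of 0 c 1] Q(1)[of c] S(1)[of c] T(2)[of c] in \<open>simp add: mult_ac\<close>)
  have r3': "p c * (1 - q c) * q (Suc c) = s c * (1 - t c) * t (Suc c)" for c
    by (rule cancel[of _ c]) (use FE[of 1 c 1] P(1)[of c] Q(1)[of "Suc c"] Q(2)[of c] S(1)[of c]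
        T(1)[of "Suc c"] T(2)[of c] in \<open>simp add: mult_ac\<close>)
  have r3: "t c * q (Suc c) = q c * t (Suc c)" for c
  proof -
    have "t c * q (Suc c) = p c * (1 - q c) * q (Suc c)" by (simp only: r1[of c])
    also have "\<dots> = q c * t (Suc c)" unfolding r3' by (simp only: r2[of c, symmetric])
    finally show ?thesis .
  qed
  have r4: "(p c - (1 - p c) * p (Suc c)) * q (Suc (Suc c)) * (1 - q (Suc c)) * (1 - q c) =
      s c * (1 - t c) * (t (Suc c) - (1 - t (Suc c)) * t (Suc (Suc c)))" for c
    by (rule cancel[of _ c]) (use FE[of 2 c 1] P(3)[of c] Q(1)[of "Suc (Suc c)"] Q(2)[of c] Q(2)[of "Suc c"]
        S(1)[of c] T(3)[of "Suc c"] T(2)[of c] in \<open>simp add: mult_ac\<close>)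
  obtain A B k where k: "k > 0" and tAB: "\<And>c. t c * (A + B * real c) = 1" and qk: "\<And>c. q c = k * t c"
    by (rule ratio_recursion_solution[where p = p and q = q and t = t and s = s, OF T(4) Q(4) Q(5) r1 r2 r3 r4]) (rule that)
  have pA: "p c * (A - k + B * real c) = 1" for c
  proof -
    have "t c * (p c * (A - k + B * real c)) = p c * (t c * (A + B * real c) - k * t c)" by (simp add: algebra_simps)
    also have "\<dots> = t c" using r1[of c] by (simp add: tAB qk)
    finally show ?thesis using T(4)[of c] by simp
  qed
  have sA: "s c * (A - 1 + B * real c) = k" for c
  proof -
    have "t c * (s c * (A - 1 + B * real c)) = s c * (t c * (A + B * real c) - t c)" by (simp add: algebra_simps)
    also have "\<dots> = t c * k" using r2[of c] qk[of c] by (simp add: tAB mult.commute)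
    finally show ?thesis using T(4)[of c] by simp
  qed
  \<comment> \<open>a decreasing progression would eventually be negative, unlike the reciprocals of \<open>t\<close>\<close>
  have Bnn: "B \<ge> 0"
  proof (rule ccontr)
    assume "\<not> B \<ge> 0"
    then obtain n where n: "A < real n * (- B)" using reals_Archimedean3[of "- B"] by auto
    have "t n * (A + B * real n) > 0" using tAB[of n] by simp
    then show False using n T(4)[of n] by (simp add: zero_less_mult_iff mult.commute)
  qed
  show ?thesis
  proof (cases "B = 0")
    case True
    have "t 0 = t 1" using tAB[of 0] tAB[of 1] True T(4)[of 0] by (metis mult_cancel_right mult_zero_left mult_zero_right zero_neq_one)
    moreover from this have "q 0 = q 1" by (simp add: qk)
    moreover have "p 0 = p 1"
      using pA[of 0] pA[of 1] True by (metis mult_cancel_right mult_zero_left mult_zero_right zero_neq_one)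
    moreover have "s 0 = s 1"
      using sA[of 0] sA[of 1] True k by (metis mult_cancel_right mult_zero_left mult_zero_right less_irrefl)
    ultimately have "AE \<omega> in M. X i \<omega> = p 0" "AE \<omega> in M. X j \<omega> = q 0" "AE \<omega> in M. X' i \<omega> = t 0" "AE \<omega> in M. X' j \<omega> = s 0"
      using AE_const_if_ratio_const[OF unit(1), folded p_def] AE_const_if_ratio_const[OF unit(2), folded q_def]
        AE_const_if_ratio_const[OF unit(3), folded t_def] AE_const_if_ratio_const[OF unit(4), folded s_def]
      by simp_all
    then show ?thesis by auto
  next
    case False
    then have B: "B > 0" using Bnn by simp
    define a where "a = 1 / B"
    define b where "b = k / B"
    define g where "g = (A - 1 - k) / B"
    have "A - k > 1"
    proof -
      have "p 0 * (A - k) = 1" using pA[of 0] by simp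
      moreover have "A - k > 0" using calculation P(4)[of 0] by (metis zero_less_mult_pos zero_less_one)
      ultimately show ?thesis using P(5)[of 0] mult_strict_right_mono[of "p 0" 1 "A - k"] by simp
    qed
    then have pos: "a > 0" "b > 0" "g > 0" using B k by (auto simp: a_def b_def g_def)
    have "distr M borel (X i) = beta_measure a g"
      by (rule distr_eq_beta_measure[OF unit(1)])
        (use pos pA B in \<open>simp_all add: p_def[symmetric] a_def b_def g_def field_simps\<close>)
    moreover have "distr M borel (X j) = beta_measure b (g + a)"
      by (rule distr_eq_beta_measure[OF unit(2)])
        (use pos tAB B in \<open>simp_all add: q_def[symmetric] a_def b_def g_def qk field_simps\<close>)
    moreover have "distr M borel (X' i) = beta_measure a (g + b)"
      by (rule distr_eq_beta_measure[OF unit(3)])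
        (use pos tAB B in \<open>simp_all add: t_def[symmetric] a_def b_def g_def field_simps\<close>)
    moreover have "distr M borel (X' j) = beta_measure b g"
      by (rule distr_eq_beta_measure[OF unit(4)])
        (use pos sA B in \<open>simp_all add: s_def[symmetric] a_def b_def g_def field_simps\<close>)
    ultimately show ?thesis using pos by blast
  qed
qed

end

section \<open>Triangular scalings of Lebesgue measure\<close>

abbreviation lborel_fun :: "('v::finite \<Rightarrow> real) measure" where
  "lborel_fun \<equiv> Pi\<^sub>M UNIV (\<lambda>_. lborel)"

interpretation lborel_product: product_sigma_finite "\<lambda>_. lborel :: real measure"
  by (simp add: product_sigma_finite_def sigma_finite_lborel)

lemma measurable_vec_lambda [measurable]:
  "(\<lambda>g. \<chi> i. g i) \<in> borel_measurable (Pi\<^sub>M (UNIV :: 'v::finite set) (\<lambda>_. borel :: real measure))"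
proof (rule borel_measurable_euclidean_space[THEN iffD2], rule ballI)
  fix b :: "real^'v" assume "b \<in> Basis"
  then obtain i where "b = axis i 1" by (auto simp: Basis_vec_def)
  then show "(\<lambda>g. (\<chi> i. g i) \<bullet> b) \<in> borel_measurable (Pi\<^sub>M UNIV (\<lambda>_. borel))"
    by (simp add: inner_axis)
qed

lemma measurable_vec_lambda_lborel [measurable]:
  "(\<lambda>g. \<chi> i. g i) \<in> borel_measurable (lborel_fun :: ('v::finite \<Rightarrow> real) measure)"
  using measurable_vec_lambda by (simp cong: measurable_cong_sets sets_PiM_cong)

lemma lborel_vec_eq: "(lborel :: (real^'v::finite) measure) = distr lborel_fun borel (\<lambda>g. \<chi> i. g i)"
proof (rule lborel_eqI)
  fix l u :: "real^'v"
  assume "\<And>b. b \<in> Basis \<Longrightarrow> l \<bullet> b \<le> u \<bullet> b"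
  then have le: "l $ i \<le> u $ i" for i by (metis axis_in_Basis_iff inner_axis inner_real_def mult.right_neutral Basis_real_def singletonI inner_commute)
  have box: "(\<lambda>g. \<chi> i. g i) -` box l u \<inter> space lborel_fun = Pi\<^sub>E UNIV (\<lambda>i. {l $ i<..<u $ i})"
    by (auto simp: space_PiM mem_box_cart PiE_iff)
  have "emeasure (distr lborel_fun borel (\<lambda>g. \<chi> i. g i)) (box l u) =
      emeasure lborel_fun (Pi\<^sub>E UNIV (\<lambda>i. {l $ i<..<u $ i}))"
    by (subst emeasure_distr) (auto simp: box)
  also have "\<dots> = (\<Prod>i\<in>UNIV. ennreal (u $ i - l $ i))"
    using le by (subst lborel_product.emeasure_PiM) auto
  also have "\<dots> = ennreal (\<Prod>i\<in>UNIV. u $ i - l $ i)"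
    using le by (intro prod_ennreal) auto
  also have "(\<Prod>i\<in>UNIV. u $ i - l $ i) = (\<Prod>b\<in>Basis. (u - l) \<bullet> b)"
  proof -
    have "(\<Prod>b\<in>Basis. (u - l) \<bullet> b) = (\<Prod>b\<in>range (\<lambda>i. axis i 1). (u - l) \<bullet> b)"
      by (rule prod.cong) (auto simp: Basis_vec_def)
    also have "\<dots> = (\<Prod>i\<in>UNIV. (u - l) \<bullet> axis i 1)"
      by (subst prod.reindex) (auto simp: inj_on_def axis_eq_axis)
    finally show ?thesis by (simp add: inner_axis)
  qed
  finally show "emeasure (distr lborel_fun borel (\<lambda>g. \<chi> i. g i)) (box l u) = (\<Prod>b\<in>Basis. (u - l) \<bullet> b)" .
qed simp

lemma nn_integral_scale_coordinate:
  fixes F :: "('v::finite \<Rightarrow> real) \<Rightarrow> ennreal"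
  assumes F [measurable]: "F \<in> borel_measurable lborel_fun"
    and c [measurable]: "c \<in> borel_measurable lborel_fun"
    and pos: "\<And>g. c g > 0" and indep: "\<And>g t. c (g(i := t)) = c g"
  shows "(\<integral>\<^sup>+g. F g \<partial>lborel_fun) = (\<integral>\<^sup>+g. F (g(i := g i * c g)) * ennreal (c g) \<partial>lborel_fun)"
proof -
  let ?I = "UNIV - {i}"
  have ins: "insert i ?I = UNIV" by auto
  have F' [measurable]: "F \<in> borel_measurable (Pi\<^sub>M (insert i ?I) (\<lambda>_. lborel))" by (simp add: ins)
  have upd: "(\<lambda>g. g(i := g i * c g)) \<in> measurable lborel_fun lborel_fun"
  proof (rule measurable_PiM_single')
    show "(\<lambda>g. (g(i := g i * c g)) k) \<in> measurable lborel_fun lborel" for k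
      by (cases "k = i") (simp_all, measurable)
  qed (auto simp: space_PiM)
  have FT [measurable]: "(\<lambda>g. F (g(i := g i * c g)) * ennreal (c g)) \<in> borel_measurable (Pi\<^sub>M (insert i ?I) (\<lambda>_. lborel))"
    unfolding ins using upd by measurable
  have slice: "(\<integral>\<^sup>+y. F (x(i := y)) \<partial>lborel) =
      (\<integral>\<^sup>+y. F (x(i := y, i := (x(i := y)) i * c (x(i := y)))) * ennreal (c (x(i := y))) \<partial>lborel)"
    if x: "x \<in> space (Pi\<^sub>M ?I (\<lambda>_. lborel))" for x
  proof -
    have upd1: "(\<lambda>y. x(i := y)) \<in> measurable lborel (Pi\<^sub>M (insert i ?I) (\<lambda>_. lborel))"
      by (rule measurable_component_update[OF x]) simp
    have Fx [measurable]: "(\<lambda>y. F (x(i := y))) \<in> borel_measurable borel"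
      using measurable_compose[OF upd1 F'] by simp
    have "(\<integral>\<^sup>+y. F (x(i := y)) \<partial>lborel) = ennreal \<bar>c x\<bar> * (\<integral>\<^sup>+y. F (x(i := 0 + c x * y)) \<partial>lborel)"
      by (rule nn_integral_real_affine[OF Fx]) (use pos[of x] in simp)
    also have "\<dots> = (\<integral>\<^sup>+y. ennreal (c x) * F (x(i := c x * y)) \<partial>lborel)"
      using pos[of x] by (subst nn_integral_cmult) auto
    finally show ?thesis by (simp add: indep mult.commute)
  qed
  have "(\<integral>\<^sup>+g. F g \<partial>lborel_fun) = (\<integral>\<^sup>+x. (\<integral>\<^sup>+y. F (x(i := y)) \<partial>lborel) \<partial>Pi\<^sub>M ?I (\<lambda>_. lborel))"
    using lborel_product.product_nn_integral_insert[of ?I i F] F' by (simp add: ins)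
  also have "\<dots> = (\<integral>\<^sup>+x. (\<integral>\<^sup>+y. F (x(i := y, i := (x(i := y)) i * c (x(i := y)))) * ennreal (c (x(i := y))) \<partial>lborel)
      \<partial>Pi\<^sub>M ?I (\<lambda>_. lborel))"
    by (intro nn_integral_cong slice)
  also have "\<dots> = (\<integral>\<^sup>+g. F (g(i := g i * c g)) * ennreal (c g) \<partial>lborel_fun)"
    using lborel_product.product_nn_integral_insert[OF _ _ FT] by (simp add: ins)
  finally show ?thesis .
qed

text \<open>
  With \<open>S = UNIV\<close> and \<open>\<gamma> y = 1 - y\<close> this is \<open>phi D\<close>, on functions instead of vectors. A general \<open>\<gamma>\<close> makes it possible to redefine the
  factor where it is not positive, so that the map is a bijection of the whole space.
\<close>

definition scale_on :: "'v set \<Rightarrow> ('v::finite) rel \<Rightarrow> (real \<Rightarrow> real) \<Rightarrow> ('v \<Rightarrow> real) \<Rightarrow> 'v \<Rightarrow> real" where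
  "scale_on S D \<gamma> g i = (if i \<in> S then g i * (\<Prod>c\<in>{c. (i, c) \<in> D}. \<gamma> (g c)) else g i)"

lemma scale_on_measurable:
  assumes [measurable]: "\<gamma> \<in> borel_measurable borel"
  shows "scale_on S D \<gamma> \<in> measurable lborel_fun lborel_fun"
proof (rule measurable_PiM_single')
  show "(\<lambda>g. scale_on S D \<gamma> g i) \<in> measurable lborel_fun lborel" for i
    unfolding scale_on_def by (cases "i \<in> S") simp_all
qed (auto simp: space_PiM)

text \<open>
  The substitution is made one coordinate at a time. A source \<open>i\<close> of \<open>S\<close> occurs in none of the factors
  of the other vertices of \<open>S\<close>, so that these are unaffected by the scaling of coordinate \<open>i\<close>.
\<close>

lemma nn_integral_scale_on:
  fixes F :: "('v::finite \<Rightarrow> real) \<Rightarrow> ennreal"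
  assumes D: "moral_dag E D" and \<gamma> [measurable]: "\<gamma> \<in> borel_measurable borel" and pos: "\<And>t. \<gamma> t > 0"
    and F: "F \<in> borel_measurable lborel_fun"
  shows "(\<integral>\<^sup>+g. F g \<partial>lborel_fun) =
    (\<integral>\<^sup>+g. F (scale_on S D \<gamma> g) * ennreal (\<Prod>i\<in>S. \<Prod>c\<in>{c. (i, c) \<in> D}. \<gamma> (g c)) \<partial>lborel_fun)"
proof (induction "card S" arbitrary: S rule: less_induct)
  case less
  show ?case
  proof (cases "S = {}")
    case True
    have "scale_on {} D \<gamma> = id" by (auto simp: fun_eq_iff scale_on_def)
    then show ?thesis using True by simp
  next
    case False
    obtain r where Dr: "D = oriented_by E r" using moral_dag_rank[OF D] by blast
    obtain i where i: "i \<in> S" and imin: "\<And>a. a \<in> S \<Longrightarrow> r i \<le> r a"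
      using ex_is_arg_min_if_finite[of S r] False by (auto simp: is_arg_min_linorder)
    have source: "(a, i) \<notin> D" if "a \<in> S" for a using imin[OF that] by (auto simp: Dr oriented_by_def)
    define c where "c g = (\<Prod>k\<in>{k. (i, k) \<in> D}. \<gamma> (g k))" for g :: "'v \<Rightarrow> real"
    define J where "J g = (\<Prod>a\<in>S - {i}. \<Prod>k\<in>{k. (a, k) \<in> D}. \<gamma> (g k))" for g :: "'v \<Rightarrow> real"
    have cpos: "c g > 0" and Jpos: "J g > 0" for g using pos by (auto simp: c_def J_def intro!: prod_pos)
    have ci: "c (g(i := t)) = c g" for g t
      unfolding c_def by (rule prod.cong) (use source[OF i] in auto)
    have Ji: "J (g(i := t)) = J g" for g t
      unfolding J_def by (intro prod.cong refl) (use source in auto)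
    have [measurable]: "c \<in> borel_measurable lborel_fun" "J \<in> borel_measurable lborel_fun"
      unfolding c_def J_def by measurable
    have mF: "(\<lambda>g. F (scale_on (S - {i}) D \<gamma> g) * ennreal (J g)) \<in> borel_measurable lborel_fun"
      using measurable_compose[OF scale_on_measurable[OF \<gamma>] F] by measurable
    have sc: "scale_on (S - {i}) D \<gamma> (g(i := g i * c g)) = scale_on S D \<gamma> g" for g
    proof
      fix a
      have "(\<Prod>k\<in>{k. (a, k) \<in> D}. \<gamma> ((g(i := g i * c g)) k)) = (\<Prod>k\<in>{k. (a, k) \<in> D}. \<gamma> (g k))" if "a \<in> S"
        by (rule prod.cong) (use source[OF that] in auto)
      then show "scale_on (S - {i}) D \<gamma> (g(i := g i * c g)) a = scale_on S D \<gamma> g a"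
        using i by (auto simp: scale_on_def c_def)
    qed
    have "card (S - {i}) < card S" by (rule psubset_card_mono) (use i in auto)
    from less.hyps[OF this]
    have "(\<integral>\<^sup>+g. F g \<partial>lborel_fun) = (\<integral>\<^sup>+g. F (scale_on (S - {i}) D \<gamma> g) * ennreal (J g) \<partial>lborel_fun)"
      by (simp add: J_def)
    also have "\<dots> = (\<integral>\<^sup>+g. F (scale_on (S - {i}) D \<gamma> (g(i := g i * c g))) * ennreal (J (g(i := g i * c g))) * ennreal (c g) \<partial>lborel_fun)"
      by (rule nn_integral_scale_coordinate[OF mF _ cpos ci]) measurable
    also have "\<dots> = (\<integral>\<^sup>+g. F (scale_on S D \<gamma> g) * ennreal (\<Prod>a\<in>S. \<Prod>k\<in>{k. (a, k) \<in> D}. \<gamma> (g k)) \<partial>lborel_fun)"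
    proof (rule nn_integral_cong)
      fix g :: "'v \<Rightarrow> real"
      have "(\<Prod>a\<in>S. \<Prod>k\<in>{k. (a, k) \<in> D}. \<gamma> (g k)) = c g * J g"
        using i by (simp add: c_def J_def prod.remove)
      then show "F (scale_on (S - {i}) D \<gamma> (g(i := g i * c g))) * ennreal (J (g(i := g i * c g))) * ennreal (c g) =
          F (scale_on S D \<gamma> g) * ennreal (\<Prod>a\<in>S. \<Prod>k\<in>{k. (a, k) \<in> D}. \<gamma> (g k))"
        unfolding sc Ji using cpos[of g] Jpos[of g] by (simp add: ennreal_mult less_imp_le mult_ac)
    qed
    finally show ?thesis .
  qed
qed

lemma PiM_density_lborel:
  fixes f :: "'v::finite \<Rightarrow> real \<Rightarrow> ennreal"
  assumes f [measurable]: "\<And>i. f i \<in> borel_measurable borel"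
    and p: "\<And>i. prob_space (density lborel (f i))"
  shows "Pi\<^sub>M UNIV (\<lambda>i. density lborel (f i)) = density lborel_fun (\<lambda>g. \<Prod>i\<in>UNIV. f i (g i))"
proof -
  interpret P: product_sigma_finite "\<lambda>i. density lborel (f i)"
    by (simp add: product_sigma_finite_def p prob_space_imp_sigma_finite)
  have "density lborel_fun (\<lambda>g. \<Prod>i\<in>UNIV. f i (g i)) = Pi\<^sub>M UNIV (\<lambda>i. density lborel (f i))"
  proof (rule P.PiM_eqI)
    show "sets (density lborel_fun (\<lambda>g. \<Prod>i\<in>UNIV. f i (g i))) = sets (Pi\<^sub>M UNIV (\<lambda>i. density lborel (f i)))"
      by (simp cong: sets_PiM_cong)
    fix A :: "'v \<Rightarrow> real set" assume "\<And>i. i \<in> UNIV \<Longrightarrow> A i \<in> sets (density lborel (f i))"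
    then have A [measurable]: "\<And>i. A i \<in> sets borel" by simp
    have "emeasure (density lborel_fun (\<lambda>g. \<Prod>i\<in>UNIV. f i (g i))) (Pi\<^sub>E UNIV A) =
        (\<integral>\<^sup>+g. (\<Prod>i\<in>UNIV. f i (g i)) * indicator (Pi\<^sub>E UNIV A) g \<partial>lborel_fun)"
      by (rule emeasure_density) (auto intro!: sets_PiM_I_finite)
    also have "\<dots> = (\<integral>\<^sup>+g. (\<Prod>i\<in>UNIV. f i (g i) * indicator (A i) (g i)) \<partial>lborel_fun)"
    proof (rule nn_integral_cong)
      fix g :: "'v \<Rightarrow> real"
      have "indicator (Pi\<^sub>E UNIV A) g = (\<Prod>i\<in>UNIV. indicator (A i) (g i) :: ennreal)"
        by (cases "\<forall>i. g i \<in> A i") (auto simp: PiE_iff indicator_def intro!: prod_zero[symmetric])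
      then show "(\<Prod>i\<in>UNIV. f i (g i)) * indicator (Pi\<^sub>E UNIV A) g = (\<Prod>i\<in>UNIV. f i (g i) * indicator (A i) (g i))"
        by (simp add: prod.distrib)
    qed
    also have "\<dots> = (\<Prod>i\<in>UNIV. \<integral>\<^sup>+x. f i x * indicator (A i) x \<partial>lborel)"
      by (rule lborel_product.product_nn_integral_prod) auto
    also have "\<dots> = (\<Prod>i\<in>UNIV. emeasure (density lborel (f i)) (A i))"
      by (intro prod.cong refl emeasure_density[symmetric]) auto
    finally show "emeasure (density lborel_fun (\<lambda>g. \<Prod>i\<in>UNIV. f i (g i))) (Pi\<^sub>E UNIV A) =
        (\<Prod>i\<in>UNIV. emeasure (density lborel (f i)) (A i))" .
  qed simp
  then show ?thesis ..
qed

text \<open>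
  The density \<open>k\<close> is given by its pullback to the coordinates \<open>Z\<close>; in this form the inverse of the
  scaling is never needed.
\<close>

lemma (in prob_space) distributed_scale_on:
  fixes Z :: "'v::finite \<Rightarrow> 'a \<Rightarrow> real" and k :: "real^'v \<Rightarrow> ennreal"
  assumes D: "moral_dag E D" and \<gamma> [measurable]: "\<gamma> \<in> borel_measurable borel" and pos: "\<And>t. \<gamma> t > 0"
    and ind: "indep_vars (\<lambda>_. borel) Z UNIV"
    and f [measurable]: "\<And>i. f i \<in> borel_measurable borel"
    and law: "\<And>i. distr M borel (Z i) = density lborel (f i)"
    and k [measurable]: "k \<in> borel_measurable borel"
    and kernel: "\<And>g. k (\<chi> i. scale_on UNIV D \<gamma> g i) * ennreal (\<Prod>i\<in>UNIV. \<Prod>c\<in>{c. (i, c) \<in> D}. \<gamma> (g c)) =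
      (\<Prod>i\<in>UNIV. f i (g i))"
    and X [measurable]: "X \<in> borel_measurable M"
    and XZ: "\<And>\<omega>. \<omega> \<in> space M \<Longrightarrow> X \<omega> = (\<chi> i. scale_on UNIV D \<gamma> (\<lambda>i. Z i \<omega>) i)"
  shows "distributed M lborel X k"
  unfolding distributed_def
proof (intro conjI)
  have Z [measurable]: "random_variable borel (Z i)" for i using ind by (auto simp: indep_vars_def)
  have scm [measurable]: "scale_on UNIV D \<gamma> \<in> measurable lborel_fun lborel_fun"
    by (rule scale_on_measurable[OF \<gamma>])
  have p: "prob_space (density lborel (f i))" for i
    unfolding law[symmetric] by (rule prob_space_distr) measurable
  have joint: "distr M (Pi\<^sub>M UNIV (\<lambda>_. borel)) (\<lambda>\<omega>. \<lambda>i\<in>UNIV. Z i \<omega>) =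
      density lborel_fun (\<lambda>g. \<Prod>i\<in>UNIV. f i (g i))"
    using indep_vars_iff_distr_eq_PiM[of UNIV Z "\<lambda>_. borel"] ind
    by (simp add: law PiM_density_lborel[OF f p])
  show "distr M lborel X = density lborel k"
  proof (rule measure_eqI)
    fix B assume "B \<in> sets (distr M lborel X)"
    then have B [measurable]: "B \<in> sets borel" by simp
    have [measurable]: "(\<lambda>g. indicator B (\<chi> i. scale_on UNIV D \<gamma> g i) :: ennreal) \<in> borel_measurable lborel_fun"
      by (rule measurable_compose[OF measurable_compose[OF scm measurable_vec_lambda_lborel]]) measurable
    have mB: "(\<lambda>g. indicator B (\<chi> i. scale_on UNIV D \<gamma> g i) :: ennreal) \<in> borel_measurable (Pi\<^sub>M UNIV (\<lambda>_. borel))"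
      by (subst measurable_cong_sets[OF sets_PiM_cong[OF refl] refl, of UNIV "\<lambda>_. borel" "\<lambda>_. lborel"]) (simp, measurable)
    have Zm: "(\<lambda>\<omega>. \<lambda>i\<in>UNIV. Z i \<omega>) \<in> measurable M (Pi\<^sub>M UNIV (\<lambda>_. borel))" by measurable
    have mf [measurable]: "(\<lambda>g. \<Prod>i\<in>UNIV. f i (g i)) \<in> borel_measurable lborel_fun" by measurable
    have "emeasure (distr M lborel X) B = (\<integral>\<^sup>+x. indicator B x \<partial>distr M lborel X)" by simp
    also have "\<dots> = (\<integral>\<^sup>+\<omega>. indicator B (X \<omega>) \<partial>M)" by (rule nn_integral_distr) measurable
    also have "\<dots> = (\<integral>\<^sup>+\<omega>. indicator B (\<chi> i. scale_on UNIV D \<gamma> (\<lambda>i\<in>UNIV. Z i \<omega>) i) \<partial>M)"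
      by (rule nn_integral_cong) (simp add: XZ restrict_UNIV)
    also have "\<dots> = (\<integral>\<^sup>+g. indicator B (\<chi> i. scale_on UNIV D \<gamma> g i)
        \<partial>distr M (Pi\<^sub>M UNIV (\<lambda>_. borel)) (\<lambda>\<omega>. \<lambda>i\<in>UNIV. Z i \<omega>))"
      by (rule nn_integral_distr[symmetric, OF Zm]) (simp add: mB)
    also have "\<dots> = (\<integral>\<^sup>+g. (\<Prod>i\<in>UNIV. f i (g i)) * indicator B (\<chi> i. scale_on UNIV D \<gamma> g i) \<partial>lborel_fun)"
      unfolding joint by (rule nn_integral_density) measurable
    also have "\<dots> = (\<integral>\<^sup>+g. (k (\<chi> i. scale_on UNIV D \<gamma> g i) * indicator B (\<chi> i. scale_on UNIV D \<gamma> g i)) *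
        ennreal (\<Prod>i\<in>UNIV. \<Prod>c\<in>{c. (i, c) \<in> D}. \<gamma> (g c)) \<partial>lborel_fun)"
      by (intro nn_integral_cong) (simp add: kernel[symmetric] mult_ac)
    also have "\<dots> = (\<integral>\<^sup>+g. k (\<chi> i. g i) * indicator B (\<chi> i. g i) \<partial>lborel_fun)"
      by (rule nn_integral_scale_on[OF D \<gamma> pos, where S = UNIV and F = "\<lambda>g. k (\<chi> i. g i) * indicator B (\<chi> i. g i)", symmetric])
        measurable
    also have "\<dots> = (\<integral>\<^sup>+x. k x * indicator B x \<partial>distr lborel_fun borel (\<lambda>g. \<chi> i. g i))"
      by (rule nn_integral_distr[symmetric]) measurable
    also have "\<dots> = emeasure (density lborel k) B"
      unfolding lborel_vec_eq[symmetric] by (rule emeasure_density[symmetric]) auto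
    finally show "emeasure (distr M lborel X) B = emeasure (density lborel k) B" .
  qed simp
qed measurable

section \<open>Propagation of the parameters through the graph\<close>

text \<open>
  \<open>L D j a b\<close> stands for the law of the \<open>j\<close>-th variable along \<open>D\<close> being beta with parameters \<open>a\<close>
  and \<open>b\<close>, and \<open>K D j\<close> for this variable being almost surely constant. The two kinds of Dirichlet
  laws differ only in \<open>s\<close> and \<open>t\<close>, which describe how the second parameter depends on the first
  parameters of the parents and of the vertex itself. Connectedness makes \<open>\<beta>\<close> common to all sources.
  For a vertex \<open>j\<close> with parents, reorienting above it makes the edge from a parent to \<open>j\<close> covered. The
  induction hypothesis applies to the upper end of this edge in each of its two directions, and
  \<open>edge\<close> passes this on to the lower end \<open>j\<close>.
\<close>

lemma beta_parameters_propagate: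
  fixes E :: "'v::finite rel" and L :: "'v rel \<Rightarrow> 'v \<Rightarrow> real \<Rightarrow> real \<Rightarrow> bool" and s t :: real
  assumes G: "simple_graph E" and ch: "chordal E" and cn: "connected_graph E" and two: "CARD('v) \<ge> 2"
    and Lcong: "\<And>D D2 j a b. moral_dag E D \<Longrightarrow> moral_dag E D2 \<Longrightarrow> desc D j = desc D2 j \<Longrightarrow> L D j a b \<Longrightarrow> L D2 j a b"
    and Kcong: "\<And>D D2 j. moral_dag E D \<Longrightarrow> moral_dag E D2 \<Longrightarrow> desc D j = desc D2 j \<Longrightarrow> K D j \<Longrightarrow> K D2 j"
    and unique: "\<And>D j a b a' b'. L D j a b \<Longrightarrow> L D j a' b' \<Longrightarrow> a = a' \<and> b = b'"
    and excl: "\<And>D j a b. L D j a b \<Longrightarrow> \<not> K D j"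
    and edge: "\<And>D i j. moral_dag E D \<Longrightarrow> parents D j = insert i (parents D i) \<Longrightarrow>
      (K D i \<and> K D j \<and> K (flip i j D) i \<and> K (flip i j D) j) \<or>
      (\<exists>a b g. L D i a (g + t * a) \<and> L D j b (g + s * a + t * b) \<and>
        L (flip i j D) i a (g + s * b + t * a) \<and> L (flip i j D) j b (g + t * b))"
  shows "(\<forall>D j. moral_dag E D \<longrightarrow> K D j) \<or>
    (\<exists>\<alpha> \<beta>. \<forall>D j. moral_dag E D \<longrightarrow> L D j (\<alpha> j) (\<beta> + s * (\<Sum>p\<in>parents D j. \<alpha> p) + t * \<alpha> j))"
proof -
  have symE: "\<And>a b. (a, b) \<in> E \<Longrightarrow> (b, a) \<in> E" and irr: "\<And>a. (a, a) \<notin> E"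
    using G by (auto simp: simple_graph_def sym_def irrefl_def)
  define source where "source D j \<longleftrightarrow> moral_dag E D \<and> parents D j = {}" for D j
  have Lsource: "L D2 j a b" if "source D j" "source D2 j" "L D j a b" for D D2 j a b
    using that Lcong[of D D2 j a b] desc_source[OF cn] unfolding source_def by metis
  have Ksource: "K D2 j" if "source D j" "source D2 j" "K D j" for D D2 j
    using that Kcong[of D D2 j] desc_source[OF cn] unfolding source_def by metis
  have edge_sources: "\<exists>D F. source D i \<and> source F j \<and>
      ((K D i \<and> K F j) \<or> (\<exists>a b g. L D i a (g + t * a) \<and> L F j b (g + t * b)))"
    if ij: "(i, j) \<in> E" for i j
  proof -
    have "{i, j} \<in> cliques UNIV E" using ij symE by (auto simp: cliques_def)
    then obtain D0 where D0: "moral_dag E D0" "parents D0 j = {i, j} - {j}"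
      using moral_dag_starting_with_clique[OF G ch, of "{i, j}" j] by blast
    have "i \<noteq> j" using ij irr by blast
    then have p0: "parents D0 j = {i}" using D0(2) by auto
    have iP: "i \<in> parents D0 j" using p0 by simp
    obtain D where D: "moral_dag E D" "parents D j = parents D0 j" "parents D i = parents D0 j - {i}"
      by (rule moral_dag_reorient_above[OF G ch D0(1) iP])
    have cov: "parents D j = insert i (parents D i)" using D p0 by auto
    have src: "parents D i = {}" using D p0 by auto
    have "(i, j) \<in> D" using cov by (auto simp: parents_def)
    then have "moral_dag E (flip i j D)" using moral_dag_flip_covered[OF G D(1) _ cov] by blast
    then have "source (flip i j D) j" using parents_flip[OF D(1) cov] src by (simp add: source_def)
    moreover have "source D i" using D(1) src by (simp add: source_def)
    moreover have "(K D i \<and> K (flip i j D) j) \<or> (\<exists>a b g. L D i a (g + t * a) \<and> L (flip i j D) j b (g + t * b))"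
      using edge[OF D(1) cov]
    proof
      assume "\<exists>a b g. L D i a (g + t * a) \<and> L D j b (g + s * a + t * b) \<and>
        L (flip i j D) i a (g + s * b + t * a) \<and> L (flip i j D) j b (g + t * b)"
      then show ?thesis by (elim exE conjE) (intro disjI2 exI conjI)
    qed simp
    ultimately show ?thesis by (intro exI conjI)
  qed
  have neighbour: "\<exists>j. (i, j) \<in> E" for i
  proof -
    have "card {i} < CARD('v)" using two by simp
    then obtain k where "k \<noteq> i" by (metis UNIV_eq_I less_irrefl singletonI)
    moreover have "(i, k) \<in> E\<^sup>*" using cn by (simp add: connected_graph_def)
    ultimately show ?thesis by (metis converse_rtranclE)
  qed
  have reorient: "\<exists>i D2. i \<in> parents D j \<and> moral_dag E D2 \<and> moral_dag E (flip i j D2) \<and> desc D2 j = desc D j \<and>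
      parents D2 j = insert i (parents D2 i) \<and> parents D2 i = parents D j - {i} \<and>
      parents (flip i j D2) j = parents D j - {i}"
    if D: "moral_dag E D" and ne: "parents D j \<noteq> {}" for D j
  proof -
    obtain i where i: "i \<in> parents D j" using ne by blast
    obtain D2 where D2: "moral_dag E D2" "desc D2 j = desc D j" "parents D2 j = parents D j"
      "parents D2 i = parents D j - {i}"
      using moral_dag_reorient_above[OF G ch D i] by blast
    have cov: "parents D2 j = insert i (parents D2 i)" using D2 i by auto
    have "(i, j) \<in> D2" using cov by (auto simp: parents_def)
    then show ?thesis
      using i D2 cov moral_dag_flip_covered[OF G D2(1) _ cov] parents_flip[OF D2(1) cov] by metis
  qed
  show ?thesis
  proof (cases "\<exists>D i a b. source D i \<and> L D i a b")
    case True
    then obtain D0 i0 a0 b0 where 0: "source D0 i0" "L D0 i0 a0 b0" by blast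
    \<comment> \<open>at a source the second parameter is \<open>\<beta> + t * a\<close>\<close>
    define \<beta> where "\<beta> = b0 - t * a0"
    have "\<exists>D a. source D v \<and> L D v a (\<beta> + t * a)" for v
    proof -
      have "(i0, v) \<in> E\<^sup>*" using cn by (simp add: connected_graph_def)
      then show ?thesis
      proof (induction rule: rtrancl_induct)
        case base
        then show ?case using 0 by (intro exI[of _ D0] exI[of _ a0]) (simp add: \<beta>_def)
      next
        case (step y z)
        then obtain D a where Da: "source D y" "L D y a (\<beta> + t * a)" by blast
        obtain D' F where DF: "source D' y" "source F z"
          and alt: "(K D' y \<and> K F z) \<or> (\<exists>a b g. L D' y a (g + t * a) \<and> L F z b (g + t * b))"
          using edge_sources[OF step.hyps(2)] by blast
        have Ly: "L D' y a (\<beta> + t * a)" by (rule Lsource[OF Da(1) DF(1) Da(2)])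
        then obtain a' b g where abg: "L D' y a' (g + t * a')" "L F z b (g + t * b)"
          using alt excl by blast
        have "a = a' \<and> \<beta> + t * a = g + t * a'" by (rule unique[OF Ly abg(1)])
        then have "g = \<beta>" by auto
        then show ?case using DF(2) abg(2) by blast
      qed
    qed
    then obtain \<alpha> where \<alpha>: "\<And>v. \<exists>D. source D v \<and> L D v (\<alpha> v) (\<beta> + t * \<alpha> v)" by metis
    have "L D j (\<alpha> j) (\<beta> + s * (\<Sum>p\<in>parents D j. \<alpha> p) + t * \<alpha> j)" if "moral_dag E D" for D j
      using that
    proof (induction "card (parents D j)" arbitrary: D j rule: less_induct)
      case less
      show ?case
      proof (cases "parents D j = {}")
        case True
        then have src: "source D j" using less.prems by (simp add: source_def)
        obtain D' where D': "source D' j" "L D' j (\<alpha> j) (\<beta> + t * \<alpha> j)" using \<alpha>[of j] by blast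
        show ?thesis using Lsource[OF D'(1) src D'(2)] True by simp
      next
        case False
        obtain i D2 where i: "i \<in> parents D j" and D2: "moral_dag E D2" "moral_dag E (flip i j D2)"
          "desc D2 j = desc D j" and cov: "parents D2 j = insert i (parents D2 i)"
          and p: "parents D2 i = parents D j - {i}" "parents (flip i j D2) j = parents D j - {i}"
          using reorient[OF less.prems False] by (elim exE conjE) (rule that)
        define S where "S = (\<Sum>p\<in>parents D j - {i}. \<alpha> p)"
        have "card (parents D j - {i}) < card (parents D j)" by (rule psubset_card_mono) (use i in auto)
        then have Li: "L D2 i (\<alpha> i) (\<beta> + s * S + t * \<alpha> i)"
          and Lj: "L (flip i j D2) j (\<alpha> j) (\<beta> + s * S + t * \<alpha> j)"
          using less.hyps[of D2 i] less.hyps[of "flip i j D2" j] D2 p by (simp_all add: S_def)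
        have "\<not> K D2 i" by (rule excl[OF Li])
        then obtain a b g where abg: "L D2 i a (g + t * a)" "L D2 j b (g + s * a + t * b)"
          "L (flip i j D2) i a (g + s * b + t * a)" "L (flip i j D2) j b (g + t * b)"
          using edge[OF D2(1) cov] by (elim disjE exE conjE) (simp, rule that)
        have "a = \<alpha> i" "g + t * a = \<beta> + s * S + t * \<alpha> i" "b = \<alpha> j"
          using unique[OF abg(1) Li] unique[OF abg(4) Lj] by auto
        then have "L D2 j (\<alpha> j) (\<beta> + s * S + s * \<alpha> i + t * \<alpha> j)" using abg(2) by simp
        moreover have "(\<Sum>p\<in>parents D j. \<alpha> p) = \<alpha> i + S" using i by (simp add: S_def sum.remove)
        ultimately have "L D2 j (\<alpha> j) (\<beta> + s * (\<Sum>p\<in>parents D j. \<alpha> p) + t * \<alpha> j)"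
          by (simp add: algebra_simps)
        then show ?thesis by (rule Lcong[OF D2(1) less.prems D2(3)])
      qed
    qed
    then show ?thesis by blast
  next
    case False
    then have Ks: "K D j" if "source D j" for D j
      using that neighbour[of j] edge_sources[of j] Ksource by metis
    have "K D j" if "moral_dag E D" for D j
      using that
    proof (induction "card (parents D j)" arbitrary: D j rule: less_induct)
      case less
      show ?case
      proof (cases "parents D j = {}")
        case True
        then show ?thesis using Ks less.prems by (simp add: source_def)
      next
        case False
        obtain i D2 where i: "i \<in> parents D j" and D2: "moral_dag E D2" "moral_dag E (flip i j D2)"
          "desc D2 j = desc D j" and cov: "parents D2 j = insert i (parents D2 i)"
          and p: "parents D2 i = parents D j - {i}" "parents (flip i j D2) j = parents D j - {i}"
          using reorient[OF less.prems False] by (elim exE conjE) (rule that)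
        have "card (parents D j - {i}) < card (parents D j)" by (rule psubset_card_mono) (use i in auto)
        then have "K D2 i" using less.hyps[of D2 i] D2 p by simp
        then have "K D2 j" using edge[OF D2(1) cov] excl by blast
        then show ?thesis by (rule Kcong[OF D2(1) less.prems D2(3)])
      qed
    qed
    then show ?thesis by blast
  qed
qed

section \<open>Densities\<close>

lemma continuous_on_Delta [continuous_intros]:
  "continuous_on S (\<lambda>x :: real^'v::finite. Delta E A x)"
  unfolding Delta_alt by (intro continuous_intros)

lemma pos_orthant_borel [measurable]: "(pos_orthant :: (real^'v::finite) set) \<in> sets borel"
proof -
  have "(pos_orthant :: (real^'v) set) = (\<Inter>i. {x. 0 < x $ i})" by (auto simp: pos_orthant_def)
  also have "open \<dots>" by (intro open_INT ballI open_Collect_less continuous_intros) simp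
  finally show ?thesis by (rule borel_open)
qed

lemma M_set_borel [measurable]: "(M_set E :: (real^'v::finite) set) \<in> sets borel"
proof -
  have "(M_set E :: (real^'v) set) = pos_orthant \<inter> (\<Inter>A. {x. 0 < Delta E A x})" by (auto simp: M_set_def)
  moreover have "open (\<Inter>A. {x :: real^'v. 0 < Delta E A x})"
    by (intro open_INT ballI open_Collect_less continuous_intros) simp
  ultimately show ?thesis by (metis pos_orthant_borel borel_open sets.Int)
qed

lemma dirichlet_kernel_measurable [measurable]:
  fixes E :: "'v::finite rel"
  shows "dirichlet_kernel E \<alpha> \<beta> \<in> borel_measurable borel"
proof -
  have [measurable]: "(\<lambda>x. Delta E UNIV x) \<in> borel_measurable borel" "(\<lambda>x :: real^'v. x $ i) \<in> borel_measurable borel" for i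
    by (intro borel_measurable_continuous_onI continuous_intros)+
  show ?thesis unfolding dirichlet_kernel_def[abs_def] by measurable
qed

lemma inv_dirichlet_kernel_measurable [measurable]:
  fixes E :: "'v::finite rel"
  shows "inv_dirichlet_kernel E \<alpha> \<beta> \<in> borel_measurable borel"
proof -
  have "continuous_on UNIV (\<lambda>x :: real^'v. Delta E UNIV (- x))"
    unfolding Delta_alt by (intro continuous_intros)
  then have [measurable]: "(\<lambda>x. delta E UNIV x) \<in> borel_measurable borel" "(\<lambda>x :: real^'v. x $ i) \<in> borel_measurable borel" for i
    unfolding delta_eq_Delta by (auto intro!: borel_measurable_continuous_onI continuous_intros)
  show ?thesis unfolding inv_dirichlet_kernel_def[abs_def] by measurable
qed

text \<open>
  The law of \<open>x / (1 - x)\<close> for a beta variable \<open>x\<close>, known as the beta prime law.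
\<close>

definition beta_prime_density :: "real \<Rightarrow> real \<Rightarrow> real \<Rightarrow> real" where
  "beta_prime_density a b y = indicator {0<..} y * (y powr (a - 1) * (1 + y) powr (- (a + b))) / Beta a b"

lemma beta_prime_density_measurable [measurable]: "beta_prime_density a b \<in> borel_measurable borel"
  unfolding beta_prime_density_def[abs_def] by measurable

lemma beta_prime_density_nonneg: "a > 0 \<Longrightarrow> b > 0 \<Longrightarrow> beta_prime_density a b y \<ge> 0"
  using Beta_real_pos[of a b] by (simp add: beta_prime_density_def)

lemma distr_beta_odds:
  assumes ab: "a > 0" "b > 0"
  shows "distr (beta_measure a b) borel (\<lambda>x. x / (1 - x)) = density lborel (\<lambda>y. ennreal (beta_prime_density a b y))"
proof (rule measure_eqI)
  fix B :: "real set" assume "B \<in> sets (distr (beta_measure a b) borel (\<lambda>x. x / (1 - x)))"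
  then have B [measurable]: "B \<in> sets borel" by simp
  define odds where "odds x = x / (1 - x)" for x :: real
  define odds' where "odds' x = 1 / (1 - x)\<^sup>2" for x :: real
  have [measurable]: "odds \<in> borel_measurable borel" unfolding odds_def[abs_def] by measurable
  define h where "h x = beta_density a b x * indicator B (odds x)" for x
  define k where "k y = beta_prime_density a b y * indicator B y" for y
  have [measurable]: "h \<in> borel_measurable borel" "k \<in> borel_measurable borel"
    unfolding h_def[abs_def] k_def[abs_def] by measurable
  have hnn: "h x \<ge> 0" and knn: "k x \<ge> 0" for x
    using beta_density_nonneg[OF ab] beta_prime_density_nonneg[OF ab] by (auto simp: h_def k_def)
  have "integrable lborel (beta_density a b)"
    using beta_measure_moment_aux[OF ab, of 0] by (simp add: has_bochner_integral_iff)
  then have hint: "integrable lborel h"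
    by (rule Bochner_Integration.integrable_bound)
      (auto simp: h_def abs_mult indicator_def beta_density_nonneg[OF ab])
  have hk: "h x = \<bar>odds' x\<bar> * k (odds x)" if x: "x \<in> {0<..<1}" for x
  proof -
    have o: "odds x > 0" "1 + odds x = 1 / (1 - x)" using x by (auto simp: odds_def field_simps)
    have "odds x powr (a - 1) = x powr (a - 1) * (1 - x) powr (- (a - 1))"
      unfolding odds_def using x by (subst powr_minus, subst powr_divide) (simp_all add: divide_inverse)
    moreover have "(1 + odds x) powr (- (a + b)) = (1 - x) powr (a + b)"
      unfolding o(2) using x by (subst powr_minus) (simp add: powr_divide)
    ultimately have "(odds x) powr (a - 1) * (1 + odds x) powr (- (a + b)) =
        x powr (a - 1) * ((1 - x) powr (- (a - 1)) * (1 - x) powr (a + b))" by (simp only: mult.assoc)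
    also have "(1 - x) powr (- (a - 1)) * (1 - x) powr (a + b) = (1 - x) powr (b - 1) * (1 - x) powr 2"
      by (simp add: powr_add[symmetric])
    also have "(1 - x) powr 2 = (1 - x)\<^sup>2" using x by simp
    finally have eq: "odds' x * ((odds x) powr (a - 1) * (1 + odds x) powr (- (a + b))) = x powr (a - 1) * (1 - x) powr (b - 1)"
      using x by (simp add: odds'_def)
    have "h x = (x powr (a - 1) * (1 - x) powr (b - 1)) * indicator B (odds x) / Beta a b"
      using x by (simp add: h_def beta_density_def)
    also have "\<dots> = odds' x * k (odds x)"
      unfolding eq[symmetric] using o(1) by (simp add: k_def beta_prime_density_def)
    also have "odds' x = \<bar>odds' x\<bar>" by (simp add: odds'_def)
    finally show ?thesis .
  qed
  have img: "odds ` {0<..<1} = {0<..}"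
  proof (intro set_eqI iffI)
    fix y :: real assume "y \<in> {0<..}"
    then have "y = odds (y / (1 + y))" "y / (1 + y) \<in> {0<..<1}" by (auto simp: odds_def field_simps)
    then show "y \<in> odds ` {0<..<1}" by blast
  qed (auto simp: odds_def)
  have inj: "inj_on odds {0<..<1}" by (auto simp: inj_on_def odds_def field_simps)
  have der: "(odds has_field_derivative odds' x) (at x within {0<..<1})" if "x \<in> {0<..<1}" for x
    unfolding odds_def[abs_def] odds'_def using that
    by (auto intro!: derivative_eq_intros simp: power2_eq_square field_simps)
  have hS: "(\<lambda>x. indicator {0<..<1} x *\<^sub>R h x) = h" and kS: "(\<lambda>x. indicator {0<..} x *\<^sub>R k x) = k"
    by (auto simp: fun_eq_iff h_def k_def beta_density_def beta_prime_density_def indicator_def)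
  have leb_iff: "f absolutely_integrable_on S \<longleftrightarrow> integrable lborel f"
    and leb_eq: "integrable lborel f \<Longrightarrow> integral S f = (\<integral>x. f x \<partial>lborel)"
    if [measurable]: "f \<in> borel_measurable borel" and fS: "(\<lambda>x. indicator S x *\<^sub>R f x) = f" for f :: "real \<Rightarrow> real" and S
  proof -
    show iff: "f absolutely_integrable_on S \<longleftrightarrow> integrable lborel f"
      unfolding set_integrable_def fS by (rule integrable_completion) simp
    assume "integrable lborel f"
    then have "integral S f = set_lebesgue_integral lebesgue S f"
      using iff by (intro set_lebesgue_integral_eq_integral(2)[symmetric]) simp
    also have "\<dots> = (\<integral>x. f x \<partial>lborel)"
      unfolding set_lebesgue_integral_def fS by (rule integral_completion) simp
    finally show "integral S f = (\<integral>x. f x \<partial>lborel)" .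
  qed
  have "h absolutely_integrable_on {0<..<1} \<and> integral {0<..<1} h = (\<integral>x. h x \<partial>lborel)"
    using leb_iff[OF _ hS] leb_eq[OF _ hS] hint by simp
  moreover have "h absolutely_integrable_on {0<..<1} \<longleftrightarrow>
      (\<lambda>x. \<bar>odds' x\<bar> * k (odds x)) absolutely_integrable_on {0<..<1}"
    by (rule set_integrable_cong) (simp_all add: hk)
  moreover have "integral {0<..<1} h = integral {0<..<1} (\<lambda>x. \<bar>odds' x\<bar> * k (odds x))"
    by (rule Henstock_Kurzweil_Integration.integral_cong) (rule hk)
  ultimately have "k absolutely_integrable_on odds ` {0<..<1} \<and> integral (odds ` {0<..<1}) k = (\<integral>x. h x \<partial>lborel)"
    using has_absolute_integral_change_of_variables_1'[OF _ der inj, of k "\<integral>x. h x \<partial>lborel"] by simp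
  then have kint: "integrable lborel k" and keq: "(\<integral>x. k x \<partial>lborel) = (\<integral>x. h x \<partial>lborel)"
    unfolding img using leb_iff[OF _ kS] leb_eq[OF _ kS] by auto
  have "emeasure (distr (beta_measure a b) borel odds) B = (\<integral>\<^sup>+x. indicator B x \<partial>distr (beta_measure a b) borel odds)"
    by simp
  also have "\<dots> = (\<integral>\<^sup>+x. indicator B (odds x) \<partial>beta_measure a b)"
    by (rule nn_integral_distr) measurable
  also have "\<dots> = (\<integral>\<^sup>+x. ennreal (beta_density a b x) * indicator B (odds x) \<partial>lborel)"
    unfolding beta_measure_def by (rule nn_integral_density) measurable
  also have "\<dots> = (\<integral>\<^sup>+x. ennreal (h x) \<partial>lborel)"
    by (rule nn_integral_cong) (auto simp: h_def indicator_def)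
  also have "\<dots> = ennreal (\<integral>x. k x \<partial>lborel)"
    unfolding keq by (rule nn_integral_eq_integral[OF hint]) (simp add: hnn)
  also have "\<dots> = (\<integral>\<^sup>+x. ennreal (k x) \<partial>lborel)"
    by (rule nn_integral_eq_integral[OF kint, symmetric]) (simp add: knn)
  also have "\<dots> = (\<integral>\<^sup>+x. ennreal (beta_prime_density a b x) * indicator B x \<partial>lborel)"
    by (rule nn_integral_cong) (auto simp: k_def indicator_def)
  also have "\<dots> = emeasure (density lborel (\<lambda>y. ennreal (beta_prime_density a b y))) B"
    by (rule emeasure_density[symmetric]) auto
  finally show "emeasure (distr (beta_measure a b) borel (\<lambda>x. x / (1 - x))) B =
      emeasure (density lborel (\<lambda>y. ennreal (beta_prime_density a b y))) B"
    unfolding odds_def[abs_def] .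
qed simp

text \<open>
  Here \<open>h i\<close> is \<open>1 - g i\<close> or \<open>1 + g i\<close>, so that the left-hand side is a Dirichlet kernel at the image
  of \<open>g\<close> times the Jacobian, and the right-hand side a product of one-dimensional kernels. The Jacobian
  contains one factor \<open>h c\<close> for each parent \<open>p\<close> of \<open>c\<close>, which raises the exponent \<open>\<alpha> p - 1\<close> that
  coordinate \<open>p\<close> contributes to \<open>h c\<close> to \<open>\<alpha> p\<close>.
\<close>

lemma kernel_along_orientation:
  fixes D :: "'v::finite rel" and g h \<alpha> :: "'v \<Rightarrow> real"
  assumes h: "\<And>i. h i > 0" and g: "\<And>i. g i > 0"
  shows "(\<Prod>j\<in>UNIV. h j) powr e * (\<Prod>i\<in>UNIV. (g i * (\<Prod>c\<in>{c. (i, c) \<in> D}. h c)) powr (\<alpha> i - 1)) *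
      (\<Prod>i\<in>UNIV. \<Prod>c\<in>{c. (i, c) \<in> D}. h c) =
    (\<Prod>i\<in>UNIV. g i powr (\<alpha> i - 1) * h i powr (e + (\<Sum>p\<in>parents D i. \<alpha> p)))"
proof -
  have "(g i * (\<Prod>c\<in>{c. (i, c) \<in> D}. h c)) powr (\<alpha> i - 1) * (\<Prod>c\<in>{c. (i, c) \<in> D}. h c) =
      g i powr (\<alpha> i - 1) * (\<Prod>c\<in>{c. (i, c) \<in> D}. h c powr \<alpha> i)" for i
  proof -
    let ?P = "\<Prod>c\<in>{c. (i, c) \<in> D}. h c"
    have P: "?P > 0" using h by (intro prod_pos) auto
    have "(g i * ?P) powr (\<alpha> i - 1) * ?P = g i powr (\<alpha> i - 1) * (?P powr (\<alpha> i - 1) * ?P powr 1)"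
      using P g[of i] by (simp add: powr_mult)
    also have "?P powr (\<alpha> i - 1) * ?P powr 1 = ?P powr \<alpha> i" by (simp only: powr_add[symmetric]) simp
    also have "\<dots> = (\<Prod>c\<in>{c. (i, c) \<in> D}. h c powr \<alpha> i)"
      by (rule prod_powr_distrib)
    finally show ?thesis .
  qed
  then have "(\<Prod>i\<in>UNIV. (g i * (\<Prod>c\<in>{c. (i, c) \<in> D}. h c)) powr (\<alpha> i - 1)) * (\<Prod>i\<in>UNIV. \<Prod>c\<in>{c. (i, c) \<in> D}. h c) =
      (\<Prod>i\<in>UNIV. g i powr (\<alpha> i - 1)) * (\<Prod>i\<in>UNIV. \<Prod>c\<in>{c. (i, c) \<in> D}. h c powr \<alpha> i)"
    by (simp add: prod.distrib[symmetric])
  also have "(\<Prod>i\<in>UNIV. \<Prod>c\<in>{c. (i, c) \<in> D}. h c powr \<alpha> i) = (\<Prod>c\<in>UNIV. \<Prod>p\<in>parents D c. h c powr \<alpha> p)"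
    using prod.swap_restrict[of UNIV UNIV "\<lambda>i c. h c powr \<alpha> i" "\<lambda>i c. (i, c) \<in> D"] by (simp add: parents_def)
  also have "\<dots> = (\<Prod>c\<in>UNIV. h c powr (\<Sum>p\<in>parents D c. \<alpha> p))"
    using h by (intro prod.cong refl powr_sum[symmetric]) (auto simp: less_imp_neq[symmetric])
  finally have *: "(\<Prod>i\<in>UNIV. (g i * (\<Prod>c\<in>{c. (i, c) \<in> D}. h c)) powr (\<alpha> i - 1)) * (\<Prod>i\<in>UNIV. \<Prod>c\<in>{c. (i, c) \<in> D}. h c) =
      (\<Prod>i\<in>UNIV. g i powr (\<alpha> i - 1)) * (\<Prod>c\<in>UNIV. h c powr (\<Sum>p\<in>parents D c. \<alpha> p))" .
  have "(\<Prod>j\<in>UNIV. h j) powr e = (\<Prod>j\<in>UNIV. h j powr e)"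
    by (rule prod_powr_distrib)
  then show ?thesis
    unfolding mult.assoc * by (simp add: prod.distrib powr_add mult_ac)
qed

section \<open>The two characterizations\<close>

lemma Delta_pos_of_M_set: "x \<in> M_set E \<Longrightarrow> Delta E A x > 0"
  by (simp add: M_set_def)

lemma delta_pos_of_pos_orthant:
  fixes y :: "real^'v::finite"
  assumes "y \<in> pos_orthant"
  shows "delta E A y > 0"
proof -
  have "{} \<in> independent_sets E A" by (simp add: independent_sets_def)
  then show ?thesis
    using assms unfolding delta_def cliques_complement_induced pos_orthant_def
    by (intro sum_pos prod_pos) auto
qed

lemma scale_on_eq_phi:
  fixes g :: "'v::finite \<Rightarrow> real"
  assumes "\<And>c. \<gamma> (g c) = 1 - e * g c"
  shows "e *\<^sub>R (\<chi> i. scale_on UNIV D \<gamma> g i) = phi D (\<chi> i. e * g i)"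
  using assms by (simp add: vec_eq_iff scale_on_def phi_nth)

context prob_space
begin

definition beta_law :: "real \<Rightarrow> real \<Rightarrow> ('a \<Rightarrow> real) \<Rightarrow> bool" where
  "beta_law a b X \<longleftrightarrow> a > 0 \<and> b > 0 \<and> distr M borel X = beta_measure a b"

definition AE_constant :: "('a \<Rightarrow> real) \<Rightarrow> bool" where
  "AE_constant X \<longleftrightarrow> (\<exists>c. AE \<omega> in M. X \<omega> = c)"

lemma beta_law_unique: "beta_law a b X \<Longrightarrow> beta_law a' b' X \<Longrightarrow> a = a' \<and> b = b'"
  unfolding beta_law_def using beta_measure_params_unique by metis

lemma beta_law_not_constant:
  assumes X: "unit_valued X" and law: "beta_law a b X"
  shows "\<not> AE_constant X"
proof
  have [measurable]: "random_variable borel X" using X by measurable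
  assume "AE_constant X"
  then obtain c where c: "AE \<omega> in M. X \<omega> = c" by (auto simp: AE_constant_def)
  then have "AE x in distr M borel X. x = c" by (subst AE_distr_iff) auto
  moreover have "distr M borel X = beta_measure a b" using law by (simp add: beta_law_def)
  ultimately have "AE x in beta_measure a b. x = c" by metis
  moreover have "AE x in lborel. x \<noteq> c" by (rule AE_lborel_singleton)
  then have "AE x in beta_measure a b. x \<noteq> c"
    unfolding beta_measure_def by (subst AE_density) (auto elim: eventually_mono)
  ultimately have F: "AE x in beta_measure a b. False" by eventually_elim simp
  interpret B: prob_space "beta_measure a b"
    using law by (intro prob_space_beta_measure) (auto simp: beta_law_def)
  show False using F by simp
qed

text \<open>
  The families \<open>X\<close> and \<open>X'\<close> belong to an orientation with a covered edge and its flip.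
\<close>

lemma beta_edge:
  fixes X X' :: "'i \<Rightarrow> 'a \<Rightarrow> real"
  assumes ij: "i \<noteq> j"
    and unit: "\<And>k. unit_valued (X k)" "\<And>k. unit_valued (X' k)"
    and ind: "indep_vars (\<lambda>_. borel) X UNIV" "indep_vars (\<lambda>_. borel) X' UNIV"
    and rel: "\<And>\<omega>. \<omega> \<in> space M \<Longrightarrow> X' i \<omega> = X i \<omega> * (1 - X j \<omega>)"
      "\<And>\<omega>. \<omega> \<in> space M \<Longrightarrow> X' j \<omega> * (1 - X' i \<omega>) = X j \<omega>"
  shows "(AE_constant (X i) \<and> AE_constant (X j) \<and> AE_constant (X' i) \<and> AE_constant (X' j)) \<or>
    (\<exists>a b g. beta_law a g (X i) \<and> beta_law b (g + a) (X j) \<and>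
      beta_law a (g + b) (X' i) \<and> beta_law b g (X' j))"
proof -
  have ind': "indep_vars (\<lambda>_. borel) X {i, j}" "indep_vars (\<lambda>_. borel) X' {i, j}"
    using ind by (auto intro: indep_vars_subset)
  have "(\<forall>Z\<in>{X i, X j, X' i, X' j}. \<exists>c. AE \<omega> in M. Z \<omega> = c) \<or>
    (\<exists>a b g. a > 0 \<and> b > 0 \<and> g > 0 \<and>
      distr M borel (X i) = beta_measure a g \<and> distr M borel (X j) = beta_measure b (g + a) \<and>
      distr M borel (X' i) = beta_measure a (g + b) \<and> distr M borel (X' j) = beta_measure b g)"
    by (rule beta_characterization_on_edge[OF ij unit(1) unit(1) unit(2) unit(2) ind']) (rule rel, assumption)+
  then show ?thesis
  proof (elim disjE exE)
    fix a b g
    assume "a > 0 \<and> b > 0 \<and> g > 0 \<and>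
      distr M borel (X i) = beta_measure a g \<and> distr M borel (X j) = beta_measure b (g + a) \<and>
      distr M borel (X' i) = beta_measure a (g + b) \<and> distr M borel (X' j) = beta_measure b g"
    then have "beta_law a g (X i) \<and> beta_law b (g + a) (X j) \<and> beta_law a (g + b) (X' i) \<and> beta_law b g (X' j)"
      by (simp add: beta_law_def add_pos_pos)
    then show ?thesis by blast
  qed (simp add: AE_constant_def)
qed

lemma not_nondegenerate_if_AE_constant:
  fixes X :: "'a \<Rightarrow> real^'v::finite" and v :: "'a \<Rightarrow> 'v \<Rightarrow> real"
  assumes "\<And>i. AE_constant (\<lambda>\<omega>. v \<omega> i)" and "\<And>\<omega>. \<omega> \<in> space M \<Longrightarrow> X \<omega> = F (\<lambda>i. v \<omega> i)"
  shows "\<not> nondegenerate M X"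
proof -
  obtain c where "\<And>i. AE \<omega> in M. v \<omega> i = c i" using assms(1) unfolding AE_constant_def by metis
  then have "AE \<omega> in M. \<forall>i\<in>UNIV. v \<omega> i = c i" by (intro AE_finite_allI) auto
  then have "AE \<omega> in M. X \<omega> = F c"
    using AE_space
  proof eventually_elim
    case (elim \<omega>)
    then have "v \<omega> = c" by auto
    then show ?case using assms(2)[of \<omega>] elim by simp
  qed
  then show ?thesis by (auto simp: nondegenerate_def)
qed

text \<open>
  Along \<open>D\<close> the \<open>j\<close>-th variable is beta with second parameter \<open>\<beta>\<close> plus the sum of \<open>\<alpha>\<close> over the
  parents of \<open>j\<close>. This is exactly the product law that the Dirichlet kernel induces in the coordinates
  \<open>u\<close> along \<open>D\<close>.
\<close>

lemma Dirichlet_characterization: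
  fixes E :: "'v::finite rel" and X :: "'a \<Rightarrow> real^'v"
  assumes G: "simple_graph E" and ch: "chordal E" and cn: "connected_graph E" and two: "CARD('v) \<ge> 2"
    and X: "X \<in> borel_measurable M" and XM: "\<And>\<omega>. \<omega> \<in> space M \<Longrightarrow> X \<omega> \<in> M_set E"
    and nd: "nondegenerate M X"
    and ind: "\<And>D. moral_dag E D \<Longrightarrow> indep_vars (\<lambda>_. borel) (\<lambda>i \<omega>. u E D i (X \<omega>)) UNIV"
  shows "\<exists>\<alpha> \<beta>. \<alpha> \<in> pos_orthant \<and> \<beta> > 0 \<and> has_Dir M X E \<alpha> \<beta>"
proof -
  define U where "U D i \<omega> = u E D i (X \<omega>)" for D i \<omega>
  have Xpos: "X \<omega> $ i > 0" and DeltaX: "Delta E A (X \<omega>) > 0" if "\<omega> \<in> space M" for \<omega> i A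
    using XM[OF that] by (auto simp: M_set_def pos_orthant_def)
  have indU: "indep_vars (\<lambda>_. borel) (U D) UNIV" if "moral_dag E D" for D
    using ind[OF that] unfolding U_def[abs_def] .
  have unit: "unit_valued (U D i)" if D: "moral_dag E D" for D i
    unfolding unit_valued_def
    using indU[OF D] phi_u(1)[OF G D DeltaX] u_sign(1)[OF G D DeltaX Xpos]
    by (auto simp: indep_vars_def U_def)
  have phiU: "X \<omega> = phi D (\<chi> i. U D i \<omega>)" if "moral_dag E D" "\<omega> \<in> space M" for D \<omega>
    using phi_u(2)[OF G that(1) DeltaX[OF that(2)]] by (simp add: U_def)
  let ?L = "\<lambda>D j a b. moral_dag E D \<and> beta_law a b (U D j)"
  let ?K = "\<lambda>D j. AE_constant (U D j)"
  have "(\<forall>D j. moral_dag E D \<longrightarrow> ?K D j) \<or>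
    (\<exists>\<alpha> \<beta>. \<forall>D j. moral_dag E D \<longrightarrow> ?L D j (\<alpha> j) (\<beta> + 1 * (\<Sum>p\<in>parents D j. \<alpha> p) + 0 * \<alpha> j))"
  proof (rule beta_parameters_propagate[OF G ch cn two])
    fix D D2 :: "'v rel" and j assume d: "desc D j = desc D2 j"
    have "U D j = U D2 j" using d by (simp add: U_def u_def desc_refl_def fun_eq_iff)
    then show "?K D j \<Longrightarrow> ?K D2 j"
      and "moral_dag E D2 \<Longrightarrow> ?L D j a b \<Longrightarrow> ?L D2 j a b" for a b by simp_all
  next
    fix D :: "'v rel" and i j assume D: "moral_dag E D" and cov: "parents D j = insert i (parents D i)"
    have ij: "(i, j) \<in> D" using cov by (auto simp: parents_def)
    then have neq: "i \<noteq> j" using moral_dag_asym[OF D] by blast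
    have F: "moral_dag E (flip i j D)" by (rule moral_dag_flip_covered[OF G D ij cov])
    have rel: "U (flip i j D) i \<omega> = U D i \<omega> * (1 - U D j \<omega>)"
      "U (flip i j D) j \<omega> * (1 - U (flip i j D) i \<omega>) = U D j \<omega>" if "\<omega> \<in> space M" for \<omega>
      using u_flip[OF G D cov DeltaX[OF that]] Xpos[OF that] by (simp_all add: U_def)
    have "(?K D i \<and> ?K D j \<and> ?K (flip i j D) i \<and> ?K (flip i j D) j) \<or>
      (\<exists>a b g. beta_law a g (U D i) \<and> beta_law b (g + a) (U D j) \<and>
        beta_law a (g + b) (U (flip i j D) i) \<and> beta_law b g (U (flip i j D) j))"
      by (rule beta_edge[OF neq unit[OF D] unit[OF F] indU[OF D] indU[OF F]]) (rule rel, assumption)+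
    then show "(?K D i \<and> ?K D j \<and> ?K (flip i j D) i \<and> ?K (flip i j D) j) \<or>
      (\<exists>a b g. ?L D i a (g + 0 * a) \<and> ?L D j b (g + 1 * a + 0 * b) \<and>
        ?L (flip i j D) i a (g + 1 * b + 0 * a) \<and> ?L (flip i j D) j b (g + 0 * b))"
      using D F by simp
  qed (use beta_law_unique beta_law_not_constant unit in blast)+
  then show ?thesis
  proof
    assume K: "\<forall>D j. moral_dag E D \<longrightarrow> ?K D j"
    obtain v :: 'v where True by simp
    obtain D where D: "moral_dag E D"
      using moral_dag_starting_with_clique[OF G ch, of "{v}" v] by (auto simp: cliques_def)
    have "\<not> nondegenerate M X"
      by (rule not_nondegenerate_if_AE_constant[of "\<lambda>\<omega> i. U D i \<omega>" X "\<lambda>v. phi D (\<chi> i. v i)"]) (use K D phiU in auto)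
    then show ?thesis using nd by simp
  next
    assume "\<exists>\<alpha> \<beta>. \<forall>D j. moral_dag E D \<longrightarrow> ?L D j (\<alpha> j) (\<beta> + 1 * (\<Sum>p\<in>parents D j. \<alpha> p) + 0 * \<alpha> j)"
    then obtain \<alpha> \<beta> where law: "\<And>D j. moral_dag E D \<Longrightarrow> beta_law (\<alpha> j) (\<beta> + (\<Sum>p\<in>parents D j. \<alpha> p)) (U D j)"
      by auto
    obtain v :: 'v where True by simp
    obtain D where D: "moral_dag E D" and src: "parents D v = {}"
      using moral_dag_starting_with_clique[OF G ch, of "{v}" v] by (auto simp: cliques_def)
    have apos: "\<alpha> j > 0" for j using law[OF D, of j] by (simp add: beta_law_def)
    have bpos: "\<beta> > 0" using law[OF D, of v] src by (simp add: beta_law_def)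
    define b where "b j = \<beta> + (\<Sum>p\<in>parents D j. \<alpha> p)" for j
    have bp: "b j > 0" for j using law[OF D, of j] by (simp add: beta_law_def b_def)
    define C where "C = (\<Prod>j\<in>UNIV. Beta (\<alpha> j) (b j))"
    have C: "C > 0" unfolding C_def by (intro prod_pos Beta_real_pos ballI) (auto simp: apos bp)
    \<comment> \<open>only \<open>t < 1\<close> matters; beyond, any positive value serves\<close>
    define \<gamma> where "\<gamma> t = (if t < 1 then 1 - t else 1)" for t :: real
    have \<gamma>pos: "\<gamma> t > 0" for t by (simp add: \<gamma>_def)
    have \<gamma>m [measurable]: "\<gamma> \<in> borel_measurable borel" unfolding \<gamma>_def[abs_def] by measurable
    let ?\<alpha> = "\<chi> i. \<alpha> i"
    let ?k = "\<lambda>x. ennreal (1 / C * dirichlet_kernel E ?\<alpha> \<beta> x)"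
    have inM: "0 < g i \<and> g i < 1" if M: "(\<chi> i. scale_on UNIV D \<gamma> g i) \<in> M_set E" for g i
    proof -
      let ?x = "\<chi> i. scale_on UNIV D \<gamma> g i"
      define v where "v = (\<chi> i. u E D i ?x)"
      have v1: "v $ i < 1" for i using phi_u(1)[OF G D Delta_pos_of_M_set[OF M]] by (simp add: v_def)
      have xi: "?x $ i = v $ i * (\<Prod>c\<in>{c. (i, c) \<in> D}. 1 - v $ c)" for i
        using phi_u(2)[OF G D Delta_pos_of_M_set[OF M]] phi_nth[of D v i] by (simp add: v_def)
      have gv: "g i = v $ i" for i
        using D
      proof (induction rule: desc_induct)
        case (less i)
        have P: "(\<Prod>c\<in>{c. (i, c) \<in> D}. \<gamma> (g c)) = (\<Prod>c\<in>{c. (i, c) \<in> D}. 1 - v $ c)"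
        proof (rule prod.cong[OF refl])
          fix c assume "c \<in> {c. (i, c) \<in> D}"
          then have "g c = v $ c" by (intro less) (auto simp: desc_def)
          then show "\<gamma> (g c) = 1 - v $ c" using v1[of c] by (simp add: \<gamma>_def)
        qed
        have "g i * (\<Prod>c\<in>{c. (i, c) \<in> D}. 1 - v $ c) = v $ i * (\<Prod>c\<in>{c. (i, c) \<in> D}. 1 - v $ c)"
          using xi[of i] by (simp only: scale_on_def vec_lambda_beta UNIV_I if_True P)
        then show ?case using phi_children_pos[of v i D, OF v1] by (metis less_irrefl mult_right_cancel)
      qed
      have "?x $ i > 0" using M by (auto simp: M_set_def pos_orthant_def)
      then have "v $ i > 0" using xi[of i] phi_children_pos[of v i D, OF v1] by (simp add: zero_less_mult_iff)
      then show ?thesis using gv v1 by simp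
    qed
    have "distributed M lborel X ?k"
    proof (rule distributed_scale_on[OF D \<gamma>m \<gamma>pos indU[OF D], where f = "\<lambda>i t. ennreal (beta_density (\<alpha> i) (b i) t)"])
      show "distr M borel (U D i) = density lborel (\<lambda>t. ennreal (beta_density (\<alpha> i) (b i) t))" for i
        using law[OF D, of i] by (simp add: beta_law_def beta_measure_def b_def)
      show "?k \<in> borel_measurable borel" by measurable
      show "X \<omega> = (\<chi> i. scale_on UNIV D \<gamma> (\<lambda>i. U D i \<omega>) i)" if "\<omega> \<in> space M" for \<omega>
        using phiU[OF D that] scale_on_eq_phi[of \<gamma> "\<lambda>i. U D i \<omega>" 1 D] unit[OF D] that
        by (simp add: \<gamma>_def unit_valued_def)
      fix g :: "'v \<Rightarrow> real"
      let ?x = "\<chi> i. scale_on UNIV D \<gamma> g i"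
      let ?J = "\<Prod>i\<in>UNIV. \<Prod>c\<in>{c. (i, c) \<in> D}. \<gamma> (g c)"
      show "?k ?x * ennreal ?J = (\<Prod>i\<in>UNIV. ennreal (beta_density (\<alpha> i) (b i) (g i)))"
      proof (cases "\<forall>i. 0 < g i \<and> g i < 1")
        case True
        then have g: "\<And>i. 0 < g i" "\<And>i. g i < 1" by auto
        have \<gamma>g: "\<gamma> (g c) = 1 - g c" for c using g by (simp add: \<gamma>_def)
        have xphi: "?x = phi D (\<chi> i. g i)" using scale_on_eq_phi[of \<gamma> g 1 D] \<gamma>g by simp
        have "?x \<in> M_set E" unfolding xphi by (rule phi_in_M_set[OF G D]) (simp_all add: g)
        moreover have "Delta E UNIV ?x = (\<Prod>j\<in>UNIV. 1 - g j)"
          unfolding xphi by (subst Delta_phi[OF G D]) (auto simp: desc_closed_def)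
        moreover have "?x $ i = g i * (\<Prod>c\<in>{c. (i, c) \<in> D}. 1 - g c)" for i unfolding xphi phi_nth by simp
        ultimately have "dirichlet_kernel E ?\<alpha> \<beta> ?x * ?J =
            (\<Prod>i\<in>UNIV. g i powr (\<alpha> i - 1) * (1 - g i) powr (\<beta> - 1 + (\<Sum>p\<in>parents D i. \<alpha> p)))"
          using kernel_along_orientation[of "\<lambda>i. 1 - g i" g "\<beta> - 1" D \<alpha>] g
          by (simp add: dirichlet_kernel_def \<gamma>g)
        moreover have "(\<Prod>i\<in>UNIV. beta_density (\<alpha> i) (b i) (g i)) =
            1 / C * (\<Prod>i\<in>UNIV. g i powr (\<alpha> i - 1) * (1 - g i) powr (\<beta> - 1 + (\<Sum>p\<in>parents D i. \<alpha> p)))"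
        proof -
          have ex: "b i - 1 = \<beta> - 1 + (\<Sum>p\<in>parents D i. \<alpha> p)" for i by (simp add: b_def)
          show ?thesis using g by (simp add: beta_density_def prod_dividef C_def ex)
        qed
        ultimately have "1 / C * dirichlet_kernel E ?\<alpha> \<beta> ?x * ?J = (\<Prod>i\<in>UNIV. beta_density (\<alpha> i) (b i) (g i))"
          by (simp add: mult.assoc)
        moreover have "?J \<ge> 0" using \<gamma>pos by (intro prod_nonneg) (auto intro: less_imp_le)
        ultimately show ?thesis
          using beta_density_nonneg[OF apos bp] by (simp add: ennreal_mult''[symmetric] prod_ennreal)
      next
        case False
        then have "?x \<notin> M_set E" using inM by blast
        then have "?k ?x = 0" by (simp add: dirichlet_kernel_def)
        moreover obtain i where "\<not> (0 < g i \<and> g i < 1)" using False by blast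
        then have "beta_density (\<alpha> i) (b i) (g i) = 0" by (auto simp: beta_density_def)
        then have "(\<Prod>i\<in>UNIV. ennreal (beta_density (\<alpha> i) (b i) (g i))) = 0"
          by (intro prod_zero bexI[of _ i]) auto
        ultimately show ?thesis by simp
      qed
    qed (use X in measurable)
    then have "has_Dir M X E ?\<alpha> \<beta>" unfolding has_Dir_def using C by (intro exI[of _ "1 / C"]) simp
    moreover have "?\<alpha> \<in> pos_orthant" using apos by (simp add: pos_orthant_def)
    ultimately show ?thesis using bpos by blast
  qed
qed

text \<open>
  The variables \<open>U = W / (1 + W)\<close> lie in the unit interval and satisfy on a covered edge the relations
  of the first case with the two orientations exchanged. Therefore the second parameter now decreases
  by \<open>\<alpha>\<close> of each parent and of the vertex itself. At the last vertex of a maximal clique that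
  comes first in the orientation, its positivity is the bound on \<open>\<beta>\<close>.
\<close>

lemma inverted_Dirichlet_characterization:
  fixes E :: "'v::finite rel" and Y :: "'a \<Rightarrow> real^'v"
  assumes G: "simple_graph E" and ch: "chordal E" and cn: "connected_graph E" and two: "CARD('v) \<ge> 2"
    and Y: "Y \<in> borel_measurable M" and YP: "\<And>\<omega>. \<omega> \<in> space M \<Longrightarrow> Y \<omega> \<in> pos_orthant"
    and nd: "nondegenerate M Y"
    and ind: "\<And>D. moral_dag E D \<Longrightarrow> indep_vars (\<lambda>_. borel) (\<lambda>i \<omega>. w E D i (Y \<omega>)) UNIV"
  shows "\<exists>\<alpha> \<beta>. \<alpha> \<in> pos_orthant \<and> \<beta> > Max ((\<lambda>C. \<Sum>i\<in>C. \<alpha> $ i) ` maximal_cliques UNIV E) \<and> has_IDir M Y E \<alpha> \<beta>"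
proof -
  define W where "W D i \<omega> = w E D i (Y \<omega>)" for D i \<omega>
  define U where "U D i \<omega> = W D i \<omega> / (1 + W D i \<omega>)" for D i \<omega>
  have Ypos: "Y \<omega> $ i > 0" and DeltaY: "Delta E A (- Y \<omega>) > 0" if "\<omega> \<in> space M" for \<omega> i A
    using YP[OF that] delta_pos_of_pos_orthant[OF YP[OF that], of E A]
    by (auto simp: delta_eq_Delta pos_orthant_def)
  have Wu: "W D i \<omega> = - u E D i (- Y \<omega>)" for D i \<omega> by (simp add: W_def w_eq_u)
  have Wpos: "W D i \<omega> > 0" if "moral_dag E D" "\<omega> \<in> space M" for D i \<omega>
    unfolding Wu using u_sign(2)[OF G that(1) DeltaY[OF that(2)], of i] Ypos[OF that(2), of i] by simp
  have odds: "W D i \<omega> = U D i \<omega> / (1 - U D i \<omega>)" if "moral_dag E D" "\<omega> \<in> space M" for D i \<omega>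
    using Wpos[OF that, of i] by (simp add: U_def field_simps)
  have indW: "indep_vars (\<lambda>_. borel) (W D) UNIV" if "moral_dag E D" for D
    using ind[OF that] unfolding W_def[abs_def] .
  have indU: "indep_vars (\<lambda>_. borel) (U D) UNIV" if "moral_dag E D" for D
    unfolding U_def[abs_def] by (rule indep_vars_compose2[OF indW[OF that]]) measurable
  have unit: "unit_valued (U D i)" if D: "moral_dag E D" for D i
    unfolding unit_valued_def
  proof
    show "random_variable borel (U D i)" using indU[OF D] by (auto simp: indep_vars_def)
    show "\<forall>\<omega>\<in>space M. 0 < U D i \<omega> \<and> U D i \<omega> < 1" using Wpos[OF D] by (auto simp: U_def add_pos_pos)
  qed
  have phiW: "- Y \<omega> = phi D (\<chi> i. - W D i \<omega>)" if "moral_dag E D" "\<omega> \<in> space M" for D \<omega>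
    using phi_u(2)[OF G that(1) DeltaY[OF that(2)]] by (simp add: Wu)
  let ?L = "\<lambda>D j a b. moral_dag E D \<and> beta_law a b (U D j)"
  let ?K = "\<lambda>D j. AE_constant (U D j)"
  have "(\<forall>D j. moral_dag E D \<longrightarrow> ?K D j) \<or>
    (\<exists>\<alpha> \<beta>. \<forall>D j. moral_dag E D \<longrightarrow> ?L D j (\<alpha> j) (\<beta> + (-1) * (\<Sum>p\<in>parents D j. \<alpha> p) + (-1) * \<alpha> j))"
  proof (rule beta_parameters_propagate[OF G ch cn two])
    fix D D2 :: "'v rel" and j assume d: "desc D j = desc D2 j"
    have "U D j = U D2 j" using d by (simp add: U_def W_def w_def desc_refl_def fun_eq_iff)
    then show "?K D j \<Longrightarrow> ?K D2 j"
      and "moral_dag E D2 \<Longrightarrow> ?L D j a b \<Longrightarrow> ?L D2 j a b" for a b by simp_all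
  next
    fix D :: "'v rel" and i j assume D: "moral_dag E D" and cov: "parents D j = insert i (parents D i)"
    have ij: "(i, j) \<in> D" using cov by (auto simp: parents_def)
    then have neq: "i \<noteq> j" using moral_dag_asym[OF D] by blast
    have F: "moral_dag E (flip i j D)" by (rule moral_dag_flip_covered[OF G D ij cov])
    have rel: "U D i \<omega> = U (flip i j D) i \<omega> * (1 - U (flip i j D) j \<omega>)"
      "U D j \<omega> * (1 - U D i \<omega>) = U (flip i j D) j \<omega>" if \<omega>: "\<omega> \<in> space M" for \<omega>
    proof -
      have r: "W (flip i j D) i \<omega> = W D i \<omega> * (1 + W D j \<omega>)"
        "W (flip i j D) j \<omega> * (1 + W (flip i j D) i \<omega>) = W D j \<omega>"
        using u_flip[OF G D cov DeltaY[OF \<omega>]] Ypos[OF \<omega>] by (simp_all add: Wu)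
      have pos: "1 + W D i \<omega> > 0" "1 + W D j \<omega> > 0" "1 + W (flip i j D) i \<omega> > 0" "1 + W (flip i j D) j \<omega> > 0"
        using Wpos[OF D \<omega>] Wpos[OF F \<omega>] by (auto intro: add_pos_pos)
      have both: "(1 + W (flip i j D) i \<omega>) * (1 + W (flip i j D) j \<omega>) = (1 + W D i \<omega>) * (1 + W D j \<omega>)"
        using r by algebra
      have c: "1 - U D' k \<omega> = 1 / (1 + W D' k \<omega>)" if "1 + W D' k \<omega> > 0" for D' k
        using that by (simp add: U_def field_simps)
      have "U (flip i j D) i \<omega> * (1 - U (flip i j D) j \<omega>) =
          W (flip i j D) i \<omega> / ((1 + W (flip i j D) i \<omega>) * (1 + W (flip i j D) j \<omega>))"
        unfolding c[OF pos(4)] by (simp add: U_def)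
      also have "\<dots> = U D i \<omega>" unfolding both unfolding r(1) using pos by (simp add: U_def)
      finally show "U D i \<omega> = U (flip i j D) i \<omega> * (1 - U (flip i j D) j \<omega>)" ..
      have "U D j \<omega> * (1 - U D i \<omega>) = W D j \<omega> / ((1 + W D i \<omega>) * (1 + W D j \<omega>))"
        unfolding c[OF pos(1)] by (simp add: U_def)
      also have "\<dots> = U (flip i j D) j \<omega>"
        unfolding both[symmetric] unfolding r(2)[symmetric] using pos by (simp add: U_def)
      finally show "U D j \<omega> * (1 - U D i \<omega>) = U (flip i j D) j \<omega>" .
    qed
    have "(?K (flip i j D) i \<and> ?K (flip i j D) j \<and> ?K D i \<and> ?K D j) \<or>
      (\<exists>a b g. beta_law a g (U (flip i j D) i) \<and> beta_law b (g + a) (U (flip i j D) j) \<and>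
        beta_law a (g + b) (U D i) \<and> beta_law b g (U D j))"
      by (rule beta_edge[OF neq unit[OF F] unit[OF D] indU[OF F] indU[OF D]]) (rule rel, assumption)+
    then show "(?K D i \<and> ?K D j \<and> ?K (flip i j D) i \<and> ?K (flip i j D) j) \<or>
      (\<exists>a b g. ?L D i a (g + (-1) * a) \<and> ?L D j b (g + (-1) * a + (-1) * b) \<and>
        ?L (flip i j D) i a (g + (-1) * b + (-1) * a) \<and> ?L (flip i j D) j b (g + (-1) * b))"
    proof
      assume "\<exists>a b g. beta_law a g (U (flip i j D) i) \<and> beta_law b (g + a) (U (flip i j D) j) \<and>
        beta_law a (g + b) (U D i) \<and> beta_law b g (U D j)"
      then obtain a b g where "beta_law a g (U (flip i j D) i)" "beta_law b (g + a) (U (flip i j D) j)"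
        "beta_law a (g + b) (U D i)" "beta_law b g (U D j)" by blast
      then show ?thesis
        using D F by (intro disjI2 exI[of _ a] exI[of _ b] exI[of _ "g + a + b"]) (simp add: algebra_simps)
    qed simp
  qed (use beta_law_unique beta_law_not_constant unit in blast)+
  then show ?thesis
  proof
    assume K: "\<forall>D j. moral_dag E D \<longrightarrow> ?K D j"
    obtain v :: 'v where True by simp
    obtain D where D: "moral_dag E D"
      using moral_dag_starting_with_clique[OF G ch, of "{v}" v] by (auto simp: cliques_def)
    have "Y \<omega> = - phi D (\<chi> i. - (U D i \<omega> / (1 - U D i \<omega>)))" if "\<omega> \<in> space M" for \<omega>
      using phiW[OF D that] unfolding odds[OF D that] by (metis minus_minus)
    then have "\<not> nondegenerate M Y"
      by (intro not_nondegenerate_if_AE_constant[of "\<lambda>\<omega> i. U D i \<omega>" Y "\<lambda>v. - phi D (\<chi> i. - (v i / (1 - v i)))"])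
        (use K D in auto)
    then show ?thesis using nd by simp
  next
    assume "\<exists>\<alpha> \<beta>. \<forall>D j. moral_dag E D \<longrightarrow> ?L D j (\<alpha> j) (\<beta> + (-1) * (\<Sum>p\<in>parents D j. \<alpha> p) + (-1) * \<alpha> j)"
    then obtain \<alpha> \<beta> where law: "\<And>D j. moral_dag E D \<Longrightarrow> beta_law (\<alpha> j) (\<beta> - (\<Sum>p\<in>parents D j. \<alpha> p) - \<alpha> j) (U D j)"
      by (auto simp: algebra_simps)
    obtain v :: 'v where True by simp
    obtain D where D: "moral_dag E D"
      using moral_dag_starting_with_clique[OF G ch, of "{v}" v] by (auto simp: cliques_def)
    have apos: "\<alpha> j > 0" for j using law[OF D, of j] by (simp add: beta_law_def)
    define b where "b j = \<beta> - (\<Sum>p\<in>parents D j. \<alpha> p) - \<alpha> j" for j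
    have bp: "b j > 0" for j using law[OF D, of j] by (simp add: beta_law_def b_def)
    let ?\<alpha> = "\<chi> i. \<alpha> i"
    \<comment> \<open>choose an orientation in which the parents of \<open>j\<close> are the rest of the clique\<close>
    have clique: "(\<Sum>i\<in>Q. ?\<alpha> $ i) < \<beta>" if Q: "Q \<in> maximal_cliques UNIV E" for Q
    proof -
      have "Q \<noteq> {}"
      proof
        assume "Q = {}"
        moreover have "{v} \<in> cliques UNIV E" by (simp add: cliques_def)
        ultimately show False using Q by (auto simp: maximal_cliques_def)
      qed
      then obtain j where j: "j \<in> Q" by blast
      have "Q \<in> cliques UNIV E" using Q by (simp add: maximal_cliques_def)
      then obtain D' where "moral_dag E D'" "parents D' j = Q - {j}"
        using moral_dag_starting_with_clique[OF G ch _ j] by blast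
      then have "0 < \<beta> - (\<Sum>p\<in>Q - {j}. \<alpha> p) - \<alpha> j" using law[of D' j] by (simp add: beta_law_def)
      then show ?thesis using j by (simp add: sum.remove)
    qed
    have mc: "maximal_cliques UNIV E \<noteq> {}"
    proof -
      have "cliques UNIV E \<noteq> {}" by (auto simp: cliques_def)
      then obtain Q where "Q \<in> cliques UNIV E" "\<And>Q'. Q' \<in> cliques UNIV E \<Longrightarrow> Q \<subseteq> Q' \<Longrightarrow> Q = Q'"
        using finite_has_maximal[of "cliques UNIV E"] by auto
      then have "Q \<in> maximal_cliques UNIV E" by (auto simp: maximal_cliques_def)
      then show ?thesis by blast
    qed
    have Max: "Max ((\<lambda>C. \<Sum>i\<in>C. ?\<alpha> $ i) ` maximal_cliques UNIV E) < \<beta>"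
      using mc clique by (subst Max_less_iff) auto
    define C where "C = (\<Prod>j\<in>UNIV. Beta (\<alpha> j) (b j))"
    have C: "C > 0" unfolding C_def by (intro prod_pos Beta_real_pos ballI) (auto simp: apos bp)
    \<comment> \<open>only \<open>t > 0\<close> matters; elsewhere, any positive value serves\<close>
    define \<gamma> where "\<gamma> t = (if t > 0 then 1 + t else 1)" for t :: real
    have \<gamma>pos: "\<gamma> t > 0" for t by (simp add: \<gamma>_def)
    have \<gamma>m [measurable]: "\<gamma> \<in> borel_measurable borel" unfolding \<gamma>_def[abs_def] by measurable
    let ?k = "\<lambda>x. ennreal (1 / C * inv_dirichlet_kernel E ?\<alpha> \<beta> x)"
    have "distributed M lborel Y ?k"
    proof (rule distributed_scale_on[OF D \<gamma>m \<gamma>pos indW[OF D], where f = "\<lambda>i t. ennreal (beta_prime_density (\<alpha> i) (b i) t)"])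
      show "distr M borel (W D i) = density lborel (\<lambda>t. ennreal (beta_prime_density (\<alpha> i) (b i) t))" for i
      proof -
        have [measurable]: "random_variable borel (U D i)" using unit[OF D] by measurable
        have "distr M borel (W D i) = distr M borel (\<lambda>\<omega>. U D i \<omega> / (1 - U D i \<omega>))"
          by (rule distr_cong) (simp_all add: odds[OF D])
        also have "\<dots> = distr (distr M borel (U D i)) borel (\<lambda>x. x / (1 - x))"
          by (subst distr_distr) (auto simp: o_def)
        also have "distr M borel (U D i) = beta_measure (\<alpha> i) (b i)"
          using law[OF D, of i] by (simp add: beta_law_def b_def)
        also have "distr (beta_measure (\<alpha> i) (b i)) borel (\<lambda>x. x / (1 - x)) =
            density lborel (\<lambda>t. ennreal (beta_prime_density (\<alpha> i) (b i) t))"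
          by (rule distr_beta_odds[OF apos bp])
        finally show ?thesis .
      qed
      show "?k \<in> borel_measurable borel" by measurable
      show "Y \<omega> = (\<chi> i. scale_on UNIV D \<gamma> (\<lambda>i. W D i \<omega>) i)" if "\<omega> \<in> space M" for \<omega>
      proof -
        have "- (\<chi> i. scale_on UNIV D \<gamma> (\<lambda>i. W D i \<omega>) i) = - Y \<omega>"
          using phiW[OF D that] scale_on_eq_phi[of \<gamma> "\<lambda>i. W D i \<omega>" "-1" D] Wpos[OF D that]
          by (simp add: \<gamma>_def)
        then show ?thesis by (metis minus_minus)
      qed
      fix g :: "'v \<Rightarrow> real"
      let ?x = "\<chi> i. scale_on UNIV D \<gamma> g i"
      let ?J = "\<Prod>i\<in>UNIV. \<Prod>c\<in>{c. (i, c) \<in> D}. \<gamma> (g c)"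
      have xpos: "?x \<in> pos_orthant \<longleftrightarrow> (\<forall>i. 0 < g i)"
      proof -
        have "(\<Prod>c\<in>{c. (i, c) \<in> D}. \<gamma> (g c)) > 0" for i using \<gamma>pos by (intro prod_pos) auto
        then show ?thesis by (simp add: pos_orthant_def scale_on_def zero_less_mult_iff) (meson less_asym)
      qed
      show "?k ?x * ennreal ?J = (\<Prod>i\<in>UNIV. ennreal (beta_prime_density (\<alpha> i) (b i) (g i)))"
      proof (cases "\<forall>i. 0 < g i")
        case True
        then have g: "\<And>i. 0 < g i" by auto
        have \<gamma>g: "\<gamma> (g c) = 1 + g c" for c using g by (simp add: \<gamma>_def)
        have xphi: "- ?x = phi D (\<chi> i. - g i)" using scale_on_eq_phi[of \<gamma> g "-1" D] \<gamma>g by simp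
        have "delta E UNIV ?x = (\<Prod>j\<in>UNIV. 1 + g j)"
          unfolding delta_eq_Delta xphi by (subst Delta_phi[OF G D]) (auto simp: desc_closed_def)
        moreover have "?x $ i = g i * (\<Prod>c\<in>{c. (i, c) \<in> D}. 1 + g c)" for i
          by (simp add: scale_on_def \<gamma>g)
        moreover have "?x \<in> pos_orthant" using True xpos by simp
        ultimately have "inv_dirichlet_kernel E ?\<alpha> \<beta> ?x * ?J =
            (\<Prod>i\<in>UNIV. g i powr (\<alpha> i - 1) * (1 + g i) powr (- \<beta> + (\<Sum>p\<in>parents D i. \<alpha> p)))"
          using kernel_along_orientation[of "\<lambda>i. 1 + g i" g "- \<beta>" D \<alpha>] g
          by (simp add: inv_dirichlet_kernel_def \<gamma>g add_pos_pos)
        moreover have "(\<Prod>i\<in>UNIV. beta_prime_density (\<alpha> i) (b i) (g i)) =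
            1 / C * (\<Prod>i\<in>UNIV. g i powr (\<alpha> i - 1) * (1 + g i) powr (- \<beta> + (\<Sum>p\<in>parents D i. \<alpha> p)))"
          using g by (simp add: beta_prime_density_def prod_dividef C_def b_def algebra_simps)
        ultimately have "1 / C * inv_dirichlet_kernel E ?\<alpha> \<beta> ?x * ?J = (\<Prod>i\<in>UNIV. beta_prime_density (\<alpha> i) (b i) (g i))"
          by (simp add: mult.assoc)
        moreover have "?J \<ge> 0" using \<gamma>pos by (intro prod_nonneg) (auto intro: less_imp_le)
        ultimately show ?thesis
          using beta_prime_density_nonneg[OF apos bp] by (simp add: ennreal_mult''[symmetric] prod_ennreal)
      next
        case False
        then have "?k ?x = 0" using xpos by (simp add: inv_dirichlet_kernel_def)
        moreover obtain i where "\<not> 0 < g i" using False by blast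
        then have "beta_prime_density (\<alpha> i) (b i) (g i) = 0" by (auto simp: beta_prime_density_def)
        then have "(\<Prod>i\<in>UNIV. ennreal (beta_prime_density (\<alpha> i) (b i) (g i))) = 0"
          by (intro prod_zero bexI[of _ i]) auto
        ultimately show ?thesis by simp
      qed
    qed (use Y in measurable)
    then have "has_IDir M Y E ?\<alpha> \<beta>" unfolding has_IDir_def using C by (intro exI[of _ "1 / C"]) simp
    moreover have "?\<alpha> \<in> pos_orthant" using apos by (simp add: pos_orthant_def)
    ultimately show ?thesis using Max by blast
  qed
qed

end

theorem theorem7p1:
  fixes E :: "('v::finite) rel"
  assumes "simple_graph E" and "chordal E" and "connected_graph E" and "CARD('v) \<ge> 2"
  shows
    "(\<forall>(M :: 'a measure) (X :: 'a \<Rightarrow> real^'v).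
        prob_space M \<and> X \<in> borel_measurable M \<and> (\<forall>\<omega>\<in>space M. X \<omega> \<in> M_set E) \<and>
        nondegenerate M X \<and>
        (\<forall>D. moral_dag E D \<longrightarrow>
           prob_space.indep_vars M (\<lambda>_. borel) (\<lambda>i \<omega>. u E D i (X \<omega>)) UNIV)
        \<longrightarrow> (\<exists>\<alpha> \<beta>. \<alpha> \<in> pos_orthant \<and> \<beta> > 0 \<and> has_Dir M X E \<alpha> \<beta>))
     \<and>
     (\<forall>(M :: 'b measure) (Y :: 'b \<Rightarrow> real^'v).
        prob_space M \<and> Y \<in> borel_measurable M \<and> (\<forall>\<omega>\<in>space M. Y \<omega> \<in> pos_orthant) \<and>
        nondegenerate M Y \<and>
        (\<forall>D. moral_dag E D \<longrightarrow>
           prob_space.indep_vars M (\<lambda>_. borel) (\<lambda>i \<omega>. w E D i (Y \<omega>)) UNIV)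
        \<longrightarrow> (\<exists>\<alpha> \<beta>. \<alpha> \<in> pos_orthant \<and>
               \<beta> > Max ((\<lambda>C. \<Sum>i\<in>C. \<alpha> $ i) ` maximal_cliques UNIV E) \<and> has_IDir M Y E \<alpha> \<beta>))"
proof (intro conjI allI impI)
  fix M :: "'a measure" and X :: "'a \<Rightarrow> real^'v"
  assume A: "prob_space M \<and> X \<in> borel_measurable M \<and> (\<forall>\<omega>\<in>space M. X \<omega> \<in> M_set E) \<and> nondegenerate M X \<and>
    (\<forall>D. moral_dag E D \<longrightarrow> prob_space.indep_vars M (\<lambda>_. borel) (\<lambda>i \<omega>. u E D i (X \<omega>)) UNIV)"
  then interpret prob_space M by blast
  show "\<exists>\<alpha> \<beta>. \<alpha> \<in> pos_orthant \<and> \<beta> > 0 \<and> has_Dir M X E \<alpha> \<beta>"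
    by (rule Dirichlet_characterization[OF assms]) (use A in auto)
next
  fix M :: "'b measure" and Y :: "'b \<Rightarrow> real^'v"
  assume A: "prob_space M \<and> Y \<in> borel_measurable M \<and> (\<forall>\<omega>\<in>space M. Y \<omega> \<in> pos_orthant) \<and> nondegenerate M Y \<and>
    (\<forall>D. moral_dag E D \<longrightarrow> prob_space.indep_vars M (\<lambda>_. borel) (\<lambda>i \<omega>. w E D i (Y \<omega>)) UNIV)"
  then interpret prob_space M by blast
  show "\<exists>\<alpha> \<beta>. \<alpha> \<in> pos_orthant \<and> \<beta> > Max ((\<lambda>C. \<Sum>i\<in>C. \<alpha> $ i) ` maximal_cliques UNIV E) \<and> has_IDir M Y E \<alpha> \<beta>"
    by (rule inverted_Dirichlet_characterization[OF assms]) (use A in auto)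
qed

end
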